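(* Let $N\ge 1$, $1\le m\le N$, $A\in\mathbb R^{N\times N}$, $B\in\mathbb R^{N\times m}$. Assume that $A$ is diagonalizable over $\mathbb R$ and that $(A,B)$ satisfies the Kalman rank condition with Kalman index $K$. Then there exists a constant $C_*>0$, depending only on $A$, $B$ and $K$, such that for every $T>0$, every $q_T\in\mathcal Y_K^-$ and the corresponding solution $q$ of the adjoint system, $$\|q_T\|_{\mathcal Y_K^-}^2\le C_*\max\left\{\frac1T,\frac1{T^{2K+1}}\right\}\int_0^T\int_{\mathbb R}|B^\top q(t,x)|^2\,dx\,dt .$$ Moreover, this time dependence is optimal: if $C_{\rm obs}(T)$ denotes the smallest constant $C$ such that $\|q_T\|_{\mathcal Y_K^-}^2\le C\int_0^T\int_{\mathbb R}|B^\top q|^2\,dx\,dt$ for all $q_T\in\mathcal Y_K^-$, then there exists $c>0$, independent of $T$, such that $C_{\rm obs}(T)\ge c\max\{T^{-1},T^{-(2K+1)}\}$ for every $T>0$.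
   Context: Fourier convention: $\widehat f(\xi)=\int_{\mathbb R}f(x)e^{-ix\xi}\,dx$. Kalman rank condition with Kalman index $K$: $K\ge0$ is the smallest integer such that $\operatorname{rank}(B,AB,\dots,A^KB)=N$. Kalman layers: $\mathcal K_k=\operatorname{Ran}(B,AB,\dots,A^kB)\subset\mathbb R^N$, $\mathcal K_{-1}=\{0\}$, $\mathcal V_k=\mathcal K_k\cap\mathcal K_{k-1}^\perp$ for $k=0,\dots,K$ (orthogonality for the Euclidean inner product), so $\mathbb R^N=\bigoplus_{k=0}^K\mathcal V_k$; $\Pi_k$ is the orthogonal projector onto $\mathcal V_k$, extended complex-linearly to $\mathbb C^N$. Weights: $\rho_k(\xi)=\min\{|\xi|^{2k},1\}$. The space $\mathcal Y_K^-$ is the Hilbert completion of the Schwartz space $\mathcal S(\mathbb R;\mathbb C^N)$ for the norm $\|q\|_{\mathcal Y_K^-}^2=\sum_{k=0}^K\int_{\mathbb R}\rho_k(\xi)|\Pi_k\widehat q(\xi)|^2\,d\xi$; it is identified, on the Fourier side, with the space of (classes of) measurable $\widehat q:\mathbb R\to\mathbb C^N$ for which this quantity is finite. Adjoint system: $q_t+A^\top q_x=0$ in $(0,T)\times\mathbb R$, $q(T,\cdot)=q_T$; its solution satisfies $\widehat q(t,\xi)=e^{i\xi(T-t)A^\top}\widehat q_T(\xi)$. For $q_T\in\mathcal Y_K^-$ the solution is understood by completion from Schwartz data (same Fourier formula), and $B^\top q$ is understood as the continuous extension, from $\mathcal S(\mathbb R;\mathbb C^N)$ to $\mathcal Y_K^-$,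 of the map $q_T\mapsto B^\top q\in L^2((0,T)\times\mathbb R;\mathbb C^m)$. *)

theory Defs
  imports "HOL-Analysis.Analysis"
begin

section \<open>Kalman structure\<close>

definition diagonalizable_over_reals :: "real^'n^'n \<Rightarrow> bool" where
  "diagonalizable_over_reals A \<longleftrightarrow>
     (\<exists>P D :: real^'n^'n. invertible P \<and> (\<forall>i j. i \<noteq> j \<longrightarrow> D $ i $ j = 0) \<and> A = P ** D ** matrix_inv P)"

text \<open>The block \<open>A^j B\<close>, as iterated matrix product (a power operation on the type
  of matrices would be entrywise).\<close>
definition kalman_block :: "real^'n^'n \<Rightarrow> real^'m^'n \<Rightarrow> nat \<Rightarrow> real^'m^'n" where
  "kalman_block A B j = (((**) A) ^^ j) B"

text \<open>The number of columns of \<open>(B, AB, \<dots>, A^k B)\<close> depends on \<open>k\<close>, so the block matrix is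
  represented by its set of columns; range and rank are the span and the dimension of that set
  (as in the library fact \<open>column_rank_def\<close>).\<close>
definition kalman_columns :: "real^'n^'n \<Rightarrow> real^'m^'n \<Rightarrow> nat \<Rightarrow> (real^'n) set" where
  "kalman_columns A B k = (\<Union>j\<le>k. columns (kalman_block A B j))"

definition kalman_rank :: "real^'n^'n \<Rightarrow> real^'m^'n \<Rightarrow> nat \<Rightarrow> nat" where
  "kalman_rank A B k = dim (kalman_columns A B k)"

definition kalman_index :: "real^'n^'n \<Rightarrow> real^'m^'n \<Rightarrow> nat \<Rightarrow> bool" where
  "kalman_index A B K \<longleftrightarrow>
     kalman_rank A B K = CARD('n) \<and> (\<forall>k<K. kalman_rank A B k \<noteq> CARD('n))"

definition kalman_space :: "real^'n^'n \<Rightarrow> real^'m^'n \<Rightarrow> nat \<Rightarrow> (real^'n) set" where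
  "kalman_space A B k = span (kalman_columns A B k)"

text \<open>The case \<open>k = 0\<close> uses the convention that the space with index \<open>-1\<close> is \<open>{0}\<close>.\<close>
definition kalman_layer :: "real^'n^'n \<Rightarrow> real^'m^'n \<Rightarrow> nat \<Rightarrow> (real^'n) set" where
  "kalman_layer A B k =
     kalman_space A B k \<inter> (case k of 0 \<Rightarrow> {0} | Suc j \<Rightarrow> kalman_space A B j)\<^sup>\<bottom>"

definition orth_proj :: "'a::euclidean_space set \<Rightarrow> 'a \<Rightarrow> 'a" where
  "orth_proj V x = (THE y. y \<in> V \<and> (\<forall>z\<in>V. orthogonal (x - y) z))"

definition complexify :: "(real^'n \<Rightarrow> real^'n) \<Rightarrow> complex^'n \<Rightarrow> complex^'n" where
  "complexify L v =
     (\<chi> i. Complex (L (\<chi> j. Re (v $ j)) $ i) (L (\<chi> j. Im (v $ j)) $ i))"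

definition kalman_proj :: "real^'n^'n \<Rightarrow> real^'m^'n \<Rightarrow> nat \<Rightarrow> complex^'n \<Rightarrow> complex^'n" where
  "kalman_proj A B k = complexify (orth_proj (kalman_layer A B k))"

definition kalman_weight :: "nat \<Rightarrow> real \<Rightarrow> real" where
  "kalman_weight k \<xi> = min (\<bar>\<xi>\<bar> ^ (2 * k)) 1"


section \<open>Schwartz functions, Fourier transform and the weighted space\<close>

text \<open>\<open>F j\<close> is the \<open>j\<close>-th derivative of \<open>f\<close>.\<close>
definition schwartz :: "(real \<Rightarrow> complex^'n) \<Rightarrow> bool" where
  "schwartz f \<longleftrightarrow>
     (\<exists>F. F 0 = f \<and>
        (\<forall>j x. (F j has_vector_derivative F (Suc j) x) (at x)) \<and>
        (\<forall>j l. bounded (range (\<lambda>x. \<bar>x\<bar> ^ l *\<^sub>R F j x))))"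

definition fourier :: "(real \<Rightarrow> complex^'n) \<Rightarrow> real \<Rightarrow> complex^'n" where
  "fourier f \<xi> = (LINT x|lborel. exp (- (\<i> * of_real x * of_real \<xi>)) *s f x)"

definition Y_sqnorm ::
  "real^'n^'n \<Rightarrow> real^'m^'n \<Rightarrow> nat \<Rightarrow> (real \<Rightarrow> complex^'n) \<Rightarrow> ennreal" where
  "Y_sqnorm A B K g =
     (\<Sum>k\<le>K. \<integral>\<^sup>+\<xi>. ennreal (kalman_weight k \<xi> * (norm (kalman_proj A B k (g \<xi>)))\<^sup>2) \<partial>lborel)"

text \<open>Elements of the completion are given on the Fourier side, by representatives of
  almost-everywhere classes: a member \<open>g\<close> plays the role of the Fourier transform of \<open>q_T\<close>.\<close>
definition Y_space ::
  "real^'n^'n \<Rightarrow> real^'m^'n \<Rightarrow> nat \<Rightarrow> (real \<Rightarrow> complex^'n) set" where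
  "Y_space A B K = {g \<in> borel_measurable lborel. Y_sqnorm A B K g < \<infinity>}"


section \<open>Adjoint system and observation\<close>

definition complex_matrix :: "real^'n^'m \<Rightarrow> complex^'n^'m" where
  "complex_matrix = map_matrix complex_of_real"

text \<open>Classical solutions of \<open>q_t + A\<^sup>T q_x = 0\<close> on the strip, with arguments \<open>(t, x)\<close>:
  the partial derivatives are the values of the total derivative at \<open>(1, 0)\<close> and \<open>(0, 1)\<close>.\<close>
definition adjoint_solution ::
  "real^'n^'n \<Rightarrow> real \<Rightarrow> (real \<Rightarrow> complex^'n) \<Rightarrow> (real \<times> real \<Rightarrow> complex^'n) \<Rightarrow> bool" where
  "adjoint_solution A T qT q \<longleftrightarrow>
     continuous_on ({0..T} \<times> UNIV) q \<and>
     (\<forall>t\<in>{0<..<T}. \<forall>x. \<exists>q'. (q has_derivative q') (at (t, x)) \<and>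
        q' (1, 0) + complex_matrix (transpose A) *v q' (0, 1) = 0) \<and>
     (\<forall>x. q (T, x) = qT x)"

definition obs_energy :: "real \<Rightarrow> (real \<times> real \<Rightarrow> complex^'m) \<Rightarrow> ennreal" where
  "obs_energy T w =
     (\<integral>\<^sup>+t\<in>{0<..<T}. (\<integral>\<^sup>+x. ennreal ((norm (w (t, x)))\<^sup>2) \<partial>lborel) \<partial>lborel)"

text \<open>\<open>Obs\<close> is the continuous extension to \<open>Y_space\<close>, with values in
  \<open>L\<^sup>2((0,T) \<times> \<real>; \<complex>\<^sup>m)\<close>, of the map sending Schwartz data \<open>q_T\<close> to \<open>B\<^sup>T q\<close>.\<close>
definition is_observation_map ::
  "real^'n^'n \<Rightarrow> real^'m^'n \<Rightarrow> nat \<Rightarrow> real \<Rightarrow>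
   ((real \<Rightarrow> complex^'n) \<Rightarrow> real \<times> real \<Rightarrow> complex^'m) \<Rightarrow> bool" where
  "is_observation_map A B K T Obs \<longleftrightarrow>
     (\<forall>g\<in>Y_space A B K. Obs g \<in> borel_measurable lborel \<and> obs_energy T (Obs g) < \<infinity>) \<and>
     (\<forall>qT q. schwartz qT \<longrightarrow> adjoint_solution A T qT q \<longrightarrow>
        (AE z in lborel. z \<in> {0<..<T} \<times> UNIV \<longrightarrow>
           Obs (fourier qT) z = complex_matrix (transpose B) *v q z)) \<and>
     (\<forall>g\<in>Y_space A B K. \<forall>G. (\<forall>n. G n \<in> Y_space A B K) \<longrightarrow>
        (\<lambda>n. Y_sqnorm A B K (\<lambda>\<xi>. G n \<xi> - g \<xi>)) \<longlonglongrightarrow> 0 \<longrightarrow>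
        (\<lambda>n. obs_energy T (\<lambda>z. Obs (G n) z - Obs g z)) \<longlonglongrightarrow> 0)"

text \<open>By density of the Schwartz data, the extension is unique up to null sets on the strip,
  so the choice of representatives does not affect \<open>obs_energy\<close>.\<close>
definition observation ::
  "real^'n^'n \<Rightarrow> real^'m^'n \<Rightarrow> nat \<Rightarrow> real \<Rightarrow>
   (real \<Rightarrow> complex^'n) \<Rightarrow> real \<times> real \<Rightarrow> complex^'m" where
  "observation A B K T = (SOME Obs. is_observation_map A B K T Obs)"

definition observability_inequality ::
  "real^'n^'n \<Rightarrow> real^'m^'n \<Rightarrow> nat \<Rightarrow> real \<Rightarrow> real \<Rightarrow> bool" where
  "observability_inequality A B K T C \<longleftrightarrow>
     (\<forall>g\<in>Y_space A B K. Y_sqnorm A B K g \<le> ennreal C * obs_energy T (observation A B K T g))"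

text \<open>The bound \<open>0 \<le> C\<close> only excludes the values that \<^const>\<open>ennreal\<close> truncates to \<open>0\<close>.\<close>
definition C_obs :: "real^'n^'n \<Rightarrow> real^'m^'n \<Rightarrow> nat \<Rightarrow> real \<Rightarrow> real" where
  "C_obs A B K T = (LEAST C. 0 \<le> C \<and> observability_inequality A B K T C)"

end

theory Submission
  imports Defs "HOL-Probability.Probability"
begin

text \<open>At each frequency \<open>\<xi>\<close> the adjoint system is a linear ordinary differential equation with
  propagator \<open>e\<^bsup>i\<xi>(T-t)A\<^sup>T\<^esup>\<close>, so Plancherel and the substitution \<open>t = T - T r\<close> turn the observed energy of
  a datum with transform \<open>g\<close> into
  \<open>(1/2\<pi>) \<integral> T G(T\<xi>, g(\<xi>)) d\<xi>\<close> with the Gramian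
  \<open>G(\<theta>, v) = \<integral>\<^sub>0\<^sup>1 |B\<^sup>T e\<^bsup>i\<theta>rA\<^sup>T\<^esup> v|\<^sup>2 dr\<close>
  (\<open>obs_energy_observed_flow\<close>). Everything therefore rests on one statement about matrices,
  \<open>energy_density_bounds\<close>: \<open>G(\<theta>, v)\<close> is comparable to
  \<open>\<Sum>\<^sub>k min(|\<theta>|\<^bsup>2k\<^esup>, 1) |\<Pi>\<^sub>k v|\<^sup>2\<close>, with constants that do not depend on \<open>\<theta>\<close>.

  For \<open>|\<theta>| \<le> 1\<close> the reason is that \<open>B\<^sup>T (A\<^sup>T)\<^sup>j\<close> annihilates the \<open>k\<close>-th layer for
  \<open>j < k\<close>, so the exponential series acting on that layer starts at order \<open>\<theta>\<^sup>k\<close>. After each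
  layer is divided by its power of \<open>\<theta>\<close> the observation extends continuously to \<open>\<theta> = 0\<close>,
  it is injective for every \<open>\<theta>\<close> by the Kalman condition (at \<open>\<theta> = 0\<close> it is a polynomial in \<open>r\<close>
  whose coefficients see the layers one by one), and compactness gives uniform bounds. For
  \<open>|\<theta>| > 1\<close> the unit interval is cut into about \<open>|\<theta>|\<close> pieces on each of which the first
  case applies; real diagonalizability keeps the norm of \<open>e\<^bsup>i\<sigma>A\<^sup>T\<^esup> v\<close> comparable to that of \<open>v\<close> along the way.

  Comparing \<open>min(|T\<xi>|\<^bsup>2k\<^esup>, 1)\<close> with \<open>min(|\<xi>|\<^bsup>2k\<^esup>, 1)\<close> loses the factor
  \<open>min(1, T\<^bsup>2K\<^esup>)\<close>, which together with the factor \<open>T\<close> in front of the Gramian is exactly the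
  reciprocal of \<open>max(1/T, 1/T\<^bsup>2K+1\<^esup>)\<close>. Up to a constant the loss is attained by data in the top layer with
  frequencies in \<open>[1, 2]\<close>, which yields optimality.

  The observation of a general element of the weighted space is only specified as a continuous
  extension, so the extension has to be constructed and its energy computed. Transforms of
  Schwartz functions are dense (\<open>schwartz_dense\<close>), the observation is bounded on them, and a
  fast Cauchy sequence in \<open>L\<^sup>2\<close> converges (\<open>L2_limit_of_fast_Cauchy\<close>); this gives
  \<open>observation_map_exists\<close>. Since constants are irrelevant, the energy of any such extension only
  needs to be known up to a factor (\<open>observation_energy_equiv\<close>), and
  \<open>|a|\<^sup>2 \<le> 2|b|\<^sup>2 + 2|a - b|\<^sup>2\<close> replaces the triangle inequality throughout. Plancherel and
  density both come from Gaussian regularization of the inversion formula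
  (\<open>gaussian_regularized_inversion\<close>).\<close>

section \<open>Gaussian regularization and Plancherel's identity\<close>

abbreviation L2sq :: "'a measure \<Rightarrow> ('a \<Rightarrow> 'b::real_normed_vector) \<Rightarrow> ennreal" where
  "L2sq M f \<equiv> \<integral>\<^sup>+x. ennreal ((norm (f x))\<^sup>2) \<partial>M"

abbreviation gaussian_mean :: "(real \<Rightarrow> complex) \<Rightarrow> complex" where
  "gaussian_mean f \<equiv> LINT z|lborel. of_real (std_normal_density z) * f z"

definition fourier1 :: "(real \<Rightarrow> complex) \<Rightarrow> real \<Rightarrow> complex" where
  "fourier1 f \<xi> = (LINT x|lborel. exp (- (\<i> * of_real x * of_real \<xi>)) * f x)"

lemma norm_iexp [simp]: "norm (exp (\<i> * complex_of_real x)) = 1"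
  "norm (exp (- (\<i> * complex_of_real x))) = 1"
  "norm (exp (- (\<i> * complex_of_real x * complex_of_real y))) = 1"
  by (simp_all add: norm_exp_eq_Re)

lemma borel_measurable_cnj [measurable (raw)]:
  "f \<in> borel_measurable M \<Longrightarrow> (\<lambda>x. cnj (f x)) \<in> borel_measurable M"
  using measurable_compose[OF _ borel_measurable_continuous_onI[OF continuous_on_cnj[OF continuous_on_id]]] by auto

text \<open>The characteristic function of the standard normal law, rescaled by \<open>s\<close>.\<close>
lemma gaussian_fourier:
  fixes s t :: real
  assumes s: "s > 0"
  shows "(LINT x|lborel. iexp (t * x) * of_real (exp (- (s * x)\<^sup>2 / 2)))
     = of_real (sqrt (2 * pi) / s * exp (- (t / s)\<^sup>2 / 2))"
proof -
  have c: "(LINT x|lborel. std_normal_density x *\<^sub>R iexp (u * x)) = of_real (exp (- u\<^sup>2 / 2))" for u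
  proof -
    have "char std_normal_distribution u = (LINT x|lborel. std_normal_density x *\<^sub>R iexp (u * x))"
      unfolding char_def by (subst integral_density) auto
    then show ?thesis by (simp add: char_std_normal_distribution)
  qed
  have "(LINT x|lborel. iexp (t / s * x) * of_real (exp (- x\<^sup>2 / 2)))
      = (LINT x|lborel. of_real (sqrt (2 * pi)) * (std_normal_density x *\<^sub>R iexp (t / s * x)))"
    by (intro Bochner_Integration.integral_cong refl)
      (simp add: std_normal_density_def scaleR_conv_of_real field_simps)
  also have "\<dots> = of_real (sqrt (2 * pi)) * of_real (exp (- (t / s)\<^sup>2 / 2))"
    by (subst integral_mult_right_zero) (simp only: c)
  finally have 1: "(LINT x|lborel. iexp (t / s * x) * of_real (exp (- x\<^sup>2 / 2)))
      = of_real (sqrt (2 * pi)) * of_real (exp (- (t / s)\<^sup>2 / 2))" .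
  have "(LINT x|lborel. iexp (t / s * x) * of_real (exp (- x\<^sup>2 / 2)))
      = \<bar>s\<bar> *\<^sub>R (LINT x|lborel. iexp (t / s * (0 + s * x)) * of_real (exp (- (0 + s * x)\<^sup>2 / 2)))"
    using s by (intro lborel_integral_real_affine) simp
  also have "\<dots> = s *\<^sub>R (LINT x|lborel. iexp (t * x) * of_real (exp (- (s * x)\<^sup>2 / 2)))"
    using s by simp
  finally show ?thesis
    using s unfolding 1 by (simp add: scaleR_conv_of_real field_simps)
qed

lemma integrable_gaussian:
  fixes s :: real
  assumes s: "s > 0"
  shows "integrable lborel (\<lambda>x. exp (- (s * x)\<^sup>2 / 2))"
proof -
  have "integrable lborel (\<lambda>x::real. sqrt (2 * pi) * (std_normal_density x * x ^ 0))"
    by (intro integrable_mult_right integrable_std_normal_moment)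
  then have "integrable lborel (\<lambda>x::real. exp (- x\<^sup>2 / 2))"
    by (simp add: std_normal_density_def)
  then have "integrable lborel (\<lambda>x::real. exp (- (0 + s * x)\<^sup>2 / 2))"
    using s by (subst lborel_integrable_real_affine_iff[where f = "\<lambda>x. exp (- x\<^sup>2 / 2)"]) auto
  then show ?thesis by simp
qed

text \<open>The Gaussian factor makes the double integral absolutely convergent; Fubini then leaves the
  transform of the Gaussian, which is again a Gaussian, of width \<open>s\<close>, centred at \<open>\<eta>\<close>. As \<open>s\<close>
  tends to \<open>0\<close> the right-hand side becomes \<open>2\<pi> h(\<eta>)\<close>, so this replaces Fourier inversion both in
  Plancherel's identity and in the density of Schwartz functions.\<close>
lemma gaussian_regularized_inversion:
  fixes h :: "real \<Rightarrow> complex" and s \<eta> :: real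
  assumes h: "integrable lborel h" and s: "s > 0"
  shows "(LINT x|lborel. iexp (- (x * \<eta>)) * of_real (exp (- (s * x)\<^sup>2 / 2)) * (LINT y|lborel. iexp (y * x) * h y))
     = of_real (2 * pi) * (gaussian_mean (\<lambda>z. h (\<eta> + s * z)))"
proof -
  have [measurable]: "h \<in> borel_measurable borel" using h by auto
  let ?F = "\<lambda>x y. iexp (- (x * \<eta>)) * of_real (exp (- (s * x)\<^sup>2 / 2)) * (iexp (y * x) * h y)"
  have nF: "norm (?F x y) = exp (- (s * x)\<^sup>2 / 2) * norm (h y)" for x y
    unfolding norm_mult by (simp del: of_real_mult of_real_minus)
  have int: "integrable (lborel \<Otimes>\<^sub>M lborel) (case_prod ?F)"
  proof (rule lborel_pair.Fubini_integrable)
    have m1: "(\<lambda>y. ?F x y) \<in> borel_measurable borel" for x by measurable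
    show "integrable lborel (\<lambda>x. LINT y|lborel. norm (case (x, y) of (x, y) \<Rightarrow> ?F x y))"
      unfolding prod.case nF using integrable_gaussian[OF s] h by simp
    show "AE x in lborel. integrable lborel (\<lambda>y. case (x, y) of (x, y) \<Rightarrow> ?F x y)"
    proof (rule AE_I2)
      fix x
      show "integrable lborel (\<lambda>y. case (x, y) of (x, y) \<Rightarrow> ?F x y)"
        unfolding prod.case
        by (rule Bochner_Integration.integrable_bound[where f = "\<lambda>y. exp (- (s * x)\<^sup>2 / 2) * norm (h y)"])
          (use h m1 in \<open>simp_all only: nF, auto\<close>)
    qed
  qed simp
  have "(LINT x|lborel. iexp (- (x * \<eta>)) * of_real (exp (- (s * x)\<^sup>2 / 2)) * (LINT y|lborel. iexp (y * x) * h y))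
      = (LINT x|lborel. LINT y|lborel. ?F x y)"
    by (simp only: integral_mult_right_zero)
  also have "\<dots> = (LINT y|lborel. LINT x|lborel. ?F x y)"
    by (rule lborel_pair.Fubini_integral[OF int, symmetric])
  also have "\<dots> = (LINT y|lborel. h y * of_real (sqrt (2 * pi) / s * exp (- ((y - \<eta>) / s)\<^sup>2 / 2)))"
  proof (intro Bochner_Integration.integral_cong refl)
    fix y
    have "(LINT x|lborel. ?F x y)
        = (LINT x|lborel. h y * (iexp ((y - \<eta>) * x) * of_real (exp (- (s * x)\<^sup>2 / 2))))"
    proof (intro Bochner_Integration.integral_cong refl)
      fix x
      have "iexp ((y - \<eta>) * x) = iexp (- (x * \<eta>)) * iexp (y * x)"
        by (simp add: exp_add[symmetric] algebra_simps)
      then show "?F x y = h y * (iexp ((y - \<eta>) * x) * of_real (exp (- (s * x)\<^sup>2 / 2)))"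
        by (simp only: ac_simps)
    qed
    also have "\<dots> = h y * of_real (sqrt (2 * pi) / s * exp (- ((y - \<eta>) / s)\<^sup>2 / 2))"
      by (simp only: integral_mult_right_zero gaussian_fourier[OF s])
    finally show "(LINT x|lborel. ?F x y) = \<dots>" .
  qed
  also have "\<dots> = \<bar>s\<bar> *\<^sub>R (LINT z|lborel. h (\<eta> + s * z) * of_real (sqrt (2 * pi) / s * exp (- ((\<eta> + s * z - \<eta>) / s)\<^sup>2 / 2)))"
    using s by (intro lborel_integral_real_affine) simp
  also have "\<dots> = (LINT z|lborel. s *\<^sub>R (h (\<eta> + s * z) * of_real (sqrt (2 * pi) / s * exp (- ((\<eta> + s * z - \<eta>) / s)\<^sup>2 / 2))))"
    using s by (simp only: integral_scaleR_right abs_of_pos)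
  also have "\<dots> = (LINT z|lborel. of_real (2 * pi) * (of_real (std_normal_density z) * h (\<eta> + s * z)))"
  proof (intro Bochner_Integration.integral_cong refl)
    fix z
    have "s * (sqrt (2 * pi) / s * exp (- ((\<eta> + s * z - \<eta>) / s)\<^sup>2 / 2)) = 2 * pi * std_normal_density z"
      using s by (simp add: std_normal_density_def field_simps)
    then have "complex_of_real s * of_real (sqrt (2 * pi) / s * exp (- ((\<eta> + s * z - \<eta>) / s)\<^sup>2 / 2)) = of_real (2 * pi) * of_real (std_normal_density z)"
      by (metis of_real_mult)
    then show "s *\<^sub>R (h (\<eta> + s * z) * of_real (sqrt (2 * pi) / s * exp (- ((\<eta> + s * z - \<eta>) / s)\<^sup>2 / 2)))
      = of_real (2 * pi) * (of_real (std_normal_density z) * h (\<eta> + s * z))"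
      unfolding scaleR_conv_of_real mult.left_commute[of "of_real s"] by (simp only: ac_simps)
  qed
  also have "\<dots> = of_real (2 * pi) * (gaussian_mean (\<lambda>z. h (\<eta> + s * z)))"
    by (simp only: integral_mult_right_zero)
  finally show ?thesis .
qed

lemma integrable_std_normal_density: "integrable lborel std_normal_density"
  using integrable_std_normal_moment[of 0] by simp

lemma integral_std_normal_density: "(LINT z|lborel. std_normal_density z) = 1"
  using integral_std_normal_moment_even[of 0] by simp

lemma fourier1_measurable [measurable]:
  assumes [measurable]: "f \<in> borel_measurable borel"
  shows "fourier1 f \<in> borel_measurable borel"
  unfolding fourier1_def by measurable

lemma norm_fourier1_le:
  assumes "integrable lborel f"
  shows "norm (fourier1 f \<xi>) \<le> (LINT x|lborel. norm (f x))"
  unfolding fourier1_def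
  by (rule order.trans[OF integral_norm_bound]) (simp add: norm_mult)

text \<open>Fubini moves one of the two transforms onto the weighted conjugate of the other, where the
  regularized inversion formula evaluates it.\<close>
lemma plancherel_gaussian:
  fixes f :: "real \<Rightarrow> complex"
  assumes f: "integrable lborel f" and s: "s > 0"
  shows "(LINT x|lborel. of_real (exp (- (s * x)\<^sup>2 / 2)) * (fourier1 f x * cnj (fourier1 f x)))
      = of_real (2 * pi) * (LINT x|lborel. f x * (gaussian_mean (\<lambda>z. cnj (f (x + s * z)))))"
proof -
  have [measurable]: "f \<in> borel_measurable borel" using f by auto
  have c: "cnj (fourier1 f x) = (LINT y|lborel. iexp (y * x) * cnj (f y))" for x
  proof -
    have "(LINT y|lborel. iexp (y * x) * cnj (f y)) = (LINT y|lborel. cnj (exp (- (\<i> * of_real y * of_real x)) * f y))"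
      by (intro Bochner_Integration.integral_cong refl) (simp add: exp_cnj mult.assoc)
    also have "\<dots> = cnj (LINT y|lborel. exp (- (\<i> * of_real y * of_real x)) * f y)"
      by (rule Bochner_Integration.integral_cnj)
    finally show ?thesis by (simp add: fourier1_def)
  qed
  have [measurable]: "(\<lambda>x. LINT y|lborel. iexp (y * x) * cnj (f y)) \<in> borel_measurable borel"
    unfolding c[symmetric] by measurable
  let ?G = "\<lambda>x. of_real (exp (- (s * x)\<^sup>2 / 2)) * (LINT y|lborel. iexp (y * x) * cnj (f y))"
  have [measurable]: "?G \<in> borel_measurable borel" by measurable
  let ?F = "\<lambda>x y. iexp (- (x * y)) * f y * ?G x"
  have "integrable lborel ?G"
  proof (rule Bochner_Integration.integrable_bound)
    show "integrable lborel (\<lambda>x. (LINT x|lborel. norm (f x)) * exp (- (s * x)\<^sup>2 / 2))"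
      by (intro integrable_mult_right integrable_gaussian s)
    show "AE x in lborel. norm (?G x) \<le> norm ((LINT x|lborel. norm (f x)) * exp (- (s * x)\<^sup>2 / 2))"
    proof (rule AE_I2)
      fix x
      have "norm (?G x) = norm (fourier1 f x) * exp (- (s * x)\<^sup>2 / 2)"
        unfolding c[symmetric] by (simp add: norm_mult)
      also have "\<dots> \<le> (LINT x|lborel. norm (f x)) * exp (- (s * x)\<^sup>2 / 2)"
        by (intro mult_right_mono norm_fourier1_le f) auto
      finally show "norm (?G x) \<le> norm ((LINT x|lborel. norm (f x)) * exp (- (s * x)\<^sup>2 / 2))" by simp
    qed
  qed measurable
  have nF: "norm (?F x y) = norm (?G x) * norm (f y)" for x y
    by (simp only: norm_mult norm_iexp of_real_minus mult_minus_right mult_1_left mult.commute[of "norm (f y)"])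
  have int: "integrable (lborel \<Otimes>\<^sub>M lborel) (case_prod ?F)"
  proof (rule lborel_pair.Fubini_integrable)
    show "case_prod ?F \<in> borel_measurable (lborel \<Otimes>\<^sub>M lborel)"
      by measurable
    have m1: "(\<lambda>y. ?F x y) \<in> borel_measurable borel" for x by measurable
    show "integrable lborel (\<lambda>x. LINT y|lborel. norm (case (x, y) of (x, y) \<Rightarrow> ?F x y))"
      unfolding prod.case nF using f \<open>integrable lborel ?G\<close> by (simp only: integral_mult_right_zero integrable_mult_left integrable_norm)
    show "AE x in lborel. integrable lborel (\<lambda>y. case (x, y) of (x, y) \<Rightarrow> ?F x y)"
    proof (rule AE_I2)
      fix x
      show "integrable lborel (\<lambda>y. case (x, y) of (x, y) \<Rightarrow> ?F x y)"
        unfolding prod.case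
      proof (rule Bochner_Integration.integrable_bound[where f = "\<lambda>y. norm (?G x) * norm (f y)"])
        show "integrable lborel (\<lambda>y. norm (?G x) * norm (f y))" using f by auto
        show "?F x \<in> borel_measurable lborel" using m1 by simp
        show "AE y in lborel. norm (?F x y) \<le> norm (norm (?G x) * norm (f y))"
          unfolding nF by simp
      qed
    qed
  qed
  have "(LINT x|lborel. of_real (exp (- (s * x)\<^sup>2 / 2)) * (fourier1 f x * cnj (fourier1 f x)))
     = (LINT x|lborel. LINT y|lborel. ?F x y)"
  proof (intro Bochner_Integration.integral_cong refl)
    fix x
    have "(LINT y|lborel. ?F x y) = (LINT y|lborel. iexp (- (x * y)) * f y) * ?G x"
      by (rule integral_mult_left_zero)
    also have "(LINT y|lborel. iexp (- (x * y)) * f y) = fourier1 f x"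
      unfolding fourier1_def by (intro Bochner_Integration.integral_cong) (simp_all add: ac_simps)
    finally show "of_real (exp (- (s * x)\<^sup>2 / 2)) * (fourier1 f x * cnj (fourier1 f x)) = (LINT y|lborel. ?F x y)"
      unfolding c by (simp only: ac_simps)
  qed
  also have "\<dots> = (LINT y|lborel. LINT x|lborel. ?F x y)"
    by (rule lborel_pair.Fubini_integral[OF int, symmetric])
  also have "\<dots> = (LINT y|lborel. of_real (2 * pi) * (f y * (gaussian_mean (\<lambda>z. cnj (f (y + s * z))))))"
  proof (intro Bochner_Integration.integral_cong refl)
    fix y
    have "(LINT x|lborel. ?F x y) = f y * (LINT x|lborel. iexp (- (x * y)) * of_real (exp (- (s * x)\<^sup>2 / 2)) * (LINT y|lborel. iexp (y * x) * cnj (f y)))"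
      by (subst integral_mult_right_zero[symmetric]) (simp only: ac_simps)
    also have "\<dots> = f y * (of_real (2 * pi) * (gaussian_mean (\<lambda>z. cnj (f (y + s * z)))))"
      using f s by (subst gaussian_regularized_inversion) auto
    finally show "(LINT x|lborel. ?F x y) = of_real (2 * pi) * (f y * (gaussian_mean (\<lambda>z. cnj (f (y + s * z)))))"
      by (simp only: ac_simps)
  qed
  finally show ?thesis by (simp only: integral_mult_right_zero)
qed

text \<open>Let \<open>s = 1/(n+1)\<close> tend to \<open>0\<close> in \<open>plancherel_gaussian\<close>: the weights on the left increase
  to \<open>1\<close> (monotone convergence), and the Gaussian means on the right converge pointwise and are
  bounded because \<open>f\<close> is continuous and bounded (dominated convergence). In particular
  the transform of \<open>f\<close> is square integrable.\<close>
lemma plancherel_scalar: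
  fixes f :: "real \<Rightarrow> complex"
  assumes f: "integrable lborel f" and cont: "continuous_on UNIV f" and bd: "bounded (range f)"
  shows "L2sq lborel (fourier1 f) = ennreal (2 * pi) * L2sq lborel f"
proof -
  have [measurable]: "f \<in> borel_measurable borel" using f by auto
  obtain M where M: "\<And>x. norm (f x) \<le> M" using bd by (auto simp: bounded_iff)
  have M0: "0 \<le> M" using M[of 0] norm_ge_zero order.trans by blast
  let ?s = "\<lambda>n. 1 / real (Suc n)"
  let ?L = "\<lambda>n. (LINT x|lborel. of_real (exp (- (?s n * x)\<^sup>2 / 2)) * (fourier1 f x * cnj (fourier1 f x)))"
  let ?R = "\<lambda>n. (LINT x|lborel. f x * (gaussian_mean (\<lambda>z. cnj (f (x + ?s n * z)))))"
  have L: "?L n = of_real (LINT x|lborel. exp (- (?s n * x)\<^sup>2 / 2) * (norm (fourier1 f x))\<^sup>2)" for n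
    unfolding integral_complex_of_real[symmetric]
    by (simp only: of_real_mult complex_norm_square)
  have intL: "integrable lborel (\<lambda>x. exp (- (?s n * x)\<^sup>2 / 2) * (norm (fourier1 f x))\<^sup>2)" for n
    by (rule Bochner_Integration.integrable_bound[where f = "\<lambda>x. (LINT x|lborel. norm (f x))\<^sup>2 * exp (- (?s n * x)\<^sup>2 / 2)"])
      (use integrable_gaussian[of "?s n"] in \<open>auto intro!: AE_I2 power_mono norm_fourier1_le f mult_right_mono simp: abs_mult mult.commute\<close>)
  have inner: "(\<lambda>n. gaussian_mean (\<lambda>z. cnj (f (x + ?s n * z)))) \<longlonglongrightarrow> cnj (f x)" for x
  proof -
    have "(\<lambda>n. gaussian_mean (\<lambda>z. cnj (f (x + ?s n * z)))) \<longlonglongrightarrow> (gaussian_mean (\<lambda>z. cnj (f x)))"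
    proof (rule integral_dominated_convergence[where w = "\<lambda>z. M * std_normal_density z"])
      show "integrable lborel (\<lambda>z. M * std_normal_density z)" using integrable_std_normal_density by simp
      show "AE z in lborel. (\<lambda>n. of_real (std_normal_density z) * cnj (f (x + ?s n * z))) \<longlonglongrightarrow> of_real (std_normal_density z) * cnj (f x)"
      proof (rule AE_I2, intro tendsto_mult tendsto_const tendsto_cnj)
        fix z
        have "(\<lambda>n. x + ?s n * z) \<longlonglongrightarrow> x + 0 * z"
          by (intro tendsto_intros LIMSEQ_Suc[OF lim_1_over_n])
        then show "(\<lambda>n. f (x + ?s n * z)) \<longlonglongrightarrow> f x"
          using cont continuous_on_tendsto_compose[OF cont, of "\<lambda>n. x + ?s n * z" x] by simp
      qed
      show "AE z in lborel. norm (of_real (std_normal_density z) * cnj (f (x + ?s n * z))) \<le> M * std_normal_density z" for n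
        by (rule AE_I2) (simp add: norm_mult mult.commute[of M] mult_left_mono M del: times_divide_eq_left)
    qed measurable
    also have "(gaussian_mean (\<lambda>z. cnj (f x))) = cnj (f x)"
      by (subst integral_mult_left_zero) (simp add: integral_std_normal_density)
    finally show ?thesis .
  qed
  have mI[measurable]: "(\<lambda>x. (gaussian_mean (\<lambda>z. cnj (f (x + ?s n * z))))) \<in> borel_measurable borel" for n
    by measurable
  have bI: "norm (gaussian_mean (\<lambda>z. cnj (f (x + ?s n * z)))) \<le> M" for n x
  proof -
    have "norm (gaussian_mean (\<lambda>z. cnj (f (x + ?s n * z)))) \<le> (LINT z|lborel. norm (of_real (std_normal_density z) * cnj (f (x + ?s n * z))))"
      by (rule integral_norm_bound)
    also have "\<dots> \<le> (LINT z|lborel. M * std_normal_density z)"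
    proof (rule integral_mono')
      show "integrable lborel (\<lambda>z. M * std_normal_density z)" using integrable_std_normal_density by simp
      show "norm (of_real (std_normal_density z) * cnj (f (x + ?s n * z))) \<le> M * std_normal_density z" for z
        by (simp add: norm_mult mult.commute[of M] mult_left_mono M del: times_divide_eq_left)
      show "0 \<le> M * std_normal_density z" for z using M0 by simp
    qed
    finally show ?thesis by (simp add: integral_std_normal_density)
  qed
  have "?R \<longlonglongrightarrow> (LINT x|lborel. f x * cnj (f x))"
  proof (rule integral_dominated_convergence[where w = "\<lambda>x. norm (f x) * M"])
    show "AE x in lborel. (\<lambda>n. f x * (gaussian_mean (\<lambda>z. cnj (f (x + ?s n * z))))) \<longlonglongrightarrow> f x * cnj (f x)"
      by (intro AE_I2 tendsto_mult tendsto_const inner)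
    show "AE x in lborel. norm (f x * (gaussian_mean (\<lambda>z. cnj (f (x + ?s n * z))))) \<le> norm (f x) * M" for n
      by (rule AE_I2) (simp only: norm_mult mult_left_mono bI norm_ge_zero)
  qed (use f in auto)
  then have "(\<lambda>n. of_real (2 * pi) * ?R n) \<longlonglongrightarrow> of_real (2 * pi) * (LINT x|lborel. f x * cnj (f x))"
    by (intro tendsto_intros)
  then have "?L \<longlonglongrightarrow> of_real (2 * pi) * (LINT x|lborel. f x * cnj (f x))"
    by (subst plancherel_gaussian[OF f]) auto
  moreover have "(LINT x|lborel. f x * cnj (f x)) = of_real (LINT x|lborel. (norm (f x))\<^sup>2)"
    unfolding integral_complex_of_real[symmetric]
    by (simp only: complex_norm_square)
  ultimately have lim: "(\<lambda>n. LINT x|lborel. exp (- (?s n * x)\<^sup>2 / 2) * (norm (fourier1 f x))\<^sup>2) \<longlonglongrightarrow> 2 * pi * (LINT x|lborel. (norm (f x))\<^sup>2)"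
    unfolding L by (simp only: of_real_mult[symmetric] tendsto_of_real_iff)
  have int2: "integrable lborel (\<lambda>x. (norm (f x))\<^sup>2)"
    by (rule Bochner_Integration.integrable_bound[where f = "\<lambda>x. M * norm (f x)"])
       (use f M M0 in \<open>auto intro!: AE_I2 mult_right_mono simp: abs_mult power2_eq_square\<close>)
  have "(\<lambda>n. ennreal (LINT x|lborel. exp (- (?s n * x)\<^sup>2 / 2) * (norm (fourier1 f x))\<^sup>2)) \<longlonglongrightarrow> ennreal (2 * pi * (LINT x|lborel. (norm (f x))\<^sup>2))"
    by (intro tendsto_ennrealI lim)
  then have lim2: "(\<lambda>n. \<integral>\<^sup>+x. ennreal (exp (- (?s n * x)\<^sup>2 / 2) * (norm (fourier1 f x))\<^sup>2) \<partial>lborel) \<longlonglongrightarrow> ennreal (2 * pi * (LINT x|lborel. (norm (f x))\<^sup>2))"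
    by (subst nn_integral_eq_integral[OF intL]) auto
  have lim3: "(\<lambda>n. \<integral>\<^sup>+x. ennreal (exp (- (?s n * x)\<^sup>2 / 2) * (norm (fourier1 f x))\<^sup>2) \<partial>lborel) \<longlonglongrightarrow> L2sq lborel (fourier1 f)"
  proof (rule nn_integral_LIMSEQ)
    show "incseq (\<lambda>n x. ennreal (exp (- (?s n * x)\<^sup>2 / 2) * (norm (fourier1 f x))\<^sup>2))"
    proof (intro incseq_SucI le_funI ennreal_leI mult_right_mono)
      fix n x
      have "\<bar>?s (Suc n) * x\<bar> \<le> \<bar>?s n * x\<bar>"
        unfolding abs_mult by (intro mult_right_mono) (auto simp: field_simps)
      then have "(?s (Suc n) * x)\<^sup>2 \<le> (?s n * x)\<^sup>2" by (metis abs_le_square_iff)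
      then show "exp (- (?s n * x)\<^sup>2 / 2) \<le> exp (- (?s (Suc n) * x)\<^sup>2 / 2)" by simp
    qed auto
    fix x
    have "(\<lambda>n. exp (- (?s n * x)\<^sup>2 / 2) * (norm (fourier1 f x))\<^sup>2) \<longlonglongrightarrow> exp (- (0 * x)\<^sup>2 / 2) * (norm (fourier1 f x))\<^sup>2"
      by (intro tendsto_intros LIMSEQ_Suc[OF lim_1_over_n]) simp
    then show "(\<lambda>n. ennreal (exp (- (?s n * x)\<^sup>2 / 2) * (norm (fourier1 f x))\<^sup>2)) \<longlonglongrightarrow> ennreal ((norm (fourier1 f x))\<^sup>2)"
      by (intro tendsto_ennrealI) simp
  qed measurable
  have "L2sq lborel (fourier1 f) = ennreal (2 * pi * (LINT x|lborel. (norm (f x))\<^sup>2))"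
    by (rule LIMSEQ_unique[OF lim3 lim2])
  also have "\<dots> = ennreal (2 * pi) * L2sq lborel f"
    by (subst nn_integral_eq_integral[OF int2]) (auto simp: ennreal_mult)
  finally show ?thesis .
qed

section \<open>Schwartz functions and their density in L2\<close>

definition schwartz1 :: "(real \<Rightarrow> complex) \<Rightarrow> bool" where
  "schwartz1 f \<longleftrightarrow>
     (\<exists>F. F 0 = f \<and>
        (\<forall>j x. (F j has_vector_derivative F (Suc j) x) (at x)) \<and>
        (\<forall>j l. bounded (range (\<lambda>x. \<bar>x\<bar> ^ l *\<^sub>R F j x))))"

lemma has_derivative_vec_lambda:
  fixes f :: "'a::real_normed_vector \<Rightarrow> complex^'k"
  assumes "\<And>i. ((\<lambda>x. f x $ i) has_derivative (\<lambda>h. f' h $ i)) (at x within S)"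
  shows "(f has_derivative f') (at x within S)"
proof -
  have lin: "bounded_linear (axis i :: complex \<Rightarrow> complex^'k)" for i
    unfolding linear_conv_bounded_linear[symmetric]
    by (rule linearI) (simp_all add: vec_eq_iff axis_def)
  have "((\<lambda>x. \<Sum>i\<in>UNIV. axis i (f x $ i)) has_derivative (\<lambda>h. \<Sum>i\<in>UNIV. axis i (f' h $ i))) (at x within S)"
    by (intro has_derivative_sum bounded_linear.has_derivative[OF lin] assms)
  moreover have "(\<Sum>i\<in>UNIV. axis i (v $ i)) = v" for v :: "complex^'k"
    by (simp add: vec_eq_iff axis_def if_distrib cong: if_cong)
  ultimately show ?thesis by simp
qed

lemma has_vector_derivative_vec_lambda:
  fixes f :: "real \<Rightarrow> complex^'n"
  assumes "\<And>i. ((\<lambda>x. f x $ i) has_vector_derivative f' $ i) (at x)"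
  shows "(f has_vector_derivative f') (at x)"
  using assms unfolding has_vector_derivative_def by (intro has_derivative_vec_lambda) simp

lemma measurable_vec_nth [measurable (raw)]:
  fixes f :: "'a \<Rightarrow> complex^'n"
  shows "f \<in> borel_measurable M \<Longrightarrow> (\<lambda>x. f x $ i) \<in> borel_measurable M"
  by (rule borel_measurable_continuous_on[where f = "\<lambda>v. v $ i"]) (auto intro: continuous_intros)

lemma measurable_vec_componentwise:
  fixes f :: "'a \<Rightarrow> complex^'n"
  assumes "\<And>i. (\<lambda>x. f x $ i) \<in> borel_measurable M"
  shows "f \<in> borel_measurable M"
  unfolding borel_measurable_euclidean_space[of f]
  using borel_measurable_inner[OF assms borel_measurable_const] by (auto simp: Basis_vec_def inner_axis)

lemma schwartz_componentwise:
  fixes f :: "real \<Rightarrow> complex^'n"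
  assumes "\<And>i. schwartz1 (\<lambda>x. f x $ i)"
  shows "schwartz f"
proof -
  have "\<forall>i. \<exists>F. F 0 = (\<lambda>x. f x $ i) \<and>
        (\<forall>j x. (F j has_vector_derivative F (Suc j) x) (at x)) \<and>
        (\<forall>j l. bounded (range (\<lambda>x. \<bar>x\<bar> ^ l *\<^sub>R F j x)))"
    using assms unfolding schwartz1_def by blast
  from choice[OF this] obtain F where F: "\<And>i. F i 0 = (\<lambda>x. f x $ i)"
      "\<And>i j x. (F i j has_vector_derivative F i (Suc j) x) (at x)"
      "\<And>i j l. bounded (range (\<lambda>x. \<bar>x\<bar> ^ l *\<^sub>R F i j x))"
    by blast
  show ?thesis
    unfolding schwartz_def
  proof (intro exI[of _ "\<lambda>j x. \<chi> i. F i j x"] conjI allI)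
    show "(\<lambda>x. \<chi> i. F i 0 x) = f" by (simp add: F(1))
    show "((\<lambda>x. \<chi> i. F i j x) has_vector_derivative (\<chi> i. F i (Suc j) x)) (at x)" for j x
      by (rule has_vector_derivative_vec_lambda) (simp add: F(2))
    show "bounded (range (\<lambda>x. \<bar>x\<bar> ^ l *\<^sub>R (\<chi> i. F i j x)))" for j l
    proof -
      from F(3) have "\<forall>i. \<exists>M. \<forall>x. norm (\<bar>x\<bar> ^ l *\<^sub>R F i j x) \<le> M"
        by (auto simp: bounded_iff)
      then obtain M where M: "\<And>i x. norm (\<bar>x\<bar> ^ l *\<^sub>R F i j x) \<le> M i" by metis
      have "norm (\<bar>x\<bar> ^ l *\<^sub>R (\<chi> i. F i j x)) \<le> (\<Sum>i\<in>UNIV. M i)" for x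
      proof -
        have "norm (\<bar>x\<bar> ^ l *\<^sub>R (\<chi> i. F i j x)) \<le> (\<Sum>i\<in>UNIV. norm ((\<bar>x\<bar> ^ l *\<^sub>R (\<chi> i. F i j x)) $ i))"
          by (simp add: norm_vec_def L2_set_le_sum)
        also have "\<dots> \<le> (\<Sum>i\<in>UNIV. M i)"
          using M by (intro sum_mono) (simp del: norm_scaleR)
        finally show ?thesis .
      qed
      then show ?thesis by (auto simp: bounded_iff)
    qed
  qed
qed

lemma schwartz_derivative:
  assumes "schwartz f"
  shows "\<exists>f'. \<forall>x. (f has_vector_derivative f' x) (at x)"
  using assms unfolding schwartz_def by metis

lemma schwartz_continuous: "schwartz f \<Longrightarrow> continuous_on UNIV f"
  by (metis schwartz_derivative continuous_at_imp_continuous_on has_vector_derivative_continuous)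

lemma schwartz_bounded:
  assumes "schwartz f"
  shows "bounded (range f)"
proof -
  from assms[unfolded schwartz_def] obtain F where
    F': "F 0 = f \<and> (\<forall>j x. (F j has_vector_derivative F (Suc j) x) (at x)) \<and>
      (\<forall>j l. bounded (range (\<lambda>x. \<bar>x\<bar> ^ l *\<^sub>R F j x)))" by (rule exE)
  then have F: "F 0 = f" "\<And>j x. (F j has_vector_derivative F (Suc j) x) (at x)"
    "\<And>j l. bounded (range (\<lambda>x. \<bar>x\<bar> ^ l *\<^sub>R F j x))" by auto
  from F(3)[of 0 0] F(1) show ?thesis by simp
qed

lemma integrable_inverse_one_plus_square: "integrable lborel (\<lambda>x::real. inverse (1 + x\<^sup>2))"
  using integrable_inverse_1_plus_square by (simp add: set_integrable_def)

lemma schwartz_integrable: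
  fixes f :: "real \<Rightarrow> complex^'n"
  assumes f: "schwartz f"
  shows "integrable lborel f"
proof -
  from f[unfolded schwartz_def] obtain F where
    F': "F 0 = f \<and> (\<forall>j x. (F j has_vector_derivative F (Suc j) x) (at x)) \<and>
      (\<forall>j l. bounded (range (\<lambda>x. \<bar>x\<bar> ^ l *\<^sub>R F j x)))" by (rule exE)
  then have F: "F 0 = f" "\<And>j x. (F j has_vector_derivative F (Suc j) x) (at x)"
    "\<And>j l. bounded (range (\<lambda>x. \<bar>x\<bar> ^ l *\<^sub>R F j x))" by auto
  from F(3)[of 0 0] F(3)[of 2 0] F(1) obtain M0 M2 where
    M: "\<And>x. norm (f x) \<le> M0" "\<And>x. x\<^sup>2 * norm (f x) \<le> M2"
    by (auto simp: bounded_iff)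
  have [measurable]: "f \<in> borel_measurable borel"
    by (rule borel_measurable_continuous_onI[OF schwartz_continuous[OF f]])
  show ?thesis
  proof (rule Bochner_Integration.integrable_bound)
    show "integrable lborel (\<lambda>x::real. (M0 + M2) * inverse (1 + x\<^sup>2))"
      by (intro integrable_mult_right integrable_inverse_one_plus_square)
    show "AE x in lborel. norm (f x) \<le> norm ((M0 + M2) * inverse (1 + x\<^sup>2))"
    proof (rule AE_I2)
      fix x :: real
      have "(1 + x\<^sup>2) * norm (f x) \<le> M0 + M2"
        using M[of x] by (simp add: algebra_simps)
      moreover have "0 < 1 + x\<^sup>2" by (simp add: add_pos_nonneg)
      ultimately have "norm (f x) \<le> (M0 + M2) * inverse (1 + x\<^sup>2)"
        by (simp add: field_simps)
      then show "norm (f x) \<le> norm ((M0 + M2) * inverse (1 + x\<^sup>2))" by simp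
    qed
  qed simp
qed

lemma schwartz_diff:
  fixes f g :: "real \<Rightarrow> complex^'n"
  assumes "schwartz f" "schwartz g"
  shows "schwartz (\<lambda>x. f x - g x)"
proof -
  from assms(1)[unfolded schwartz_def] obtain F where
    F': "F 0 = f \<and> (\<forall>j x. (F j has_vector_derivative F (Suc j) x) (at x)) \<and>
      (\<forall>j l. bounded (range (\<lambda>x. \<bar>x\<bar> ^ l *\<^sub>R F j x)))" by (rule exE)
  then have F: "F 0 = f" "\<And>j x. (F j has_vector_derivative F (Suc j) x) (at x)"
    "\<And>j l. bounded (range (\<lambda>x. \<bar>x\<bar> ^ l *\<^sub>R F j x))" by auto
  from assms(2)[unfolded schwartz_def] obtain G where
    G': "G 0 = g \<and> (\<forall>j x. (G j has_vector_derivative G (Suc j) x) (at x)) \<and>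
      (\<forall>j l. bounded (range (\<lambda>x. \<bar>x\<bar> ^ l *\<^sub>R G j x)))" by (rule exE)
  then have G: "G 0 = g" "\<And>j x. (G j has_vector_derivative G (Suc j) x) (at x)"
    "\<And>j l. bounded (range (\<lambda>x. \<bar>x\<bar> ^ l *\<^sub>R G j x))" by auto
  show ?thesis
    unfolding schwartz_def
  proof (intro exI[of _ "\<lambda>j x. F j x - G j x"] conjI allI)
    show "((\<lambda>x. F j x - G j x) has_vector_derivative F (Suc j) x - G (Suc j) x) (at x)" for j x
      by (intro has_vector_derivative_diff F G)
    show "bounded (range (\<lambda>x. \<bar>x\<bar> ^ l *\<^sub>R (F j x - G j x)))" for j l
      using bounded_minus_comp[OF F(3)[of l j] G(3)[of l j]] by (simp add: scaleR_diff_right)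
  qed (simp add: F(1) G(1))
qed

text \<open>Reduces all statements on vector-valued transforms to scalar ones.\<close>
lemma fourier_component:
  fixes f :: "real \<Rightarrow> complex^'n"
  assumes f: "integrable lborel f"
  shows "fourier f \<xi> $ i = fourier1 (\<lambda>x. f x $ i) \<xi>"
proof -
  have [measurable]: "f \<in> borel_measurable borel" using f by auto
  have "integrable lborel (\<lambda>x. exp (- (\<i> * of_real x * of_real \<xi>)) *s f x)"
  proof (rule Bochner_Integration.integrable_bound[OF f])
    show "(\<lambda>x. exp (- (\<i> * of_real x * of_real \<xi>)) *s f x) \<in> borel_measurable lborel"
      by (rule measurable_vec_componentwise) simp
    show "AE x in lborel. norm (exp (- (\<i> * of_real x * of_real \<xi>)) *s f x) \<le> norm (f x)"
      by (intro AE_I2) (simp add: norm_vec_def norm_mult)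
  qed
  from integral_bounded_linear[OF bounded_linear_vec_nth[of i] this]
  show ?thesis by (simp add: fourier_def fourier1_def)
qed

lemma norm_vec_square: "(norm (v :: complex^'n))\<^sup>2 = (\<Sum>i\<in>UNIV. (norm (v $ i))\<^sup>2)"
  by (simp add: norm_vec_def L2_set_def sum_nonneg)

text \<open>From \<open>y\<^sup>l \<le> l! e\<^sup>y\<close> with \<open>y = (sx)\<^sup>2/2\<close>, after \<open>|x|\<^sup>l \<le> 1 + |x|\<^bsup>2l\<^esup>\<close>.\<close>
lemma gaussian_power_bounded:
  fixes s :: real
  assumes s: "s > 0"
  shows "bounded (range (\<lambda>x. \<bar>x\<bar> ^ l * exp (- (s * x)\<^sup>2 / 2)))"
proof -
  have "\<bar>x\<bar> ^ l * exp (- (s * x)\<^sup>2 / 2) \<le> 1 + fact l * (2 / s\<^sup>2) ^ l" for x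
  proof -
    let ?y = "(s * x)\<^sup>2 / 2"
    have y: "?y ^ l \<le> fact l * exp ?y"
    proof -
      have "?y ^ l / fact l \<le> (\<Sum>k. inverse (fact k) * ?y ^ k)"
        using sum_le_suminf[OF summable_exp[of ?y], of "{l}"] by (simp add: field_simps)
      then show ?thesis by (simp add: exp_def field_simps)
    qed
    have "\<bar>x\<bar> ^ l \<le> 1 + \<bar>x\<bar> ^ (2 * l)"
    proof (cases "\<bar>x\<bar> \<le> 1")
      case True then show ?thesis by (simp add: power_le_one add_increasing2)
    next
      case False
      then have "\<bar>x\<bar> ^ l \<le> \<bar>x\<bar> ^ (2 * l)" by (intro power_increasing) auto
      then show ?thesis by simp
    qed
    also have "\<bar>x\<bar> ^ (2 * l) = (2 / s\<^sup>2) ^ l * ?y ^ l"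
    proof -
      have "\<bar>x\<bar> ^ (2 * l) = (x\<^sup>2) ^ l" by (simp add: power_mult)
      also have "x\<^sup>2 = 2 / s\<^sup>2 * ?y" using s by (simp add: field_simps)
      finally show ?thesis by (simp only: power_mult_distrib)
    qed
    also have "\<dots> \<le> (2 / s\<^sup>2) ^ l * (fact l * exp ?y)"
      by (intro mult_left_mono y) auto
    finally have "\<bar>x\<bar> ^ l * exp (- ?y) \<le> (1 + (2 / s\<^sup>2) ^ l * (fact l * exp ?y)) * exp (- ?y)"
      by (intro mult_right_mono) auto
    also have "\<dots> = exp (- ?y) + fact l * (2 / s\<^sup>2) ^ l"
      by (simp add: algebra_simps exp_minus)
    also have "\<dots> \<le> 1 + fact l * (2 / s\<^sup>2) ^ l" by simp
    finally show ?thesis by simp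
  qed
  then show ?thesis by (auto simp: bounded_iff abs_mult power_abs)
qed

text \<open>The \<open>j\<close>-th derivative of \<open>2\<pi>\<close> times the inverse transform of \<open>h\<close> restricted to \<open>[-R, R]\<close>.\<close>
definition band_moment :: "(real \<Rightarrow> complex) \<Rightarrow> real \<Rightarrow> nat \<Rightarrow> real \<Rightarrow> complex" where
  "band_moment h R j x = integral {-R..R} (\<lambda>y. (\<i> * of_real y) ^ j * iexp (y * x) * h y)"

lemma band_moment_derivative:
  assumes h: "continuous_on UNIV h"
  shows "(band_moment h R j has_vector_derivative band_moment h R (Suc j) x) (at x)"
proof -
  have "((\<lambda>x. integral (cbox (-R) R) (\<lambda>y. (\<i> * of_real y) ^ j * iexp (y * x) * h y)) has_vector_derivative
      integral (cbox (-R) R) (\<lambda>y. (\<i> * of_real y) ^ Suc j * iexp (y * x) * h y)) (at x within UNIV)"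
  proof (rule leibniz_rule_vector_derivative)
    fix x y :: real
    show "((\<lambda>x. (\<i> * of_real y) ^ j * iexp (y * x) * h y) has_vector_derivative (\<i> * of_real y) ^ Suc j * iexp (y * x) * h y) (at x within UNIV)"
      by (auto intro!: derivative_eq_intros has_vector_derivative_real_field simp: algebra_simps)
  next
    fix x
    show "(\<lambda>y. (\<i> * of_real y) ^ j * iexp (y * x) * h y) integrable_on cbox (-R) R"
      by (intro integrable_continuous continuous_intros continuous_on_subset[OF h]) auto
  next
    show "continuous_on (UNIV \<times> cbox (- R) R) (\<lambda>(x, y). (\<i> * of_real y) ^ Suc j * iexp (y * x) * h y)"
      unfolding case_prod_unfold
      by (intro continuous_intros continuous_on_compose2[OF h]) auto
  qed auto
  then show ?thesis unfolding band_moment_def[abs_def] by simp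
qed

lemma band_moment_bounded:
  assumes h: "continuous_on UNIV h"
  shows "bounded (range (band_moment h R j))"
proof -
  have "norm (band_moment h R j x) \<le> integral {-R..R} (\<lambda>y. \<bar>y\<bar> ^ j * norm (h y))" for x
    unfolding band_moment_def
    by (intro integral_norm_bound_integral integrable_continuous_interval continuous_intros continuous_on_subset[OF h])
      (auto simp: norm_mult norm_power)
  then show ?thesis by (auto simp: bounded_iff)
qed

text \<open>Band-limited functions have bounded derivatives, hence become Schwartz functions when
  multiplied by a Gaussian. This class contains those products, is closed under differentiation, and all its
  members decay; that avoids an explicit Leibniz formula for the derivatives.\<close>
inductive_set gaussian_combinations :: "(real \<Rightarrow> complex) \<Rightarrow> real \<Rightarrow> real \<Rightarrow> (real \<Rightarrow> complex) set"
  for h R s where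
  monomial: "(\<lambda>x. (c * x ^ l * exp (- (s * x)\<^sup>2 / 2)) *\<^sub>R band_moment h R j x) \<in> gaussian_combinations h R s"
| add: "f \<in> gaussian_combinations h R s \<Longrightarrow> g \<in> gaussian_combinations h R s \<Longrightarrow>
    (\<lambda>x. f x + g x) \<in> gaussian_combinations h R s"

lemma gaussian_combinations_derivative:
  assumes h: "continuous_on UNIV h" and f: "f \<in> gaussian_combinations h R s"
  shows "\<exists>f'\<in>gaussian_combinations h R s. \<forall>x. (f has_vector_derivative f' x) (at x)"
  using f
proof induction
  case (monomial c l j)
  let ?e = "\<lambda>x. exp (- (s * x)\<^sup>2 / 2)"
  let ?f' = "\<lambda>x. ((c * l * x ^ (l - 1) * ?e x) *\<^sub>R band_moment h R j x
     + (- c * s\<^sup>2 * x ^ (l + 1) * ?e x) *\<^sub>R band_moment h R j x)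
     + (c * x ^ l * ?e x) *\<^sub>R band_moment h R (Suc j) x"
  have m: "?f' \<in> gaussian_combinations h R s"
    by (intro gaussian_combinations.intros)
  have d: "((\<lambda>x. (c * x ^ l * ?e x) *\<^sub>R band_moment h R j x) has_vector_derivative ?f' x) (at x)" for x
  proof -
    have "((\<lambda>x. c * x ^ l * ?e x) has_real_derivative (c * l * x ^ (l - 1) * ?e x - c * s\<^sup>2 * x ^ (l + 1) * ?e x)) (at x)"
      by (auto intro!: derivative_eq_intros simp: algebra_simps power2_eq_square)
    from has_vector_derivative_scaleR[OF this band_moment_derivative[OF h, of R j x]]
    show ?thesis
      by (rule has_vector_derivative_eq_rhs) (simp add: scaleR_left_diff_distrib scaleR_left_distrib)
  qed
  show ?case by (intro bexI[of _ ?f'] allI d m)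
next
  case (add f g)
  then obtain f' g' where "f' \<in> gaussian_combinations h R s" "g' \<in> gaussian_combinations h R s"
    "\<And>x. (f has_vector_derivative f' x) (at x)" "\<And>x. (g has_vector_derivative g' x) (at x)" by blast
  then show ?case
    by (intro bexI[of _ "\<lambda>x. f' x + g' x"] allI has_vector_derivative_add gaussian_combinations.add)
qed

lemma gaussian_combinations_bounded:
  assumes h: "continuous_on UNIV h" and s: "s > 0" and f: "f \<in> gaussian_combinations h R s"
  shows "bounded (range (\<lambda>x. \<bar>x\<bar> ^ m *\<^sub>R f x))"
  using f
proof induction
  case (monomial c l j)
  obtain M where M: "\<And>x. \<bar>x\<bar> ^ (m + l) * exp (- (s * x)\<^sup>2 / 2) \<le> M"
    using gaussian_power_bounded[OF s, of "m + l"] by (auto simp: bounded_iff)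
  obtain M' where M': "\<And>x. norm (band_moment h R j x) \<le> M'"
    using band_moment_bounded[OF h, of R j] by (auto simp: bounded_iff)
  have "norm (\<bar>x\<bar> ^ m *\<^sub>R ((c * x ^ l * exp (- (s * x)\<^sup>2 / 2)) *\<^sub>R band_moment h R j x)) \<le> \<bar>c\<bar> * M * M'" for x
  proof -
    have "norm (\<bar>x\<bar> ^ m *\<^sub>R ((c * x ^ l * exp (- (s * x)\<^sup>2 / 2)) *\<^sub>R band_moment h R j x))
      = \<bar>c\<bar> * (\<bar>x\<bar> ^ (m + l) * exp (- (s * x)\<^sup>2 / 2)) * norm (band_moment h R j x)"
      by (simp add: abs_mult power_add power_abs)
    also have "\<dots> \<le> \<bar>c\<bar> * M * M'"
      using M[of x] M'[of x] order.trans[OF _ M[of x], of 0]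
      by (intro mult_mono) auto
    finally show ?thesis .
  qed
  then show ?case by (auto simp: bounded_iff)
next
  case (add f g)
  then show ?case
    using bounded_plus_comp[OF add.IH] by (simp add: scaleR_add_right)
qed

lemma schwartz1_gaussian_combinations:
  assumes h: "continuous_on UNIV h" and s: "s > 0" and f: "f \<in> gaussian_combinations h R s"
  shows "schwartz1 f"
proof -
  have "\<forall>f\<in>gaussian_combinations h R s. \<exists>f'. f' \<in> gaussian_combinations h R s \<and> (\<forall>x. (f has_vector_derivative f' x) (at x))"
    using gaussian_combinations_derivative[OF h] by (simp add: Bex_def)
  from bchoice[OF this] obtain D where D: "\<And>f. f \<in> gaussian_combinations h R s \<Longrightarrow> D f \<in> gaussian_combinations h R s"
      "\<And>f x. f \<in> gaussian_combinations h R s \<Longrightarrow> (f has_vector_derivative D f x) (at x)"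
    by blast
  have in_gc: "(D ^^ j) f \<in> gaussian_combinations h R s" for j
    by (induction j) (auto simp: f D)
  show ?thesis
    unfolding schwartz1_def
    by (intro exI[of _ "\<lambda>j. (D ^^ j) f"])
      (auto intro!: D(2) in_gc gaussian_combinations_bounded[OF h s])
qed

text \<open>Jensen's inequality for the Gaussian law, as nonnegativity of the variance of \<open>|a|\<close>.\<close>
lemma gaussian_average_square_le:
  fixes a :: "real \<Rightarrow> complex"
  assumes [measurable]: "a \<in> borel_measurable borel" and M: "\<And>z. norm (a z) \<le> M"
  shows "(norm (gaussian_mean a))\<^sup>2
     \<le> (LINT z|lborel. std_normal_density z * (norm (a z))\<^sup>2)"
proof -
  have i1: "integrable lborel (\<lambda>z. std_normal_density z * norm (a z))"
    by (rule Bochner_Integration.integrable_bound[where f = "\<lambda>z. M * std_normal_density z"])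
      (use integrable_std_normal_density M order.trans[OF norm_ge_zero M] in \<open>auto simp: abs_mult mult.commute intro!: AE_I2 mult_mono\<close>)
  have i2: "integrable lborel (\<lambda>z. std_normal_density z * (norm (a z))\<^sup>2)"
    by (rule Bochner_Integration.integrable_bound[where f = "\<lambda>z. M\<^sup>2 * std_normal_density z"])
      (use integrable_std_normal_density M order.trans[OF norm_ge_zero M] in \<open>auto simp: abs_mult mult.commute intro!: AE_I2 mult_mono power_mono\<close>)
  define \<mu> where "\<mu> = (LINT z|lborel. std_normal_density z * norm (a z))"
  have mu0: "0 \<le> \<mu>" unfolding \<mu>_def by (intro integral_nonneg_AE) auto
  have "norm (gaussian_mean a) \<le> (LINT z|lborel. norm (of_real (std_normal_density z) * a z))"
    by (rule integral_norm_bound)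
  also have "\<dots> = \<mu>" unfolding \<mu>_def by (simp add: norm_mult)
  finally have 1: "(norm (gaussian_mean a))\<^sup>2 \<le> \<mu>\<^sup>2"
    by (intro power_mono) auto
  have "0 \<le> (LINT z|lborel. std_normal_density z * (norm (a z) - \<mu>)\<^sup>2)"
    by (intro integral_nonneg_AE) auto
  also have "\<dots> = (LINT z|lborel. std_normal_density z * (norm (a z))\<^sup>2 - 2 * \<mu> * (std_normal_density z * norm (a z)) + \<mu>\<^sup>2 * std_normal_density z)"
    by (intro Bochner_Integration.integral_cong) (auto simp: power2_eq_square algebra_simps)
  also have "\<dots> = (LINT z|lborel. std_normal_density z * (norm (a z))\<^sup>2) - 2 * \<mu> * \<mu> + \<mu>\<^sup>2"
    using i1 i2 integrable_std_normal_density by (simp add: \<mu>_def integral_std_normal_density)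
  finally have "\<mu>\<^sup>2 \<le> (LINT z|lborel. std_normal_density z * (norm (a z))\<^sup>2)"
    by (simp add: power2_eq_square)
  with 1 show ?thesis by simp
qed

text \<open>Serves in place of the triangle inequality, so that no square roots of extended nonnegative
  reals are needed.\<close>
lemma norm_diff_square_le: "(norm (a - b))\<^sup>2 \<le> 2 * (norm a)\<^sup>2 + 2 * (norm (b::'a::real_normed_vector))\<^sup>2"
proof -
  have "(norm (a - b))\<^sup>2 \<le> (norm a + norm b)\<^sup>2" by (intro power_mono norm_triangle_ineq4) auto
  also have "\<dots> \<le> 2 * (norm a)\<^sup>2 + 2 * (norm b)\<^sup>2"
    using zero_le_power2[of "norm a - norm b"] by (simp add: power2_eq_square algebra_simps)
  finally show ?thesis .
qed

text \<open>By Jensen and Tonelli the error is at most the Gaussian mean of \<open>z \<mapsto> \<omega>(sz)\<close>, where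
  \<open>\<omega>(a)\<close> is the squared \<open>L\<^sup>2\<close> distance of \<open>h\<close> from its translate by \<open>a\<close>. Uniformly bounded by
  four times the squared norm of \<open>h\<close>, it tends to \<open>0\<close> with \<open>a\<close> since \<open>h\<close> is continuous with
  compact support.\<close>
lemma gaussian_mollification_L2:
  fixes h :: "real \<Rightarrow> complex"
  assumes h: "continuous_on UNIV h" and supp: "\<And>x. \<bar>x\<bar> > R \<Longrightarrow> h x = 0" and M: "\<And>x. norm (h x) \<le> M"
  shows "(\<lambda>n. L2sq lborel (\<lambda>\<xi>. (gaussian_mean (\<lambda>z. h (\<xi> + 1 / real (Suc n) * z))) - h \<xi>)) \<longlonglongrightarrow> 0"
proof -
  have [measurable]: "h \<in> borel_measurable borel"
    by (rule borel_measurable_continuous_onI[OF h])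
  let ?s = "\<lambda>n. 1 / real (Suc n)"
  have M0: "0 \<le> M" using M[of 0] norm_ge_zero order.trans by blast
  let ?d = "\<lambda>a \<xi>. ennreal ((norm (h (\<xi> + a) - h \<xi>))\<^sup>2)"
  let ?om = "\<lambda>a. \<integral>\<^sup>+\<xi>. ?d a \<xi> \<partial>lborel"
  define C where "C = L2sq lborel h"
  have C: "C < \<infinity>"
  proof -
    have "C \<le> (\<integral>\<^sup>+\<xi>. ennreal (M\<^sup>2) * indicator {-R..R} \<xi> \<partial>lborel)"
      unfolding C_def
    proof (intro nn_integral_mono)
      fix \<xi>
      show "ennreal ((norm (h \<xi>))\<^sup>2) \<le> ennreal (M\<^sup>2) * indicator {-R..R} \<xi>"
        using M[of \<xi>] supp[of \<xi>] by (cases "\<bar>\<xi>\<bar> > R") (auto simp: indicator_def intro!: ennreal_leI power_mono)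
    qed
    also have "\<dots> < \<infinity>" by (simp add: nn_integral_cmult_indicator ennreal_mult_less_top emeasure_lborel_Icc_eq)
    finally show ?thesis .
  qed
  have om_le: "?om a \<le> 4 * C" for a
  proof -
    have "?om a \<le> (\<integral>\<^sup>+\<xi>. 2 * ennreal ((norm (h (\<xi> + a)))\<^sup>2) + 2 * ennreal ((norm (h \<xi>))\<^sup>2) \<partial>lborel)"
    proof (intro nn_integral_mono)
      fix \<xi>
      have "?d a \<xi> \<le> ennreal (2 * (norm (h (\<xi> + a)))\<^sup>2 + 2 * (norm (h \<xi>))\<^sup>2)"
        by (intro ennreal_leI norm_diff_square_le)
      then show "?d a \<xi> \<le> 2 * ennreal ((norm (h (\<xi> + a)))\<^sup>2) + 2 * ennreal ((norm (h \<xi>))\<^sup>2)"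
        by (simp add: ennreal_mult)
    qed
    also have "\<dots> = 2 * L2sq lborel (\<lambda>\<xi>. h (\<xi> + a)) + 2 * C"
      unfolding C_def by (subst nn_integral_add) (auto simp: nn_integral_cmult)
    also have "L2sq lborel (\<lambda>\<xi>. h (\<xi> + a)) = C"
      unfolding C_def
      by (subst nn_integral_real_affine[where f = "\<lambda>\<xi>. ennreal ((norm (h \<xi>))\<^sup>2)" and c = 1 and t = a]) (auto simp: add.commute)
    also have "2 * C + 2 * C = 4 * C" by (metis (no_types) distrib_right numeral_Bit0)
    finally show ?thesis .
  qed
  have om_lim: "(\<lambda>n. ?om (?s n * z)) \<longlonglongrightarrow> 0" for z
  proof -
    have "(\<lambda>n. ?om (?s n * z)) \<longlonglongrightarrow> (\<integral>\<^sup>+\<xi>. 0 \<partial>(lborel::real measure))"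
    proof (rule nn_integral_dominated_convergence[where w = "\<lambda>\<xi>. ennreal (4 * M\<^sup>2) * indicator {-(R + \<bar>z\<bar>)..R + \<bar>z\<bar>} \<xi>"])
      show "(\<integral>\<^sup>+\<xi>. ennreal (4 * M\<^sup>2) * indicator {-(R + \<bar>z\<bar>)..R + \<bar>z\<bar>} \<xi> \<partial>lborel) < \<infinity>"
        by (simp add: nn_integral_cmult_indicator ennreal_mult_less_top emeasure_lborel_Icc_eq)
      show "AE \<xi> in lborel. (\<lambda>n. ?d (?s n * z) \<xi>) \<longlonglongrightarrow> 0"
      proof (rule AE_I2)
        fix \<xi>
        have "(\<lambda>n. \<xi> + ?s n * z) \<longlonglongrightarrow> \<xi> + 0 * z"
          by (intro tendsto_intros LIMSEQ_Suc[OF lim_1_over_n])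
        then have "(\<lambda>n. h (\<xi> + ?s n * z)) \<longlonglongrightarrow> h \<xi>"
          using continuous_on_tendsto_compose[OF h, of "\<lambda>n. \<xi> + ?s n * z" \<xi>] by simp
        then have "(\<lambda>n. (norm (h (\<xi> + ?s n * z) - h \<xi>))\<^sup>2) \<longlonglongrightarrow> (norm (h \<xi> - h \<xi>))\<^sup>2"
          by (intro tendsto_intros)
        then show "(\<lambda>n. ?d (?s n * z) \<xi>) \<longlonglongrightarrow> 0"
          using tendsto_ennrealI by fastforce
      qed
      show "AE \<xi> in lborel. ?d (?s n * z) \<xi> \<le> ennreal (4 * M\<^sup>2) * indicator {-(R + \<bar>z\<bar>)..R + \<bar>z\<bar>} \<xi>" for n
      proof (rule AE_I2)
        fix \<xi>
        show "?d (?s n * z) \<xi> \<le> ennreal (4 * M\<^sup>2) * indicator {-(R + \<bar>z\<bar>)..R + \<bar>z\<bar>} \<xi>"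
        proof (cases "\<xi> \<in> {-(R + \<bar>z\<bar>)..R + \<bar>z\<bar>}")
          case True
          have "norm (h (\<xi> + ?s n * z) - h \<xi>) \<le> M + M"
            using norm_triangle_ineq4 M by (meson add_mono order.trans)
          then have "(norm (h (\<xi> + ?s n * z) - h \<xi>))\<^sup>2 \<le> (M + M)\<^sup>2" by (intro power_mono) auto
          then show ?thesis using True by (auto intro!: ennreal_leI simp: power2_eq_square)
        next
          case False
          have "\<bar>?s n * z\<bar> \<le> 1 * \<bar>z\<bar>" unfolding abs_mult by (intro mult_right_mono) auto
          moreover from False have "\<bar>\<xi>\<bar> > R + \<bar>z\<bar>" by auto
          ultimately have "\<bar>\<xi> + ?s n * z\<bar> > R" "\<bar>\<xi>\<bar> > R" by linarith+
          then have "h (\<xi> + ?s n * z) = 0" "h \<xi> = 0" using supp by blast+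
          then show ?thesis by simp
        qed
      qed
    qed measurable
    then show ?thesis by simp
  qed
  have om_meas[measurable]: "?om \<in> borel_measurable borel" by measurable
  have up: "L2sq lborel (\<lambda>\<xi>. (gaussian_mean (\<lambda>z. h (\<xi> + ?s n * z))) - h \<xi>)
     \<le> (\<integral>\<^sup>+z. ennreal (std_normal_density z) * ?om (?s n * z) \<partial>lborel)" (is "?lhs n \<le> ?rhs n") for n
  proof -
    have "?lhs n \<le> (\<integral>\<^sup>+\<xi>. \<integral>\<^sup>+z. ennreal (std_normal_density z) * ?d (?s n * z) \<xi> \<partial>lborel \<partial>lborel)"
    proof (intro nn_integral_mono)
      fix \<xi>
      have i1: "integrable lborel (\<lambda>z. of_real (std_normal_density z) * h (\<xi> + ?s n * z))"
        by (rule Bochner_Integration.integrable_bound[where f = "\<lambda>z. M * std_normal_density z"])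
          (use integrable_std_normal_density M M0 in \<open>auto simp: norm_mult abs_mult mult.commute[of M] intro!: AE_I2 mult_left_mono\<close>)
      have i0: "integrable lborel (\<lambda>z. of_real (std_normal_density z) * h \<xi>)"
        using integrable_std_normal_density by (intro integrable_mult_left) simp
      have bd: "norm (h (\<xi> + ?s n * z) - h \<xi>) \<le> 2 * M" for z
        using norm_triangle_ineq4[of "h (\<xi> + ?s n * z)" "h \<xi>"] M[of "\<xi> + ?s n * z"] M[of \<xi>] by linarith
      have "(gaussian_mean (\<lambda>z. h (\<xi> + ?s n * z))) - h \<xi>
         = (gaussian_mean (\<lambda>z. h (\<xi> + ?s n * z))) - (gaussian_mean (\<lambda>z. h \<xi>))"
      proof -
        have "(gaussian_mean (\<lambda>z. h \<xi>)) = (LINT z|lborel. complex_of_real (std_normal_density z)) * h \<xi>"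
          by (rule integral_mult_left_zero)
        then show ?thesis by (simp add: integral_std_normal_density)
      qed
      also have "\<dots> = (gaussian_mean (\<lambda>z. h (\<xi> + ?s n * z) - h \<xi>))"
        using i1 i0 by (subst Bochner_Integration.integral_diff[symmetric]) (auto simp: right_diff_distrib)
      finally have "(norm ((gaussian_mean (\<lambda>z. h (\<xi> + ?s n * z))) - h \<xi>))\<^sup>2
         \<le> (LINT z|lborel. std_normal_density z * (norm (h (\<xi> + ?s n * z) - h \<xi>))\<^sup>2)"
        using gaussian_average_square_le[of "\<lambda>z. h (\<xi> + ?s n * z) - h \<xi>" "2 * M"] bd by simp
      then have "ennreal ((norm ((gaussian_mean (\<lambda>z. h (\<xi> + ?s n * z))) - h \<xi>))\<^sup>2)
         \<le> ennreal (LINT z|lborel. std_normal_density z * (norm (h (\<xi> + ?s n * z) - h \<xi>))\<^sup>2)"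
        by (rule ennreal_leI)
      also have "\<dots> = (\<integral>\<^sup>+z. ennreal (std_normal_density z * (norm (h (\<xi> + ?s n * z) - h \<xi>))\<^sup>2) \<partial>lborel)"
      proof (rule nn_integral_eq_integral[symmetric])
        show "integrable lborel (\<lambda>z. std_normal_density z * (norm (h (\<xi> + ?s n * z) - h \<xi>))\<^sup>2)"
          by (rule Bochner_Integration.integrable_bound[where f = "\<lambda>z. (2 * M)\<^sup>2 * std_normal_density z"])
            (use integrable_std_normal_density power_mono[OF bd norm_ge_zero, where n = 2] in \<open>auto simp: abs_mult mult.commute[of _ "std_normal_density _"] intro!: AE_I2 mult_left_mono\<close>)
      qed auto
      finally show "ennreal ((norm ((gaussian_mean (\<lambda>z. h (\<xi> + ?s n * z))) - h \<xi>))\<^sup>2)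
         \<le> (\<integral>\<^sup>+z. ennreal (std_normal_density z) * ?d (?s n * z) \<xi> \<partial>lborel)"
        by (simp add: ennreal_mult)
    qed
    also have "\<dots> = (\<integral>\<^sup>+z. \<integral>\<^sup>+\<xi>. ennreal (std_normal_density z) * ?d (?s n * z) \<xi> \<partial>lborel \<partial>lborel)"
      by (rule lborel_pair.Fubini') measurable
    also have "\<dots> = ?rhs n"
      by (intro nn_integral_cong nn_integral_cmult) measurable
    finally show ?thesis .
  qed
  have "?rhs \<longlonglongrightarrow> (\<integral>\<^sup>+z. 0 \<partial>(lborel::real measure))"
  proof (rule nn_integral_dominated_convergence[where w = "\<lambda>z. ennreal (std_normal_density z) * (4 * C)"])
    have "(\<integral>\<^sup>+z. ennreal (std_normal_density z) * (4 * C) \<partial>lborel) = ennreal 1 * (4 * C)"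
      by (subst nn_integral_multc) (auto simp: nn_integral_eq_integral integrable_std_normal_density integral_std_normal_density)
    also have "\<dots> < \<infinity>" using C by (simp add: ennreal_mult_less_top)
    finally show "(\<integral>\<^sup>+z. ennreal (std_normal_density z) * (4 * C) \<partial>lborel) < \<infinity>" .
    show "AE z in lborel. ennreal (std_normal_density z) * ?om (?s n * z) \<le> ennreal (std_normal_density z) * (4 * C)" for n
      by (intro AE_I2 mult_left_mono om_le) auto
    show "AE z in lborel. (\<lambda>n. ennreal (std_normal_density z) * ?om (?s n * z)) \<longlonglongrightarrow> 0"
    proof (rule AE_I2)
      fix z
      have "(\<lambda>n. ennreal (std_normal_density z) * ?om (?s n * z)) \<longlonglongrightarrow> ennreal (std_normal_density z) * 0"
        by (intro ennreal_tendsto_cmult om_lim) auto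
      then show "(\<lambda>n. ennreal (std_normal_density z) * ?om (?s n * z)) \<longlonglongrightarrow> 0" by simp
    qed
  qed measurable
  then have r: "?rhs \<longlonglongrightarrow> 0" by simp
  show ?thesis
    by (rule tendsto_sandwich[OF _ _ tendsto_const r]) (use up in auto)
qed

text \<open>Measurability supplies continuous functions converging almost everywhere; radial truncation to
  the ball of radius \<open>M\<close> and a cutoff make the convergence dominated without disturbing the limit.\<close>
lemma L2_approx_continuous:
  fixes g :: "real \<Rightarrow> complex"
  assumes [measurable]: "g \<in> borel_measurable borel" and M: "\<And>x. norm (g x) \<le> M"
    and supp: "\<And>x. \<bar>x\<bar> > R \<Longrightarrow> g x = 0" and R: "R > 0"
  shows "\<exists>h. (\<forall>n. continuous_on UNIV (h n) \<and> (\<forall>x. norm (h n x) \<le> M) \<and> (\<forall>x. \<bar>x\<bar> > R + 1 \<longrightarrow> h n x = 0)) \<and>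
     (\<lambda>n. L2sq lborel (\<lambda>x. h n x - g x)) \<longlonglongrightarrow> 0"
proof -
  have M0: "0 \<le> M" using M[of 0] norm_ge_zero order.trans by blast
  have "g measurable_on UNIV"
    by (rule lebesgue_measurable_imp_measurable_on) (auto intro!: measurable_completion)
  then obtain N G where N: "negligible N" and G: "\<And>n. continuous_on UNIV (G n)"
    and lim: "\<And>x. x \<notin> N \<Longrightarrow> (\<lambda>n. G n x) \<longlonglongrightarrow> g x"
    unfolding measurable_on_def by auto
  \<comment> \<open>The cutoff equals one on \<open>[-R, R]\<close>; the radial truncation fixes the ball of radius \<open>M\<close>.\<close>
  define cut where "cut x = max 0 (min 1 (R + 1 - \<bar>x\<bar>))" for x :: real
  define clamp where "clamp z = (M / max M (norm z)) *\<^sub>R z" for z :: complex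
  define h where "h n x = cut x *\<^sub>R clamp (G n x)" for n x
  have "M = 0 \<Longrightarrow> ?thesis"
  proof -
    assume "M = 0"
    then have "g x = 0" for x using M[of x] by simp
    then show ?thesis using M0 by (intro exI[of _ "\<lambda>n x. 0"]) auto
  qed
  moreover have ?thesis if Mp: "M > 0"
  proof -
    have clamp_le: "norm (clamp z) \<le> M" for z
      using Mp by (auto simp: clamp_def field_simps max_def)
    have clamp_eq: "clamp z = z" if "norm z \<le> M" for z
      using that Mp by (simp add: clamp_def max_def)
    have clamp_cont: "continuous_on UNIV clamp"
      unfolding clamp_def using Mp by (intro continuous_intros) (auto simp: max_def)
    have cut01: "0 \<le> cut x" "cut x \<le> 1" for x by (auto simp: cut_def)
    have h_cont: "continuous_on UNIV (h n)" for n
      unfolding h_def cut_def by (intro continuous_intros continuous_on_compose2[OF clamp_cont G]) auto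
    have h_le: "norm (h n x) \<le> M" for n x
      using mult_mono[OF cut01(2)[of x] clamp_le[of "G n x"]] cut01[of x] by (simp add: h_def)
    have h_supp: "h n x = 0" if "\<bar>x\<bar> > R + 1" for n x using that by (simp add: h_def cut_def)
    have [measurable]: "h n \<in> borel_measurable borel" for n
      by (rule borel_measurable_continuous_onI[OF h_cont])
    have "(\<lambda>n. L2sq lborel (\<lambda>x. h n x - g x)) \<longlonglongrightarrow> (\<integral>\<^sup>+x. 0 \<partial>(lborel::real measure))"
    proof (rule nn_integral_dominated_convergence[where w = "\<lambda>x. ennreal (4 * M\<^sup>2) * indicator {-(R + 1)..R + 1} x"])
      show "(\<integral>\<^sup>+x. ennreal (4 * M\<^sup>2) * indicator {-(R + 1)..R + 1} x \<partial>lborel) < \<infinity>"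
        by (simp add: nn_integral_cmult_indicator ennreal_mult_less_top emeasure_lborel_Icc_eq)
      show "AE x in lborel. (\<lambda>n. ennreal ((norm (h n x - g x))\<^sup>2)) \<longlonglongrightarrow> 0"
      proof -
        have "AE x in lebesgue. x \<notin> N"
          using N by (simp add: negligible_iff_null_sets AE_not_in)
        then have "AE x in lborel. x \<notin> N" by (simp add: AE_completion_iff)
        then show ?thesis
        proof eventually_elim
          case (elim x)
          have "(\<lambda>n. clamp (G n x)) \<longlonglongrightarrow> clamp (g x)"
            by (rule continuous_on_tendsto_compose[OF clamp_cont lim[OF elim]]) auto
          then have "(\<lambda>n. h n x) \<longlonglongrightarrow> cut x *\<^sub>R g x"
            unfolding h_def clamp_eq[OF M] by (intro tendsto_intros)
          also have "cut x *\<^sub>R g x = g x"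
            using supp[of x] by (cases "\<bar>x\<bar> > R") (auto simp: cut_def)
          finally have "(\<lambda>n. (norm (h n x - g x))\<^sup>2) \<longlonglongrightarrow> (norm (g x - g x))\<^sup>2"
            by (intro tendsto_intros)
          then show ?case using tendsto_ennrealI by fastforce
        qed
      qed
      show "AE x in lborel. ennreal ((norm (h n x - g x))\<^sup>2) \<le> ennreal (4 * M\<^sup>2) * indicator {-(R + 1)..R + 1} x" for n
      proof (rule AE_I2)
        fix x
        show "ennreal ((norm (h n x - g x))\<^sup>2) \<le> ennreal (4 * M\<^sup>2) * indicator {-(R + 1)..R + 1} x"
        proof (cases "\<bar>x\<bar> > R + 1")
          case True
          then show ?thesis using supp[of x] h_supp[of x n] R by simp
        next
          case False
          have "norm (h n x - g x) \<le> M + M"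
            using norm_triangle_ineq4 h_le M by (meson add_mono order.trans)
          then have "(norm (h n x - g x))\<^sup>2 \<le> (M + M)\<^sup>2" by (intro power_mono) auto
          then show ?thesis using False by (auto intro!: ennreal_leI simp: power2_eq_square indicator_def)
        qed
      qed
    qed measurable
    then show ?thesis using h_cont h_le h_supp by (intro exI[of _ h]) auto
  qed
  ultimately show ?thesis using M0 order_le_less[of 0 M] by blast
qed

lemma nn_integral_triangle:
  assumes [measurable]: "f \<in> borel_measurable M" "g \<in> borel_measurable M"
    and le: "\<And>x. h x \<le> 2 * f x + 2 * g x" and nn: "\<And>x. 0 \<le> f x" "\<And>x. 0 \<le> (g x :: real)"
  shows "(\<integral>\<^sup>+x. ennreal (h x) \<partial>M) \<le> 2 * (\<integral>\<^sup>+x. ennreal (f x) \<partial>M) + 2 * (\<integral>\<^sup>+x. ennreal (g x) \<partial>M)"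
proof -
  have "(\<integral>\<^sup>+x. ennreal (h x) \<partial>M) \<le> (\<integral>\<^sup>+x. 2 * ennreal (f x) + 2 * ennreal (g x) \<partial>M)"
  proof (intro nn_integral_mono)
    fix x
    have "ennreal (h x) \<le> ennreal (2 * f x + 2 * g x)" by (intro ennreal_leI le)
    then show "ennreal (h x) \<le> 2 * ennreal (f x) + 2 * ennreal (g x)" using nn by (simp add: ennreal_mult)
  qed
  also have "\<dots> = 2 * (\<integral>\<^sup>+x. ennreal (f x) \<partial>M) + 2 * (\<integral>\<^sup>+x. ennreal (g x) \<partial>M)"
    by (subst nn_integral_add) (auto simp: nn_integral_cmult)
  finally show ?thesis .
qed

lemma nn_integral_norm_diff_square_le:
  fixes f g h :: "'a \<Rightarrow> 'b::euclidean_space"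
  assumes [measurable]: "f \<in> borel_measurable M" "g \<in> borel_measurable M" "h \<in> borel_measurable M"
  shows "L2sq M (\<lambda>x. f x - h x) \<le> 2 * L2sq M (\<lambda>x. f x - g x) + 2 * L2sq M (\<lambda>x. g x - h x)"
proof (rule nn_integral_triangle)
  show "(norm (f x - h x))\<^sup>2 \<le> 2 * (norm (f x - g x))\<^sup>2 + 2 * (norm (g x - h x))\<^sup>2" for x
    using norm_diff_square_le[of "f x - g x" "h x - g x"] by (simp add: norm_minus_commute)
qed auto

text \<open>Approximate \<open>g\<close> by a continuous compactly supported \<open>h\<close>, and multiply the inverse transform of
  \<open>h\<close> by a wide Gaussian: the product is a Schwartz function whose transform is a mollification
  of \<open>h\<close>.\<close>
lemma schwartz1_approx:
  fixes g :: "real \<Rightarrow> complex"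
  assumes [measurable]: "g \<in> borel_measurable borel" and M: "\<And>x. norm (g x) \<le> M"
    and supp: "\<And>x. \<bar>x\<bar> > R \<Longrightarrow> g x = 0" and R: "R > 0" and e: "e > (0::real)"
  shows "\<exists>q. schwartz1 q \<and> q \<in> borel_measurable borel \<and> L2sq lborel (\<lambda>\<xi>. fourier1 q \<xi> - g \<xi>) \<le> ennreal e"
proof -
  have d: "ennreal (e / 4) > 0" using e by simp
  from L2_approx_continuous[OF assms(1) M supp R] obtain H where
    H: "\<And>n. continuous_on UNIV (H n)" "\<And>n x. norm (H n x) \<le> M" "\<And>n x. \<bar>x\<bar> > R + 1 \<Longrightarrow> H n x = 0"
    "(\<lambda>n. L2sq lborel (\<lambda>x. H n x - g x)) \<longlonglongrightarrow> 0" by auto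
  from order_tendstoD(2)[OF H(4) d] obtain n0 where
    n0: "L2sq lborel (\<lambda>x. H n0 x - g x) < ennreal (e / 4)" by (auto simp: eventually_sequentially)
  define h where "h = H n0"
  have h: "continuous_on UNIV h" and hM: "\<And>x. norm (h x) \<le> M" and hs: "\<And>x. \<bar>x\<bar> > R + 1 \<Longrightarrow> h x = 0"
    using H unfolding h_def by auto
  have [measurable]: "h \<in> borel_measurable borel" by (rule borel_measurable_continuous_onI[OF h])
  have inth: "integrable lborel h"
  proof -
    have "integrable lborel (\<lambda>x. indicator {-(R+1)..R+1} x *\<^sub>R h x)"
      by (rule borel_integrable_compact) (auto intro: continuous_on_subset[OF h])
    moreover have "(\<lambda>x. indicator {-(R+1)..R+1} x *\<^sub>R h x) = h"
      using hs by (force simp: indicator_def)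
    ultimately show ?thesis by simp
  qed
  have inv: "(LINT y|lborel. iexp (y * x) * h y) = band_moment h (R + 1) 0 x" for x
  proof -
    have "set_integrable lborel {-(R+1)..R+1} (\<lambda>y. iexp (y * x) * h y)"
      unfolding set_integrable_def
      by (rule borel_integrable_compact) (auto intro!: continuous_intros continuous_on_subset[OF h])
    then have "(LINT y:{-(R+1)..R+1}|lborel. iexp (y * x) * h y) = integral {-(R+1)..R+1} (\<lambda>y. iexp (y * x) * h y)"
      by (rule set_borel_integral_eq_integral)
    moreover have "(LINT y:{-(R+1)..R+1}|lborel. iexp (y * x) * h y) = (LINT y|lborel. iexp (y * x) * h y)"
      unfolding set_lebesgue_integral_def
      by (intro Bochner_Integration.integral_cong refl) (use hs in \<open>force simp: indicator_def\<close>)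
    ultimately show ?thesis by (simp add: band_moment_def)
  qed
  let ?s = "\<lambda>n. 1 / real (Suc n)"
  \<comment> \<open>The trivial power \<open>x ^ 0\<close> exhibits \<open>q n\<close> as a monomial member of \<open>gaussian_combinations\<close>.\<close>
  define q where "q n x = (1 / (2 * pi) * x ^ 0 * exp (- (?s n * x)\<^sup>2 / 2)) *\<^sub>R band_moment h (R + 1) 0 x" for n x
  have qs: "schwartz1 (q n)" for n
    unfolding q_def[abs_def]
    by (rule schwartz1_gaussian_combinations[OF h _ gaussian_combinations.monomial]) auto
  have qm: "q n \<in> borel_measurable borel" for n
    unfolding q_def[abs_def] inv[symmetric] by measurable
  have "fourier1 (q n) \<xi> = (gaussian_mean (\<lambda>z. h (\<xi> + ?s n * z)))" for n \<xi>
  proof -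
    have "fourier1 (q n) \<xi> = (LINT x|lborel. of_real (1 / (2 * pi)) * (iexp (- (x * \<xi>)) * of_real (exp (- (?s n * x)\<^sup>2 / 2)) * (LINT y|lborel. iexp (y * x) * h y)))"
      unfolding fourier1_def q_def inv
      by (intro Bochner_Integration.integral_cong refl) (simp add: scaleR_conv_of_real mult_ac)
    also have "\<dots> = of_real (1 / (2 * pi)) * (of_real (2 * pi) * (gaussian_mean (\<lambda>z. h (\<xi> + ?s n * z))))"
      by (subst integral_mult_right_zero, subst gaussian_regularized_inversion[OF inth]) auto
    also have "\<dots> = (of_real (1 / (2 * pi)) * of_real (2 * pi)) * (gaussian_mean (\<lambda>z. h (\<xi> + ?s n * z)))"
      by (simp only: mult.assoc)
    also have "complex_of_real (1 / (2 * pi)) * of_real (2 * pi) = 1" by (simp flip: of_real_mult)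
    finally show ?thesis by (simp only: mult_1_left)
  qed
  then have "(\<lambda>n. L2sq lborel (\<lambda>\<xi>. fourier1 (q n) \<xi> - h \<xi>)) \<longlonglongrightarrow> 0"
    using gaussian_mollification_L2[OF h hs hM] by simp
  from order_tendstoD(2)[OF this d] obtain n where
    n: "L2sq lborel (\<lambda>\<xi>. fourier1 (q n) \<xi> - h \<xi>) < ennreal (e / 4)" by (auto simp: eventually_sequentially)
  have [measurable]: "fourier1 (q n) \<in> borel_measurable borel" using qm by (rule fourier1_measurable)
  have "L2sq lborel (\<lambda>\<xi>. fourier1 (q n) \<xi> - g \<xi>)
     \<le> 2 * L2sq lborel (\<lambda>\<xi>. fourier1 (q n) \<xi> - h \<xi>) + 2 * L2sq lborel (\<lambda>\<xi>. h \<xi> - g \<xi>)"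
    by (rule nn_integral_norm_diff_square_le) auto
  also have "\<dots> \<le> 2 * ennreal (e / 4) + 2 * ennreal (e / 4)"
    using n n0 unfolding h_def by (intro add_mono mult_left_mono) auto
  also have "\<dots> = ennreal e"
    using e by (simp flip: ennreal_mult ennreal_plus ennreal_numeral)
  finally show ?thesis using qs qm by blast
qed

lemma schwartz_approx:
  fixes g :: "real \<Rightarrow> complex^'n"
  assumes [measurable]: "g \<in> borel_measurable borel" and M: "\<And>x. norm (g x) \<le> M"
    and supp: "\<And>x. \<bar>x\<bar> > R \<Longrightarrow> g x = 0" and R: "R > 0" and e: "e > (0::real)"
  shows "\<exists>q. schwartz q \<and> L2sq lborel (\<lambda>\<xi>. fourier q \<xi> - g \<xi>) \<le> ennreal e"
proof -
  have d: "e / CARD('n) > 0" using e by simp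
  have "\<forall>i. \<exists>q. schwartz1 q \<and> q \<in> borel_measurable borel \<and> L2sq lborel (\<lambda>\<xi>. fourier1 q \<xi> - g \<xi> $ i) \<le> ennreal (e / CARD('n))"
  proof
    fix i
    show "\<exists>q. schwartz1 q \<and> q \<in> borel_measurable borel \<and> L2sq lborel (\<lambda>\<xi>. fourier1 q \<xi> - g \<xi> $ i) \<le> ennreal (e / CARD('n))"
    proof (rule schwartz1_approx[where M = M and R = R])
      show "norm (g x $ i) \<le> M" for x
        by (rule order.trans[OF Finite_Cartesian_Product.norm_nth_le M])
      show "g x $ i = 0" if "\<bar>x\<bar> > R" for x using supp[OF that] by simp
    qed (use R d in auto)
  qed
  from choice[OF this] obtain Q where Q: "\<And>i. schwartz1 (Q i)" "\<And>i. Q i \<in> borel_measurable borel"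
     "\<And>i. (L2sq lborel (\<lambda>\<xi>. fourier1 (Q i) \<xi> - g \<xi> $ i)) \<le> ennreal (e / CARD('n))" by blast
  define q where "q x = (\<chi> i. Q i x)" for x
  have q: "schwartz q" by (rule schwartz_componentwise) (simp add: q_def Q)
  have [measurable]: "fourier1 (Q i) \<in> borel_measurable borel" for i using Q(2) by (rule fourier1_measurable)
  have comp: "fourier q \<xi> $ i = fourier1 (Q i) \<xi>" for \<xi> i
    using fourier_component[OF schwartz_integrable[OF q]] by (simp add: q_def)
  have "L2sq lborel (\<lambda>\<xi>. fourier q \<xi> - g \<xi>)
      = (\<Sum>i\<in>UNIV. (L2sq lborel (\<lambda>\<xi>. fourier1 (Q i) \<xi> - g \<xi> $ i)))"
    by (subst nn_integral_sum[symmetric]) (auto simp: norm_vec_square comp)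
  also have "\<dots> \<le> (\<Sum>i\<in>(UNIV::'n set). ennreal (e / CARD('n)))"
    by (intro sum_mono Q)
  also have "\<dots> = ennreal e"
    using e by (simp add: ennreal_of_nat_eq_real_of_nat flip: ennreal_mult)
  finally show ?thesis using q by blast
qed

lemma plancherel:
  fixes f :: "real \<Rightarrow> complex^'n"
  assumes f: "integrable lborel f" and cont: "continuous_on UNIV f" and bd: "bounded (range f)"
  shows "L2sq lborel (fourier f) = ennreal (2 * pi) * L2sq lborel f"
proof -
  have fm[measurable]: "f \<in> borel_measurable borel" using f by auto
  have [measurable]: "fourier1 (\<lambda>x. f x $ i) \<in> borel_measurable borel" for i
    by (rule fourier1_measurable) simp
  have c: "L2sq lborel (\<lambda>\<xi>. fourier1 (\<lambda>x. f x $ i) \<xi>) = ennreal (2 * pi) * L2sq lborel (\<lambda>x. f x $ i)" for i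
  proof (rule plancherel_scalar)
    show "integrable lborel (\<lambda>x. f x $ i)"
      by (rule integrable_bounded_linear[OF bounded_linear_vec_nth f])
    show "continuous_on UNIV (\<lambda>x. f x $ i)" by (intro continuous_intros cont)
    show "bounded (range (\<lambda>x. f x $ i))"
      using bounded_linear_image[OF bd bounded_linear_vec_nth, of i] by (simp add: image_image)
  qed
  have "L2sq lborel (fourier f) = (\<Sum>i\<in>UNIV. L2sq lborel (\<lambda>\<xi>. fourier1 (\<lambda>x. f x $ i) \<xi>))"
    by (subst nn_integral_sum[symmetric]) (auto simp: norm_vec_square fourier_component[OF f])
  also have "\<dots> = ennreal (2 * pi) * (\<Sum>i\<in>UNIV. L2sq lborel (\<lambda>x. f x $ i))"
    unfolding c by (simp add: sum_distrib_left)
  also have "(\<Sum>i\<in>UNIV. L2sq lborel (\<lambda>x. f x $ i)) = L2sq lborel f"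
    by (subst nn_integral_sum[symmetric]) (auto simp: norm_vec_square)
  finally show ?thesis .
qed

section \<open>Orthogonal projections on the Kalman layers\<close>

definition vec_Re :: "complex^'n \<Rightarrow> real^'n" where "vec_Re v = (\<chi> j. Re (v $ j))"
definition vec_Im :: "complex^'n \<Rightarrow> real^'n" where "vec_Im v = (\<chi> j. Im (v $ j))"

lemma vec_Re_nth [simp]: "vec_Re v $ j = Re (v $ j)" by (simp add: vec_Re_def)
lemma vec_Im_nth [simp]: "vec_Im v $ j = Im (v $ j)" by (simp add: vec_Im_def)

lemma vec_complex_eq_iff: "v = w \<longleftrightarrow> vec_Re v = vec_Re w \<and> vec_Im v = vec_Im w"
  by (auto simp: vec_eq_iff complex_eq_iff)

lemma norm_vec_Re_Im: "(norm (v :: complex^'n))\<^sup>2 = (norm (vec_Re v))\<^sup>2 + (norm (vec_Im v))\<^sup>2"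
  by (simp add: norm_vec_def L2_set_def sum_nonneg cmod_power2 sum.distrib)

lemma linear_vec_Re: "linear (vec_Re :: complex^'n \<Rightarrow> real^'n)"
  and linear_vec_Im: "linear (vec_Im :: complex^'n \<Rightarrow> real^'n)"
  by (auto intro!: linearI simp: vec_eq_iff)

lemma vec_Re_add: "vec_Re (v + w) = vec_Re v + vec_Re w"
  and vec_Im_add: "vec_Im (v + w) = vec_Im v + vec_Im w"
  and vec_Re_scaleR: "vec_Re (c *\<^sub>R v) = c *\<^sub>R vec_Re v"
  and vec_Im_scaleR: "vec_Im (c *\<^sub>R v) = c *\<^sub>R vec_Im v"
  by (simp_all add: vec_eq_iff)

lemma vec_Re_complexify [simp]: "vec_Re (complexify L v) = L (vec_Re v)"
  and vec_Im_complexify [simp]: "vec_Im (complexify L v) = L (vec_Im v)"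
  by (simp_all add: vec_eq_iff complexify_def vec_Re_def vec_Im_def)

lemma linear_complexify:
  assumes "linear L"
  shows "linear (complexify L)"
  by (intro linearI)
    (simp_all add: vec_complex_eq_iff vec_Re_add vec_Im_add vec_Re_scaleR vec_Im_scaleR
      linear_add[OF assms] linear_scale[OF assms])

lemma vec_Re_complex_matrix [simp]: "vec_Re (complex_matrix M *v v) = M *v vec_Re v"
  and vec_Im_complex_matrix [simp]: "vec_Im (complex_matrix M *v v) = M *v vec_Im v"
  by (simp_all add: vec_eq_iff complex_matrix_def matrix_vector_mult_def map_matrix_def)

lemma complex_matrix_mult_vec:
  "complex_matrix (M ** N) *v v = complex_matrix M *v (complex_matrix N *v v)"
  by (simp add: vec_complex_eq_iff flip: matrix_vector_mul_assoc)

lemma complex_matrix_one [simp]: "complex_matrix (mat 1) *v v = v"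
  by (simp add: vec_complex_eq_iff)

lemma orth_proj_eqI:
  assumes V: "subspace V" and y: "y \<in> V" "\<And>z. z \<in> V \<Longrightarrow> orthogonal (x - y) z"
  shows "orth_proj V x = y"
  unfolding orth_proj_def
proof (rule the_equality)
  fix w assume w: "w \<in> V \<and> (\<forall>z\<in>V. orthogonal (x - w) z)"
  then have "y - w \<in> V" using V y by (simp add: subspace_diff)
  then have "orthogonal (x - w) (y - w)" "orthogonal (x - y) (y - w)" using w y by auto
  then have "(y - w) \<bullet> (y - w) = 0" by (simp add: orthogonal_def inner_diff_left)
  then show "w = y" by simp
qed (use y in auto)

lemma orth_proj_works:
  assumes V: "subspace V"
  shows "orth_proj V x \<in> V" "z \<in> V \<Longrightarrow> orthogonal (x - orth_proj V x) z"
proof -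
  obtain y z where yz: "y \<in> span V" "\<And>w. w \<in> span V \<Longrightarrow> orthogonal z w" "x = y + z"
    using orthogonal_subspace_decomp_exists by blast
  have sV: "span V = V" using V by (simp only: span_eq_iff)
  have "orth_proj V x = y"
    using yz unfolding sV by (intro orth_proj_eqI V) auto
  then show "orth_proj V x \<in> V" "z \<in> V \<Longrightarrow> orthogonal (x - orth_proj V x) z" for z
    using yz unfolding sV by auto
qed

lemma orth_proj_id: "subspace V \<Longrightarrow> x \<in> V \<Longrightarrow> orth_proj V x = x"
  by (rule orth_proj_eqI) (auto simp: orthogonal_def)

lemma orth_proj_eq_0: "subspace V \<Longrightarrow> (\<And>z. z \<in> V \<Longrightarrow> orthogonal x z) \<Longrightarrow> orth_proj V x = 0"
  by (rule orth_proj_eqI) (auto simp: subspace_0)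

lemma linear_orth_proj:
  assumes V: "subspace V"
  shows "linear (orth_proj V)"
proof (rule linearI)
  fix x y
  show "orth_proj V (x + y) = orth_proj V x + orth_proj V y"
  proof (rule orth_proj_eqI[OF V])
    fix z assume z: "z \<in> V"
    show "orthogonal (x + y - (orth_proj V x + orth_proj V y)) z"
      using orth_proj_works(2)[OF V z, of x] orth_proj_works(2)[OF V z, of y]
      by (simp add: orthogonal_def inner_diff_left inner_add_left)
  qed (use orth_proj_works(1)[OF V] V in \<open>auto intro: subspace_add\<close>)
next
  fix c x
  show "orth_proj V (c *\<^sub>R x) = c *\<^sub>R orth_proj V x"
  proof (rule orth_proj_eqI[OF V])
    fix z assume z: "z \<in> V"
    show "orthogonal (c *\<^sub>R x - c *\<^sub>R orth_proj V x) z"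
      using orth_proj_works(2)[OF V z, of x]
      by (simp add: orthogonal_def inner_diff_left flip: scaleR_diff_right)
  qed (use orth_proj_works(1)[OF V] V in \<open>auto intro: subspace_scale\<close>)
qed

definition kalman_below :: "real^'n^'n \<Rightarrow> real^'m^'n \<Rightarrow> nat \<Rightarrow> (real^'n) set" where
  "kalman_below A B k = (case k of 0 \<Rightarrow> {0} | Suc j \<Rightarrow> kalman_space A B j)"

lemma kalman_layer_alt: "kalman_layer A B k = kalman_space A B k \<inter> (kalman_below A B k)\<^sup>\<bottom>"
  by (simp add: kalman_layer_def kalman_below_def)

lemma kalman_below_Suc [simp]: "kalman_below A B (Suc k) = kalman_space A B k"
  and kalman_below_0 [simp]: "kalman_below A B 0 = {0}"
  by (simp_all add: kalman_below_def)

lemma subspace_kalman_space: "subspace (kalman_space A B k)"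
  by (simp add: kalman_space_def)

lemma subspace_kalman_below: "subspace (kalman_below A B k)"
  by (cases k) (auto simp: subspace_kalman_space subspace_0)

lemma subspace_kalman_layer: "subspace (kalman_layer A B k)"
  unfolding kalman_layer_alt
  by (intro subspace_inter subspace_kalman_space subspace_orthogonal_comp)

lemma kalman_space_mono: "j \<le> k \<Longrightarrow> kalman_space A B j \<subseteq> kalman_space A B k"
  unfolding kalman_space_def kalman_columns_def by (intro span_mono UN_mono) auto

lemma kalman_below_subset: "kalman_below A B k \<subseteq> kalman_space A B k"
  by (cases k) (auto simp: subspace_0[OF subspace_kalman_space] intro: subsetD[OF kalman_space_mono, rotated])

lemma kalman_layer_in_space: "x \<in> kalman_layer A B k \<Longrightarrow> x \<in> kalman_space A B k"
  by (simp add: kalman_layer_alt)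

lemma kalman_layer_orthogonal: "x \<in> kalman_layer A B k \<Longrightarrow> y \<in> kalman_below A B k \<Longrightarrow> orthogonal x y"
  by (auto simp: kalman_layer_alt orthogonal_comp_def orthogonal_commute)

lemma kalman_layers_orthogonal:
  assumes "x \<in> kalman_layer A B j" "y \<in> kalman_layer A B k" "j \<noteq> k"
  shows "orthogonal x y"
proof -
  have *: "orthogonal x y" if "x \<in> kalman_layer A B j" "y \<in> kalman_layer A B k" "j < k" for x y j k
  proof -
    obtain k' where "k = Suc k'" "j \<le> k'" using \<open>j < k\<close> by (cases k) auto
    then have "x \<in> kalman_below A B k"
      using kalman_layer_in_space[OF that(1)] kalman_space_mono[of j k'] by auto
    then show ?thesis using kalman_layer_orthogonal[OF that(2)] by (simp add: orthogonal_commute)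
  qed
  from assms(3) show ?thesis
    using *[OF assms(1,2)] *[OF assms(2,1)] by (auto simp: orthogonal_commute neq_iff)
qed

text \<open>The layers are the successive orthogonal increments of the Kalman spaces; sums over layers
  therefore telescope.\<close>
lemma orth_proj_kalman_layer:
  "orth_proj (kalman_layer A B k) x = orth_proj (kalman_space A B k) x - orth_proj (kalman_below A B k) x"
proof (rule orth_proj_eqI[OF subspace_kalman_layer])
  note S = orth_proj_works[OF subspace_kalman_space[of A B k]]
  note L = orth_proj_works[OF subspace_kalman_below[of A B k]]
  have "orth_proj (kalman_space A B k) x - orth_proj (kalman_below A B k) x \<in> kalman_space A B k"
    using subsetD[OF kalman_below_subset L(1)] by (intro subspace_diff subspace_kalman_space S(1))
  moreover have "orthogonal (orth_proj (kalman_space A B k) x - orth_proj (kalman_below A B k) x) z"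
    if z: "z \<in> kalman_below A B k" for z
    using S(2)[of z x] L(2)[OF z, of x] z kalman_below_subset[of A B k]
    by (auto simp: orthogonal_def inner_diff_left)
  ultimately show "orth_proj (kalman_space A B k) x - orth_proj (kalman_below A B k) x \<in> kalman_layer A B k"
    by (auto simp: kalman_layer_alt orthogonal_comp_def orthogonal_commute)
  fix z assume z: "z \<in> kalman_layer A B k"
  show "orthogonal (x - (orth_proj (kalman_space A B k) x - orth_proj (kalman_below A B k) x)) z"
    using S(2)[OF kalman_layer_in_space[OF z], of x] kalman_layer_orthogonal[OF z L(1)[of x]]
    by (simp add: orthogonal_def inner_diff_left inner_diff_right inner_commute)
qed

lemma sum_orth_proj_kalman_layer:
  "(\<Sum>k\<le>n. orth_proj (kalman_layer A B k) x) = orth_proj (kalman_space A B n) x"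
proof (induction n)
  case 0
  have "orth_proj {0} x = (0::real^'a)" by (rule orth_proj_eqI) (auto simp: subspace_0 orthogonal_def)
  then show ?case by (simp add: orth_proj_kalman_layer)
next
  case (Suc n)
  then show ?case by (simp add: orth_proj_kalman_layer)
qed

lemma kalman_space_full:
  assumes "kalman_index A B K"
  shows "kalman_space (A :: real^'n^'n) B K = UNIV"
proof -
  have "dim (kalman_columns A B K) = DIM(real^'n)"
    using assms by (simp add: kalman_index_def kalman_rank_def)
  then show ?thesis unfolding kalman_space_def by (simp only: dim_eq_full)
qed

lemma sum_orth_proj_kalman_layer_full:
  assumes "kalman_index A B K"
  shows "(\<Sum>k\<le>K. orth_proj (kalman_layer A B k) x) = x"
  unfolding sum_orth_proj_kalman_layer kalman_space_full[OF assms]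
  by (rule orth_proj_id) auto

text \<open>Pair \<open>x\<close> with its own decomposition: \<open>x \<bullet> \<Pi>\<^sub>k x = |\<Pi>\<^sub>k x|\<^sup>2\<close>.\<close>
lemma norm_sum_orth_proj_kalman_layer:
  assumes "kalman_index A B K"
  shows "(\<Sum>k\<le>K. (norm (orth_proj (kalman_layer A B k) x))\<^sup>2) = (norm x)\<^sup>2"
proof -
  have "(norm x)\<^sup>2 = x \<bullet> (\<Sum>k\<le>K. orth_proj (kalman_layer A B k) x)"
    by (simp add: sum_orth_proj_kalman_layer_full[OF assms] power2_norm_eq_inner)
  also have "\<dots> = (\<Sum>k\<le>K. x \<bullet> orth_proj (kalman_layer A B k) x)" by (rule inner_sum_right)
  also have "\<dots> = (\<Sum>k\<le>K. (norm (orth_proj (kalman_layer A B k) x))\<^sup>2)"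
  proof (intro sum.cong refl)
    fix k
    show "x \<bullet> orth_proj (kalman_layer A B k) x = (norm (orth_proj (kalman_layer A B k) x))\<^sup>2"
      using orth_proj_works(2)[OF subspace_kalman_layer orth_proj_works(1)[OF subspace_kalman_layer], of x A B k x]
      by (simp add: orthogonal_def inner_diff_left power2_norm_eq_inner)
  qed
  finally show ?thesis by simp
qed

lemma linear_kalman_proj: "linear (kalman_proj A B k)"
  unfolding kalman_proj_def by (intro linear_complexify linear_orth_proj subspace_kalman_layer)

lemma sum_kalman_proj:
  assumes "kalman_index A B K"
  shows "(\<Sum>k\<le>K. kalman_proj A B k v) = v"
  unfolding vec_complex_eq_iff linear_sum[OF linear_vec_Re] linear_sum[OF linear_vec_Im]
  by (simp add: kalman_proj_def sum_orth_proj_kalman_layer_full[OF assms])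

lemma norm_sum_kalman_proj:
  assumes "kalman_index A B K"
  shows "(\<Sum>k\<le>K. (norm (kalman_proj A B k v))\<^sup>2) = (norm v)\<^sup>2"
  by (simp add: norm_vec_Re_Im kalman_proj_def sum.distrib norm_sum_orth_proj_kalman_layer[OF assms])

lemma kalman_proj_kalman_proj:
  "kalman_proj A B j (kalman_proj A B k v) = (if j = k then kalman_proj A B k v else 0)"
proof -
  have "orth_proj (kalman_layer A B j) (orth_proj (kalman_layer A B k) x)
      = (if j = k then orth_proj (kalman_layer A B k) x else 0)" for x
    using orth_proj_works(1)[OF subspace_kalman_layer, of A B k x]
    by (auto intro!: orth_proj_id orth_proj_eq_0 subspace_kalman_layer kalman_layers_orthogonal)
  moreover have "vec_Re (0::complex^'a) = 0" "vec_Im (0::complex^'a) = 0" by (simp_all add: vec_eq_iff)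
  ultimately show ?thesis by (auto simp: vec_complex_eq_iff kalman_proj_def)
qed

lemma kalman_proj_combination:
  assumes "k \<le> K"
  shows "kalman_proj A B k (\<Sum>j\<le>K. a j *\<^sub>R kalman_proj A B j v) = a k *\<^sub>R kalman_proj A B k v"
proof -
  have "kalman_proj A B k (\<Sum>j\<le>K. a j *\<^sub>R kalman_proj A B j v)
      = (\<Sum>j\<le>K. a j *\<^sub>R (if k = j then kalman_proj A B j v else 0))"
    unfolding linear_sum[OF linear_kalman_proj] linear_scale[OF linear_kalman_proj] kalman_proj_kalman_proj ..
  also have "\<dots> = (\<Sum>j\<le>K. if k = j then a k *\<^sub>R kalman_proj A B k v else 0)"
    by (intro sum.cong) auto
  finally show ?thesis using assms by simp
qed

lemma transpose_mult_eq_0_iff: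
  "transpose M *v x = 0 \<longleftrightarrow> (\<forall>c\<in>columns M. orthogonal x (c :: real^'n))"
proof -
  have "(transpose M *v x) $ i = x \<bullet> column i M" for i
    by (simp add: matrix_vector_mult_def transpose_def column_def inner_vec_def mult.commute del: transpose_matrix_vector)
  then have "transpose M *v x = 0 \<longleftrightarrow> (\<forall>i. x \<bullet> column i M = 0)"
    by (simp only: vec_eq_iff zero_index)
  then show ?thesis
    by (auto simp: columns_def orthogonal_def simp del: transpose_matrix_vector)
qed

text \<open>The range of \<open>A\<^sup>j B\<close> lies in the Kalman space of index \<open>k - 1\<close>, to which the layer is
  orthogonal. This is why layer \<open>k\<close> is seen only at order \<open>k\<close> in time.\<close>
lemma kalman_block_kills_layer:
  assumes "j < k" "x \<in> kalman_layer A B k"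
  shows "transpose (kalman_block A B j) *v x = 0"
proof -
  obtain k' where k: "k = Suc k'" "j \<le> k'" using \<open>j < k\<close> by (cases k) auto
  have "c \<in> kalman_below A B k" if "c \<in> columns (kalman_block A B j)" for c
    using that k unfolding k kalman_below_Suc kalman_space_def kalman_columns_def by (auto intro!: span_base)
  then show ?thesis
    using kalman_layer_orthogonal[OF assms(2)] unfolding transpose_mult_eq_0_iff by blast
qed

lemma kalman_space_orthogonal:
  assumes "\<And>j. j \<le> k \<Longrightarrow> transpose (kalman_block A B j) *v x = 0" "y \<in> kalman_space A B k"
  shows "orthogonal x y"
proof (rule orthogonal_to_span)
  show "y \<in> span (kalman_columns A B k)" using assms(2) by (simp add: kalman_space_def)
  show "orthogonal x c" if "c \<in> kalman_columns A B k" for c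
    using that assms(1) unfolding kalman_columns_def transpose_mult_eq_0_iff by auto
qed

text \<open>Such an \<open>x\<close> is orthogonal to the whole Kalman space of index \<open>k\<close>, which contains it.\<close>
lemma kalman_block_inj_layer:
  assumes x: "x \<in> kalman_layer A B k" and 0: "transpose (kalman_block A B k) *v x = 0"
  shows "x = 0"
proof -
  have "transpose (kalman_block A B j) *v x = 0" if "j \<le> k" for j
    using kalman_block_kills_layer[OF _ x, of j] 0 that by (cases "j = k") auto
  from kalman_space_orthogonal[OF this kalman_layer_in_space[OF x]] show ?thesis
    by (simp add: orthogonal_self)
qed

lemma kalman_block_inj:
  assumes "kalman_index A B K" "\<And>j. j \<le> K \<Longrightarrow> transpose (kalman_block A B j) *v x = 0"
  shows "x = 0"
proof -
  have "orthogonal x x"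
    using kalman_space_orthogonal[OF assms(2)] kalman_space_full[OF assms(1)] by auto
  then show ?thesis by (simp add: orthogonal_self)
qed

text \<open>By minimality of the Kalman index the preceding Kalman space is a proper subspace.\<close>
lemma kalman_layer_nonzero:
  fixes A :: "real^'n^'n"
  assumes K: "kalman_index A B K"
  shows "\<exists>x\<in>kalman_layer A B K. x \<noteq> 0"
proof -
  have "dim (kalman_below A B K) < DIM(real^'n)"
  proof (cases K)
    case (Suc j)
    then have "dim (kalman_columns A B j) \<noteq> CARD('n)" using K by (auto simp: kalman_index_def kalman_rank_def)
    then show ?thesis using dim_subset_UNIV[of "kalman_columns A B j"] by (simp add: Suc kalman_space_def)
  qed simp
  then obtain x where x: "x \<noteq> 0" "\<And>y. y \<in> span (kalman_below A B K) \<Longrightarrow> orthogonal x y"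
    by (rule orthogonal_to_subspace_exists) auto
  then have "x \<in> kalman_layer A B K"
    by (auto simp: kalman_layer_alt kalman_space_full[OF K] orthogonal_comp_def orthogonal_commute intro: span_base)
  with x show ?thesis by blast
qed

text \<open>The \<open>j\<close>-th Taylor coefficient \<open>B\<^sup>T (A\<^sup>T)\<^sup>j\<close> of the observation, on complex vectors.\<close>
definition obs_block :: "real^'n^'n \<Rightarrow> real^'m^'n \<Rightarrow> nat \<Rightarrow> complex^'n \<Rightarrow> complex^'m" where
  "obs_block A B j v = complex_matrix (transpose (kalman_block A B j)) *v v"

lemma vec_Re_0 [simp]: "vec_Re 0 = 0" and vec_Im_0 [simp]: "vec_Im 0 = 0"
  by (simp_all add: vec_eq_iff)

lemma obs_block_kalman_proj: "j < k \<Longrightarrow> obs_block A B j (kalman_proj A B k v) = 0"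
  by (simp add: obs_block_def vec_complex_eq_iff kalman_proj_def kalman_block_kills_layer
      orth_proj_works(1)[OF subspace_kalman_layer] del: transpose_matrix_vector)

lemma obs_block_inj_layer:
  "obs_block A B k (kalman_proj A B k v) = 0 \<Longrightarrow> kalman_proj A B k v = 0"
  using kalman_block_inj_layer[OF orth_proj_works(1)[OF subspace_kalman_layer[of A B k], of "vec_Re v"]]
    kalman_block_inj_layer[OF orth_proj_works(1)[OF subspace_kalman_layer[of A B k], of "vec_Im v"]]
  by (simp add: obs_block_def vec_complex_eq_iff kalman_proj_def del: transpose_matrix_vector)

lemma obs_block_inj:
  "kalman_index A B K \<Longrightarrow> (\<And>j. j \<le> K \<Longrightarrow> obs_block A B j v = 0) \<Longrightarrow> v = 0"
  using kalman_block_inj[of A B K "vec_Re v"] kalman_block_inj[of A B K "vec_Im v"]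
  by (simp add: obs_block_def vec_complex_eq_iff del: transpose_matrix_vector)

lemma obs_block_0: "obs_block A B 0 v = complex_matrix (transpose B) *v v"
  by (simp add: obs_block_def kalman_block_def)

lemma obs_block_Suc: "obs_block A B (Suc j) v = obs_block A B j (complex_matrix (transpose A) *v v)"
  by (simp add: obs_block_def kalman_block_def matrix_transpose_mul complex_matrix_mult_vec)

section \<open>Functional calculus of the transposed matrix\<close>

definition exp_tail :: "nat \<Rightarrow> complex \<Rightarrow> complex" where
  "exp_tail k z = (\<Sum>n. inverse (fact (n + k)) * z ^ n)"

lemma summable_exp_tail: "summable (\<lambda>n. inverse (fact (n + k)) * (z::complex) ^ n)"
proof (rule summable_comparison_test'[where N = 0])
  show "summable (\<lambda>n. inverse (fact n) * norm z ^ n)" by (rule summable_exp)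
  show "norm (inverse (fact (n + k)) * z ^ n) \<le> inverse (fact n) * norm z ^ n" for n
    unfolding norm_mult norm_power norm_inverse norm_fact
    by (intro mult_right_mono le_imp_inverse_le fact_mono) auto
qed

lemma exp_eq_exp_tail: "exp z = (\<Sum>j<k. z ^ j / fact j) + z ^ k * exp_tail k z"
proof -
  have "exp z = (\<Sum>n. inverse (fact (n + k)) * z ^ (n + k)) + (\<Sum>j<k. inverse (fact j) * z ^ j)"
    unfolding exp_def scaleR_conv_of_real
    using suminf_split_initial_segment[OF summable_exp[of z], of k] by simp
  also have "(\<Sum>n. inverse (fact (n + k)) * z ^ (n + k)) = (\<Sum>n. z ^ k * (inverse (fact (n + k)) * z ^ n))"
    by (simp add: power_add mult_ac)
  also have "\<dots> = z ^ k * exp_tail k z"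
    unfolding exp_tail_def by (rule suminf_mult[OF summable_exp_tail])
  finally show ?thesis by (simp add: divide_inverse mult.commute)
qed

lemma exp_tail_0: "exp_tail k 0 = 1 / fact k"
proof -
  have "exp_tail k 0 = (\<Sum>n. if n = 0 then 1 / fact k else 0)"
    unfolding exp_tail_def by (intro suminf_cong) (auto simp: divide_inverse)
  then show ?thesis by (simp add: sums_unique[OF sums_single, symmetric])
qed

lemma continuous_on_exp_tail [continuous_intros]:
  "continuous_on S f \<Longrightarrow> continuous_on S (\<lambda>x. exp_tail k (f x))"
proof -
  have "continuous_on UNIV (exp_tail k)"
    unfolding exp_tail_def[abs_def]
    by (intro continuous_at_imp_continuous_on ballI isCont_powser_converges_everywhere summable_exp_tail)
  then show "continuous_on S f \<Longrightarrow> continuous_on S (\<lambda>x. exp_tail k (f x))"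
    by (rule continuous_on_compose2) auto
qed

lemma matrix_inv_works:
  assumes "invertible P"
  shows "P ** matrix_inv P = mat 1" "matrix_inv P ** P = mat 1"
  using someI_ex[OF assms[unfolded invertible_def]] unfolding matrix_inv_def by auto

lemma norm_vec_mult_le:
  fixes v :: "complex^'n"
  assumes "\<And>l. norm (a l) \<le> 1"
  shows "norm (\<chi> l. a l * v $ l) \<le> norm v"
proof -
  have "(norm (\<chi> l. a l * v $ l))\<^sup>2 \<le> (norm v)\<^sup>2"
    unfolding norm_vec_def L2_set_def
    by (simp add: sum_nonneg norm_mult power_mult_distrib)
      (intro sum_mono mult_left_le_one_le power_le_one assms; simp)
  then show ?thesis by (rule power2_le_imp_le) simp
qed

text \<open>Working in eigencoordinates makes exponentials, their Taylor remainders and the translations in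
  the explicit solution all instances of one diagonal functional calculus.\<close>
locale diagonalized_pair =
  fixes A :: "real^'n^'n" and B :: "real^'m^'n" and P :: "real^'n^'n" and eigval :: "'n \<Rightarrow> real"
  assumes invertible_P: "invertible P"
    and A_eq: "A = P ** (\<chi> i j. if i = j then eigval i else 0) ** matrix_inv P"
begin

definition coords :: "complex^'n \<Rightarrow> complex^'n" where
  "coords v = complex_matrix (transpose P) *v v"

definition from_coords :: "complex^'n \<Rightarrow> complex^'n" where
  "from_coords u = complex_matrix (transpose (matrix_inv P)) *v u"

text \<open>The operator \<open>f(A\<^sup>T)\<close>; \<open>obs_spec\<close> below is \<open>B\<^sup>T f(A\<^sup>T)\<close>.\<close>
definition spec :: "(real \<Rightarrow> complex) \<Rightarrow> complex^'n \<Rightarrow> complex^'n" where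
  "spec f v = from_coords (\<chi> l. f (eigval l) * coords v $ l)"

definition obs_coeff :: "complex^'n^'m" where
  "obs_coeff = complex_matrix (transpose B) ** complex_matrix (transpose (matrix_inv P))"

definition obs_spec :: "(real \<Rightarrow> complex) \<Rightarrow> complex^'n \<Rightarrow> complex^'m" where
  "obs_spec f v = (\<chi> i. \<Sum>l\<in>UNIV. f (eigval l) * (obs_coeff $ i $ l * coords v $ l))"

lemma coords_from_coords [simp]: "coords (from_coords u) = u"
  and from_coords_coords [simp]: "from_coords (coords v) = v"
  unfolding coords_def from_coords_def complex_matrix_mult_vec[symmetric] matrix_transpose_mul[symmetric]
  using matrix_inv_works[OF invertible_P] by (simp_all add: transpose_mat)

lemma coords_add: "coords (v + w) = coords v + coords w"
  and coords_diff: "coords (v - w) = coords v - coords w"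
  and coords_scaleR: "coords (c *\<^sub>R v) = c *\<^sub>R coords v"
  unfolding coords_def
  by (simp_all add: matrix_vector_right_distrib matrix_vector_mult_diff_distrib linear_scale[OF bounded_linear.linear[OF matrix_vector_mul_bounded_linear]])

lemma coords_spec: "coords (spec f v) $ l = f (eigval l) * coords v $ l"
  by (simp add: spec_def)

lemma spec_one: "spec (\<lambda>x. 1) v = v"
  by (simp add: spec_def)

lemma obs_eq: "complex_matrix (transpose B) *v from_coords u = obs_coeff *v u"
  by (simp add: from_coords_def obs_coeff_def matrix_vector_mul_assoc)

lemma obs_spec_eq: "obs_spec f v = complex_matrix (transpose B) *v spec f v"
  unfolding spec_def obs_eq by (simp add: obs_spec_def vec_eq_iff matrix_vector_mult_def mult_ac)

lemma obs_spec_spec: "obs_spec f (spec g v) = obs_spec (\<lambda>x. f x * g x) v"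
  by (simp add: obs_spec_def coords_spec mult_ac)

lemma complex_matrix_A: "complex_matrix (transpose A) *v v = spec of_real v"
proof -
  have D: "transpose (\<chi> i j. if i = j then eigval i else 0) = ((\<chi> i j. if i = j then eigval i else 0) :: real^'n^'n)"
    by (auto simp: transpose_def vec_eq_iff)
  have "complex_matrix (\<chi> i j. if i = j then eigval i else 0) *v u = (\<chi> l. of_real (eigval l) * u $ l)" for u :: "complex^'n"
    by (simp add: vec_eq_iff complex_matrix_def map_matrix_def matrix_vector_mult_def if_distrib[of complex_of_real] if_distrib[of "\<lambda>x. x * _"] cong: if_cong)
  then show ?thesis
    unfolding A_eq matrix_transpose_mul D complex_matrix_mult_vec spec_def coords_def from_coords_def by simp
qed

lemma obs_block_eq: "obs_block A B j v = obs_spec (\<lambda>x. of_real x ^ j) v"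
proof (induction j arbitrary: v)
  case 0
  then show ?case by (simp add: obs_block_0 obs_spec_eq spec_one)
next
  case (Suc j)
  then show ?case by (simp add: obs_block_Suc complex_matrix_A obs_spec_spec mult.commute)
qed

lemma obs_spec_add: "obs_spec f (v + w) = obs_spec f v + obs_spec f w"
  by (simp add: obs_spec_def vec_eq_iff coords_add algebra_simps sum.distrib)

lemma obs_spec_scaleR: "obs_spec f (c *\<^sub>R v) = c *\<^sub>R obs_spec f v"
  by (simp add: obs_spec_def vec_eq_iff coords_scaleR scaleR_sum_right)

lemma obs_spec_diff: "obs_spec f (v - w) = obs_spec f v - obs_spec f w"
  using obs_spec_add[of f v "-w"] obs_spec_scaleR[of f "-1" w] by simp

lemma obs_spec_sum: "obs_spec f (\<Sum>k\<in>I. v k) = (\<Sum>k\<in>I. obs_spec f (v k))"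
proof -
  have "linear (obs_spec f)" by (intro linearI obs_spec_add obs_spec_scaleR)
  then show ?thesis by (rule linear_sum)
qed

lemma obs_spec_combination:
  "obs_spec (\<lambda>x. (\<Sum>j\<in>I. c j * f j x)) v = (\<Sum>j\<in>I. c j *s obs_spec (f j) v)"
  by (simp add: obs_spec_def vec_eq_iff sum_distrib_left sum_distrib_right mult.assoc)
    (subst sum.swap, simp)

lemma obs_spec_plus: "obs_spec (\<lambda>x. f x + g x) v = obs_spec f v + obs_spec g v"
  by (simp add: obs_spec_def vec_eq_iff sum.distrib distrib_right)

lemma continuous_on_coords [continuous_intros]:
  "continuous_on S w \<Longrightarrow> continuous_on S (\<lambda>p. coords (w p))"
  unfolding coords_def by (rule continuous_on_compose2[OF matrix_vector_mult_linear_continuous_on]) auto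

lemma continuous_on_from_coords [continuous_intros]:
  "continuous_on S w \<Longrightarrow> continuous_on S (\<lambda>p. from_coords (w p))"
  unfolding from_coords_def by (rule continuous_on_compose2[OF matrix_vector_mult_linear_continuous_on]) auto

lemma continuous_on_obs_spec:
  assumes "\<And>x. continuous_on S (\<lambda>p. f p x)" "continuous_on S w"
  shows "continuous_on S (\<lambda>p. obs_spec (f p) (w p))"
  unfolding obs_spec_def by (intro continuous_intros assms)

text \<open>For the scalar exponentials, of modulus one because the eigenvalues are real, this bounds
  \<open>e\<^bsup>i\<sigma>A\<^sup>T\<^esup>\<close> uniformly in \<open>\<sigma>\<close>.\<close>
lemma spec_bound: "\<exists>C>0. \<forall>f v. (\<forall>l. norm (f (eigval l)) \<le> 1) \<longrightarrow> norm (spec f v) \<le> C * norm v"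
proof -
  obtain a where a: "a > 0" "\<And>u. norm (from_coords u) \<le> norm u * a"
    unfolding from_coords_def using bounded_linear.pos_bounded[OF matrix_vector_mul_bounded_linear] by metis
  obtain b where b: "b > 0" "\<And>u. norm (coords u) \<le> norm u * b"
    unfolding coords_def using bounded_linear.pos_bounded[OF matrix_vector_mul_bounded_linear] by metis
  have "norm (spec f v) \<le> (b * a) * norm v" if "\<And>l. norm (f (eigval l)) \<le> 1" for f v
  proof -
    have "norm (spec f v) \<le> norm (\<chi> l. f (eigval l) * coords v $ l) * a" unfolding spec_def by (rule a)
    also have "\<dots> \<le> (norm v * b) * a"
      using a(1) by (intro mult_right_mono order.trans[OF norm_vec_mult_le[OF that] b(2)]) auto
    finally show ?thesis by (simp add: mult_ac)
  qed
  then show ?thesis using a b by (intro exI[of _ "b * a"]) auto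
qed

definition evol :: "real \<Rightarrow> complex^'n \<Rightarrow> complex^'n" where
  "evol \<sigma> v = spec (\<lambda>x. iexp (\<sigma> * x)) v"

definition obs_evol :: "real \<Rightarrow> complex^'n \<Rightarrow> complex^'m" where
  "obs_evol \<sigma> v = obs_spec (\<lambda>x. iexp (\<sigma> * x)) v"

lemma obs_evol_evol: "obs_evol \<sigma> (evol \<tau> v) = obs_evol (\<sigma> + \<tau>) v"
  by (simp add: obs_evol_def evol_def obs_spec_spec distrib_right distrib_left flip: exp_add)

lemma evol_evol: "evol \<sigma> (evol \<tau> v) = evol (\<sigma> + \<tau>) v"
  by (simp add: evol_def spec_def distrib_right distrib_left exp_add mult.assoc)

lemma evol_0 [simp]: "evol 0 v = v"
  by (simp add: evol_def spec_one)

lemma evol_bounds: "\<exists>C>0. \<forall>\<sigma> v. norm (evol \<sigma> v) \<le> C * norm v \<and> norm v \<le> C * norm (evol \<sigma> v)"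
proof -
  obtain C where C: "C > 0" "\<And>f v. (\<forall>l. norm (f (eigval l)) \<le> 1) \<Longrightarrow> norm (spec f v) \<le> C * norm v"
    using spec_bound by metis
  have *: "norm (evol \<sigma> v) \<le> C * norm v" for \<sigma> v
    unfolding evol_def by (intro C(2)) (simp add: norm_exp_eq_Re)
  have "norm v \<le> C * norm (evol \<sigma> v)" for \<sigma> v
    using *[of "-\<sigma>" "evol \<sigma> v"] by (simp add: evol_evol)
  then show ?thesis using C(1) * by blast
qed

lemma continuous_on_obs_evol [continuous_intros]:
  "continuous_on S s \<Longrightarrow> continuous_on S w \<Longrightarrow> continuous_on S (\<lambda>p. obs_evol (s p) (w p))"
  unfolding obs_evol_def by (intro continuous_on_obs_spec continuous_intros)

lemma obs_evol_bound: "\<exists>C>0. \<forall>\<sigma> v. norm (obs_evol \<sigma> v) \<le> C * norm v"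
proof -
  obtain C where C: "C > 0" "\<And>\<sigma> v. norm (evol \<sigma> v) \<le> C * norm v" using evol_bounds by metis
  obtain a where a: "a > 0" "\<And>u. norm (complex_matrix (transpose B) *v u) \<le> norm u * a"
    using bounded_linear.pos_bounded[OF matrix_vector_mul_bounded_linear] by metis
  have "norm (obs_evol \<sigma> v) \<le> (C * a) * norm v" for \<sigma> v
  proof -
    have "norm (obs_evol \<sigma> v) \<le> norm (evol \<sigma> v) * a"
      unfolding obs_evol_def obs_spec_eq evol_def[symmetric] by (rule a)
    also have "\<dots> \<le> (C * norm v) * a" using a(1) by (intro mult_right_mono C) auto
    finally show ?thesis by (simp add: mult_ac)
  qed
  then show ?thesis using a C by (intro exI[of _ "C * a"]) auto
qed

text \<open>On the \<open>k\<close>-th layer the first \<open>k\<close> terms of the exponential series are not observed; this is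
  the remaining series divided by \<open>\<sigma>\<^sup>k\<close>, which is continuous also at \<open>\<sigma> = 0\<close>.\<close>
definition obs_tail :: "nat \<Rightarrow> real \<Rightarrow> complex^'n \<Rightarrow> complex^'m" where
  "obs_tail k \<sigma> v = obs_spec (\<lambda>x. (\<i> * of_real x) ^ k * exp_tail k (\<i> * of_real (\<sigma> * x))) v"

lemma obs_evol_kalman_proj:
  "obs_evol \<sigma> (kalman_proj A B k v) = \<sigma> ^ k *\<^sub>R obs_tail k \<sigma> (kalman_proj A B k v)"
proof -
  let ?w = "kalman_proj A B k v"
  have "iexp (\<sigma> * x) = (\<Sum>j<k. ((\<i> * of_real \<sigma>) ^ j / fact j) * of_real x ^ j)
      + (\<Sum>j\<in>{()}. of_real \<sigma> ^ k * ((\<i> * of_real x) ^ k * exp_tail k (\<i> * of_real (\<sigma> * x))))" for x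
    by (subst exp_eq_exp_tail[of _ k]) (simp add: power_mult_distrib mult_ac)
  then have "obs_evol \<sigma> ?w = (\<Sum>j<k. ((\<i> * of_real \<sigma>) ^ j / fact j) *s obs_spec (\<lambda>x. of_real x ^ j) ?w)
       + (\<Sum>j\<in>{()}. of_real \<sigma> ^ k *s obs_tail k \<sigma> ?w)"
    unfolding obs_evol_def obs_tail_def obs_spec_combination[symmetric] obs_spec_plus[symmetric] by simp
  also have "(\<Sum>j<k. ((\<i> * of_real \<sigma>) ^ j / fact j) *s obs_spec (\<lambda>x. of_real x ^ j) ?w) = 0"
    unfolding obs_block_eq[symmetric] by (intro sum.neutral) (simp add: obs_block_kalman_proj)
  finally show ?thesis by (simp add: vec_eq_iff scaleR_conv_of_real[where 'a = complex])
qed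

lemma obs_tail_0: "obs_tail k 0 v = (\<i> ^ k / fact k) *s obs_block A B k v"
  unfolding obs_tail_def obs_block_eq
  by (simp add: exp_tail_0 obs_spec_def vec_eq_iff sum_distrib_left power_mult_distrib mult_ac)

end

section \<open>Two-sided estimate of the Gramian\<close>

locale kalman_pair = diagonalized_pair A B P eigval
  for A :: "real^'n^'n" and B :: "real^'m^'n" and P :: "real^'n^'n" and eigval :: "'n \<Rightarrow> real" +
  fixes K :: nat
  assumes index: "kalman_index A B K"
begin

text \<open>The observation at time \<open>r\<close> and frequency \<open>\<theta>\<close> of the vector \<open>v\<close> with
  \<open>\<Pi>\<^sub>k w = \<theta>\<^sup>k \<Pi>\<^sub>k v\<close> (\<open>rescaled_obs_eq\<close>), written so that it makes sense at \<open>\<theta> = 0\<close> too.\<close>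
definition rescaled_obs :: "real \<Rightarrow> real \<Rightarrow> complex^'n \<Rightarrow> complex^'m" where
  "rescaled_obs \<theta> r w = (\<Sum>k\<le>K. r ^ k *\<^sub>R obs_tail k (\<theta> * r) (kalman_proj A B k w))"

lemma rescaled_obs_eq:
  assumes "\<And>k. k \<le> K \<Longrightarrow> kalman_proj A B k w = \<theta> ^ k *\<^sub>R kalman_proj A B k v"
  shows "rescaled_obs \<theta> r w = obs_evol (\<theta> * r) v"
proof -
  have "obs_evol (\<theta> * r) v = (\<Sum>k\<le>K. obs_evol (\<theta> * r) (kalman_proj A B k v))"
    unfolding obs_evol_def obs_spec_sum[symmetric] by (simp add: sum_kalman_proj[OF index])
  also have "\<dots> = (\<Sum>k\<le>K. r ^ k *\<^sub>R obs_tail k (\<theta> * r) (kalman_proj A B k w))"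
    using assms by (intro sum.cong refl)
      (simp add: obs_evol_kalman_proj obs_tail_def obs_spec_scaleR power_mult_distrib mult.commute)
  finally show ?thesis by (simp add: rescaled_obs_def)
qed

lemma continuous_on_kalman_proj [continuous_intros]:
  "continuous_on S w \<Longrightarrow> continuous_on S (\<lambda>p. kalman_proj A B k (w p))"
  by (rule continuous_on_compose2[OF linear_continuous_on]) (auto simp: linear_conv_bounded_linear[symmetric] linear_kalman_proj)

lemma continuous_on_rescaled_obs [continuous_intros]:
  assumes "continuous_on S t" "continuous_on S r" "continuous_on S w"
  shows "continuous_on S (\<lambda>p. rescaled_obs (t p) (r p) (w p))"
  unfolding rescaled_obs_def obs_tail_def
  by (intro continuous_intros continuous_on_obs_spec assms)

lemma rescaled_obs_scaleR: "rescaled_obs \<theta> r (c *\<^sub>R w) = c *\<^sub>R rescaled_obs \<theta> r w"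
  by (simp add: rescaled_obs_def obs_tail_def linear_scale[OF linear_kalman_proj] obs_spec_scaleR scaleR_sum_right mult.commute)

text \<open>Differentiating the vanishing observation repeatedly produces all observations
  \<open>B\<^sup>T (A\<^sup>T)\<^sup>j e\<^bsup>i\<theta>rA\<^sup>T\<^esup> v\<close>, so that the Kalman condition applies to the evolved vector.\<close>
lemma obs_evol_unique:
  assumes \<theta>: "\<theta> \<noteq> 0" and 0: "\<And>r. r \<in> {0<..<1} \<Longrightarrow> obs_evol (\<theta> * r) v = 0"
  shows "v = 0"
proof -
  have z: "obs_spec (\<lambda>x. of_real x ^ j * iexp ((\<theta> * r) * x)) v = 0" if "r \<in> {0<..<1}" for j r
    using that
  proof (induction j arbitrary: r)
    case 0
    then show ?case using assms(2) by (simp add: obs_evol_def)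
  next
    case (Suc j)
    show ?case
    proof (simp only: vec_eq_iff zero_index, intro allI)
      fix i
      let ?F = "\<lambda>r. obs_spec (\<lambda>x. of_real x ^ j * iexp ((\<theta> * r) * x)) v $ i"
      let ?D = "\<i> * of_real \<theta> * obs_spec (\<lambda>x. of_real x ^ Suc j * iexp ((\<theta> * r) * x)) v $ i"
      have iexp': "((\<lambda>r. iexp ((\<theta> * r) * x)) has_vector_derivative \<i> * of_real (\<theta> * x) * iexp ((\<theta> * r) * x)) (at r)" for x
        by (auto intro!: derivative_eq_intros has_vector_derivative_real_field simp: algebra_simps)
      have "(?F has_vector_derivative ?D) (at r)"
        unfolding obs_spec_def vec_lambda_beta sum_distrib_left
        by (intro has_vector_derivative_sum)
          (rule has_vector_derivative_eq_rhs[OF has_vector_derivative_mult_left[OF has_vector_derivative_mult_right[OF iexp']]],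
           simp add: algebra_simps)
      moreover have "(?F has_vector_derivative 0) (at r)"
      proof (rule has_vector_derivative_transform_within_open)
        show "((\<lambda>r. 0) has_vector_derivative 0) (at r)" by simp
        show "open {0<..<1::real}" by simp
        show "r \<in> {0<..<1}" by fact
        show "0 = ?F s" if "s \<in> {0<..<1}" for s using Suc.IH[OF that] by simp
      qed
      ultimately have "?D = 0" by (rule vector_derivative_unique_at)
      then show "obs_spec (\<lambda>x. of_real x ^ Suc j * iexp ((\<theta> * r) * x)) v $ i = 0" using \<theta> by simp
    qed
  qed
  \<comment> \<open>The derivatives vanish at the interior time \<open>r = 1/2\<close>; evolving back afterwards recovers \<open>v\<close>.\<close>
  have "obs_block A B j (evol (\<theta> * (1/2)) v) = 0" for j
    using z[of "1/2" j] by (simp add: obs_block_eq evol_def obs_spec_spec)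
  then have "evol (\<theta> * (1/2)) v = 0" by (rule obs_block_inj[OF index])
  then have "evol (- (\<theta> * (1/2))) (evol (\<theta> * (1/2)) v) = evol (- (\<theta> * (1/2))) 0" by simp
  moreover have "evol \<sigma> 0 = 0" for \<sigma> using evol_bounds by (metis mult_zero_right norm_le_zero_iff norm_zero)
  ultimately show ?thesis by (simp add: evol_evol)
qed

text \<open>For \<open>\<theta> \<noteq> 0\<close> the scaling can be undone. For \<open>\<theta> = 0\<close> the observation is a polynomial in \<open>r\<close>
  whose \<open>k\<close>-th coefficient determines the \<open>k\<close>-th layer.\<close>
lemma rescaled_obs_unique:
  assumes 0: "\<And>r. r \<in> {0..1} \<Longrightarrow> rescaled_obs \<theta> r w = 0"
  shows "w = 0"
proof -
  have "kalman_proj A B k w = 0" if "k \<le> K" for k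
  proof (cases "\<theta> = 0")
    case False
    \<comment> \<open>The vector whose rescaling is \<open>w\<close>.\<close>
    define v where "v = (\<Sum>j\<le>K. (1 / \<theta> ^ j) *\<^sub>R kalman_proj A B j w)"
    have pv: "kalman_proj A B k v = (1 / \<theta> ^ k) *\<^sub>R kalman_proj A B k w" if "k \<le> K" for k
      unfolding v_def by (rule kalman_proj_combination[OF that])
    have "rescaled_obs \<theta> r w = obs_evol (\<theta> * r) v" for r
      by (rule rescaled_obs_eq) (simp add: pv False)
    then have "v = 0" using 0 by (intro obs_evol_unique[OF False]) auto
    then have "(1 / \<theta> ^ k) *\<^sub>R kalman_proj A B k w = 0"
      using pv[OF that] linear_0[OF linear_kalman_proj, of A B k] by simp
    then show ?thesis using False by simp
  next
    case True
    have "obs_block A B k (kalman_proj A B k w) $ i = 0" for i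
    proof -
      define c where "c k = \<i> ^ k / fact k * obs_block A B k (kalman_proj A B k w) $ i" for k
      have "(\<Sum>k\<le>K. c k * of_real r ^ k) = 0" if "r \<in> {0..1}" for r
      proof -
        have "rescaled_obs \<theta> r w $ i = (\<Sum>k\<le>K. c k * of_real r ^ k)"
          by (simp add: rescaled_obs_def True obs_tail_0 c_def scaleR_conv_of_real[where 'a = complex] mult_ac)
        then show ?thesis using 0[OF that] by simp
      qed
      then have "of_real ` {0..1::real} \<subseteq> {x. (\<Sum>k\<le>K. c k * x ^ k) = 0}" by auto
      moreover have "infinite (complex_of_real ` {0..1})"
        by (subst finite_image_iff) (auto simp: inj_on_def infinite_Icc)
      ultimately have "infinite {x. (\<Sum>k\<le>K. c k * x ^ k) = 0}" using finite_subset by blast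
      then have "c k = 0" using that unfolding polyfun_finite_roots by blast
      then show ?thesis by (simp add: c_def)
    qed
    then have "obs_block A B k (kalman_proj A B k w) = 0" by (simp add: vec_eq_iff)
    then show ?thesis by (rule obs_block_inj_layer)
  qed
  then have "(\<Sum>k\<le>K. kalman_proj A B k w) = 0" by simp
  then show ?thesis by (simp add: sum_kalman_proj[OF index])
qed

definition rescaled_energy :: "real \<Rightarrow> complex^'n \<Rightarrow> real" where
  "rescaled_energy \<theta> w = integral {0..1} (\<lambda>r. (norm (rescaled_obs \<theta> r w))\<^sup>2)"

lemma rescaled_energy_scaleR: "rescaled_energy \<theta> (c *\<^sub>R w) = c\<^sup>2 * rescaled_energy \<theta> w"
  by (simp add: rescaled_energy_def rescaled_obs_scaleR power_mult_distrib)

text \<open>A continuous function that is positive on the product of \<open>[-1, 1]\<close> and the unit sphere is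
  bounded above and away from zero there; homogeneity does the rest.\<close>
lemma rescaled_energy_bounds:
  "\<exists>c>0. \<exists>C>0. \<forall>\<theta>\<in>{-1..1}. \<forall>w. c * (norm w)\<^sup>2 \<le> rescaled_energy \<theta> w \<and> rescaled_energy \<theta> w \<le> C * (norm w)\<^sup>2"
proof -
  let ?X = "{-1..1::real} \<times> sphere (0::complex^'n) 1"
  have comp: "compact ?X" by (intro compact_Times compact_Icc compact_sphere)
  have ne: "?X \<noteq> {}"
    by simp
  have cont: "continuous_on ?X (\<lambda>p. rescaled_energy (fst p) (snd p))"
  proof -
    have "continuous_on ?X (\<lambda>p. integral (cbox 0 1) (\<lambda>r. (norm (rescaled_obs (fst p) r (snd p)))\<^sup>2))"
      by (rule integral_continuous_on_param) (auto intro!: continuous_intros simp: case_prod_unfold)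
    then show ?thesis by (simp add: rescaled_energy_def)
  qed
  have pos: "rescaled_energy \<theta> w > 0" if "w \<noteq> 0" for \<theta> w
  proof -
    let ?f = "\<lambda>r. (norm (rescaled_obs \<theta> r w))\<^sup>2"
    have cf: "continuous_on {0..1} ?f" by (intro continuous_intros)
    have "rescaled_energy \<theta> w \<noteq> 0"
    proof
      assume "rescaled_energy \<theta> w = 0"
      then have "\<forall>r\<in>{0..1}. ?f r = 0"
        using integral_eq_0_iff[OF cf] by (simp add: rescaled_energy_def)
      then have "w = 0" by (intro rescaled_obs_unique) auto
      with that show False by simp
    qed
    moreover have "rescaled_energy \<theta> w \<ge> 0"
      unfolding rescaled_energy_def by (intro Henstock_Kurzweil_Integration.integral_nonneg integrable_continuous_interval cf) auto
    ultimately show ?thesis by simp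
  qed
  obtain p0 where p0: "p0 \<in> ?X" "\<And>p. p \<in> ?X \<Longrightarrow> rescaled_energy (fst p0) (snd p0) \<le> rescaled_energy (fst p) (snd p)"
    using continuous_attains_inf[OF comp ne cont] by blast
  obtain p1 where p1: "p1 \<in> ?X" "\<And>p. p \<in> ?X \<Longrightarrow> rescaled_energy (fst p) (snd p) \<le> rescaled_energy (fst p1) (snd p1)"
    using continuous_attains_sup[OF comp ne cont] by blast
  define c where "c = rescaled_energy (fst p0) (snd p0)"
  define C where "C = rescaled_energy (fst p1) (snd p1)"
  have "c > 0" "C > 0" unfolding c_def C_def using p0(1) p1(1) by (auto intro!: pos)
  moreover have "c * (norm w)\<^sup>2 \<le> rescaled_energy \<theta> w \<and> rescaled_energy \<theta> w \<le> C * (norm w)\<^sup>2" if "\<theta> \<in> {-1..1}" for \<theta> w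
  proof (cases "w = 0")
    case True
    then show ?thesis using rescaled_energy_scaleR[of \<theta> 0 w] by simp
  next
    case False
    let ?u = "(1 / norm w) *\<^sub>R w"
    have u: "(\<theta>, ?u) \<in> ?X" using that False by simp
    have "rescaled_energy \<theta> w = rescaled_energy \<theta> (norm w *\<^sub>R ?u)" using False by simp
    also have "\<dots> = (norm w)\<^sup>2 * rescaled_energy \<theta> ?u" by (rule rescaled_energy_scaleR)
    finally have e: "rescaled_energy \<theta> w = (norm w)\<^sup>2 * rescaled_energy \<theta> ?u" .
    have "c \<le> rescaled_energy \<theta> ?u" "rescaled_energy \<theta> ?u \<le> C"
      using p0(2)[OF u] p1(2)[OF u] by (simp_all add: c_def C_def)
    then show ?thesis unfolding e mult.commute[of _ "(norm w)\<^sup>2"] by (intro conjI mult_left_mono) auto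
  qed
  ultimately show ?thesis by blast
qed

text \<open>The quadratic form \<open>G(\<theta>, v)\<close> of the Gramian on the unit time interval.\<close>
definition energy_density :: "real \<Rightarrow> complex^'n \<Rightarrow> real" where
  "energy_density \<theta> v = integral {0..1} (\<lambda>r. (norm (obs_evol (\<theta> * r) v))\<^sup>2)"

definition layer_norm :: "real \<Rightarrow> complex^'n \<Rightarrow> real" where
  "layer_norm \<theta> v = (\<Sum>k\<le>K. kalman_weight k \<theta> * (norm (kalman_proj A B k v))\<^sup>2)"

lemma layer_norm_large: "\<bar>\<theta>\<bar> \<ge> 1 \<Longrightarrow> layer_norm \<theta> v = (norm v)\<^sup>2"
  unfolding layer_norm_def norm_sum_kalman_proj[OF index, of v, symmetric]
  by (intro sum.cong refl) (simp add: kalman_weight_def min_def one_le_power antisym)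

lemma kalman_weight_small: "\<bar>\<theta>\<bar> \<le> 1 \<Longrightarrow> kalman_weight k \<theta> = (\<theta> ^ k)\<^sup>2"
  using power_le_one[of "\<bar>\<theta>\<bar>" "2 * k"]
  by (simp add: kalman_weight_def min_def power_even_eq flip: power_abs)

lemma layer_norm_small:
  assumes "\<bar>\<theta>\<bar> \<le> 1"
  shows "layer_norm \<theta> v = (norm (\<Sum>k\<le>K. \<theta> ^ k *\<^sub>R kalman_proj A B k v))\<^sup>2" (is "_ = (norm ?w)\<^sup>2")
    and "energy_density \<theta> v = rescaled_energy \<theta> (\<Sum>k\<le>K. \<theta> ^ k *\<^sub>R kalman_proj A B k v)"
proof -
  have p: "kalman_proj A B k ?w = \<theta> ^ k *\<^sub>R kalman_proj A B k v" if "k \<le> K" for k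
    by (rule kalman_proj_combination[OF that])
  show "layer_norm \<theta> v = (norm ?w)\<^sup>2"
    unfolding layer_norm_def norm_sum_kalman_proj[OF index, of ?w, symmetric]
    using assms by (intro sum.cong refl) (simp add: p kalman_weight_small power_mult_distrib power2_eq_square)
  show "energy_density \<theta> v = rescaled_energy \<theta> ?w"
    unfolding energy_density_def rescaled_energy_def using rescaled_obs_eq[OF p] by simp
qed

lemma layer_norm_nonneg: "layer_norm \<theta> v \<ge> 0"
  unfolding layer_norm_def kalman_weight_def by (intro sum_nonneg mult_nonneg_nonneg) auto

text \<open>Cut the unit interval into \<open>n\<close> equal parts and restart the evolution at the left end of each.\<close>
lemma energy_density_split:
  assumes n: "n > 0"
  shows "energy_density \<theta> v = (\<Sum>k<n. energy_density (\<theta> / real n) (evol (\<theta> / real n * real k) v)) / real n"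
proof -
  let ?f = "\<lambda>r. (norm (obs_evol (\<theta> * r) v))\<^sup>2"
  have int: "?f integrable_on {a..b}" for a b
    by (intro integrable_continuous_interval continuous_intros)
  have split: "integral {0..real j / real n} ?f = (\<Sum>k<j. integral {real k / real n..real (Suc k) / real n} ?f)" for j
  proof (induction j)
    case (Suc j)
    have "integral {0..real (Suc j) / real n} ?f = integral {0..real j / real n} ?f + integral {real j / real n..real (Suc j) / real n} ?f"
      by (rule Henstock_Kurzweil_Integration.integral_combine[symmetric]) (auto simp: divide_right_mono int)
    with Suc show ?case by simp
  qed simp
  have piece: "integral {real k / real n..real (Suc k) / real n} ?f = energy_density (\<theta> / real n) (evol (\<theta> / real n * real k) v) / real n" for k
  proof -
    have "(?f has_integral integral {real k / real n..real (Suc k) / real n} ?f) (cbox (real k / real n) (real (Suc k) / real n))"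
      using int by (simp add: integrable_integral)
    from has_integral_affinity'[OF this, of "1 / real n" "real k / real n"] n
    have "((\<lambda>r. ?f (r / real n + real k / real n)) has_integral (real n * integral {real k / real n..real (Suc k) / real n} ?f)) {0..1}"
      by (simp add: field_simps)
    moreover have "?f (r / real n + real k / real n) = (norm (obs_evol (\<theta> / real n * r) (evol (\<theta> / real n * real k) v)))\<^sup>2" for r
      by (simp add: obs_evol_evol algebra_simps)
    ultimately have "energy_density (\<theta> / real n) (evol (\<theta> / real n * real k) v) = real n * integral {real k / real n..real (Suc k) / real n} ?f"
      unfolding energy_density_def by (simp add: integral_unique)
    then show ?thesis using n by simp
  qed
  show ?thesis
    using split[of n] n unfolding piece by (simp add: energy_density_def sum_divide_distrib)
qed

text \<open>For \<open>|\<theta>| > 1\<close> the \<open>n = \<lceil>|\<theta>|\<rceil>\<close> pieces have frequency \<open>\<theta>/n\<close> of modulus between \<open>1/2\<close> and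
  \<open>1\<close>, where all weights are at least \<open>4\<^bsup>-K\<^esup>\<close>; averaging over the pieces keeps a bound
  independent of \<open>n\<close>.\<close>
theorem energy_density_bounds:
  "\<exists>c>0. \<exists>C>0. \<forall>\<theta> v. c * layer_norm \<theta> v \<le> energy_density \<theta> v \<and> energy_density \<theta> v \<le> C * layer_norm \<theta> v"
proof -
  obtain c1 C1 where c1: "c1 > 0" "C1 > 0" and
    b1: "\<And>\<theta> w. \<bar>\<theta>\<bar> \<le> 1 \<Longrightarrow> c1 * (norm w)\<^sup>2 \<le> rescaled_energy \<theta> w \<and> rescaled_energy \<theta> w \<le> C1 * (norm w)\<^sup>2"
    using rescaled_energy_bounds by (auto simp: abs_le_iff)
  obtain C2 where C2: "C2 > 0" "\<And>\<sigma> v. norm (obs_evol \<sigma> v) \<le> C2 * norm v" using obs_evol_bound by metis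
  obtain C3 where C3: "C3 > 0" "\<And>\<sigma> v. norm v \<le> C3 * norm (evol \<sigma> v)" using evol_bounds by metis
  \<comment> \<open>The smallest weight at frequencies of modulus between \<open>1/2\<close> and \<open>1\<close>.\<close>
  define q where "q = (1 / 4 :: real) ^ K"
  have q: "q > 0" "q \<le> 1" by (auto simp: q_def power_le_one)
  have small: "c1 * layer_norm \<theta> v \<le> energy_density \<theta> v \<and> energy_density \<theta> v \<le> C1 * layer_norm \<theta> v" if "\<bar>\<theta>\<bar> \<le> 1" for \<theta> v
    using b1[OF that] layer_norm_small[OF that] by simp
  have half: "q * (norm v)\<^sup>2 \<le> layer_norm \<theta> v" if "\<bar>\<theta>\<bar> \<le> 1" "\<bar>\<theta>\<bar> \<ge> 1 / 2" for \<theta> v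
    unfolding layer_norm_def norm_sum_kalman_proj[OF index, of v, symmetric] sum_distrib_left
  proof (intro sum_mono mult_right_mono)
    fix k assume "k \<in> {..K}"
    then have "q \<le> (1 / 4) ^ k" unfolding q_def by (intro power_decreasing) auto
    also have "\<dots> = ((1 / 2) ^ k)\<^sup>2" by (simp add: power2_eq_square flip: power_mult_distrib)
    also have "\<dots> \<le> (\<bar>\<theta>\<bar> ^ k)\<^sup>2" using that by (intro power_mono) auto
    finally show "q \<le> kalman_weight k \<theta>" using that(1) by (simp add: kalman_weight_small flip: power_abs)
  qed auto
  have large_up: "energy_density \<theta> v \<le> C2\<^sup>2 * (norm v)\<^sup>2" for \<theta> v
  proof -
    have "energy_density \<theta> v \<le> integral {0..1} (\<lambda>r::real. (C2 * norm v)\<^sup>2)"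
      unfolding energy_density_def
      by (intro integral_le integrable_continuous_interval continuous_intros power_mono C2) auto
    then show ?thesis by (simp add: power_mult_distrib)
  qed
  have large_low: "c1 * q / C3\<^sup>2 * (norm v)\<^sup>2 \<le> energy_density \<theta> v" if \<theta>: "\<bar>\<theta>\<bar> > 1" for \<theta> v
  proof -
    define n where "n = nat \<lceil>\<bar>\<theta>\<bar>\<rceil>"
    have n: "real n \<ge> \<bar>\<theta>\<bar>" "real n < \<bar>\<theta>\<bar> + 1" "n > 0"
      using \<theta> by (auto simp: n_def) linarith+
    have t: "\<bar>\<theta> / real n\<bar> \<le> 1" "\<bar>\<theta> / real n\<bar> \<ge> 1 / 2"
      using n \<theta> by (auto simp: field_simps)
    have "c1 * q / C3\<^sup>2 * (norm v)\<^sup>2 = (\<Sum>k<n. c1 * q / C3\<^sup>2 * (norm v)\<^sup>2) / real n" using n by simp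
    also have "\<dots> \<le> (\<Sum>k<n. energy_density (\<theta> / real n) (evol (\<theta> / real n * real k) v)) / real n"
    proof (intro divide_right_mono sum_mono)
      fix k
      let ?u = "evol (\<theta> / real n * real k) v"
      have "(norm v)\<^sup>2 \<le> (C3 * norm ?u)\<^sup>2" by (intro power_mono C3) auto
      then have "(norm v)\<^sup>2 / C3\<^sup>2 \<le> (norm ?u)\<^sup>2" using C3(1) by (simp add: power_mult_distrib field_simps)
      then have "c1 * q * ((norm v)\<^sup>2 / C3\<^sup>2) \<le> c1 * q * (norm ?u)\<^sup>2" using c1 q by (intro mult_left_mono) auto
      also have "\<dots> \<le> c1 * layer_norm (\<theta> / real n) ?u" using half[OF t, of ?u] c1 by simp
      also have "\<dots> \<le> energy_density (\<theta> / real n) ?u" using small[OF t(1)] by blast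
      finally show "c1 * q / C3\<^sup>2 * (norm v)\<^sup>2 \<le> energy_density (\<theta> / real n) ?u" by simp
    qed simp
    also have "\<dots> = energy_density \<theta> v" by (rule energy_density_split[OF n(3), symmetric])
    finally show ?thesis .
  qed
  define c where "c = min c1 (c1 * q / C3\<^sup>2)"
  define C where "C = max C1 (C2\<^sup>2)"
  have "c > 0" "C > 0" using c1 q C3 by (auto simp: c_def C_def)
  moreover have "c * layer_norm \<theta> v \<le> energy_density \<theta> v \<and> energy_density \<theta> v \<le> C * layer_norm \<theta> v" for \<theta> v
  proof (cases "\<bar>\<theta>\<bar> \<le> 1")
    case True
    have "c * layer_norm \<theta> v \<le> c1 * layer_norm \<theta> v" "C1 * layer_norm \<theta> v \<le> C * layer_norm \<theta> v"
      by (auto intro!: mult_right_mono layer_norm_nonneg simp: c_def C_def)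
    then show ?thesis using small[OF True, of v] by linarith
  next
    case False
    have "c \<le> c1 * q / C3\<^sup>2" "C2\<^sup>2 \<le> C" by (simp_all add: c_def C_def)
    then have "c * (norm v)\<^sup>2 \<le> c1 * q / C3\<^sup>2 * (norm v)\<^sup>2" "C2\<^sup>2 * (norm v)\<^sup>2 \<le> C * (norm v)\<^sup>2"
      by (intro mult_right_mono; simp)+
    then show ?thesis using large_low[of \<theta> v] large_up[of \<theta> v] False by (simp add: layer_norm_large)
  qed
  ultimately show ?thesis by blast
qed

end

section \<open>Limits in L2 and transforms of linear images\<close>

lemma ennreal_term_le_suminf: "f n \<le> (\<Sum>n. f n :: ennreal)"
  using sum_le_suminf[OF summableI, of "{n}" f] by simp

text \<open>Weighting the squared increments by \<open>2\<^sup>n\<close> still leaves a summable series of integrals, so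
  almost everywhere the increments are bounded by a geometric sequence and the limit exists
  pointwise; Fatou's lemma transfers the estimate to it.\<close>
lemma L2_limit_of_fast_Cauchy:
  fixes W :: "nat \<Rightarrow> 'a \<Rightarrow> 'b::euclidean_space"
  assumes W[measurable]: "\<And>n. W n \<in> borel_measurable M" and C: "C \<ge> 0"
    and cauchy: "\<And>m n. m \<ge> n \<Longrightarrow> L2sq M (\<lambda>x. W m x - W n x) \<le> ennreal (C * (1 / 4) ^ n)"
  shows "\<exists>V\<in>borel_measurable M. \<forall>n. (L2sq M (\<lambda>x. V x - W n x)) \<le> ennreal (C * (1 / 4) ^ n)"
proof -
  define V where "V x = lim (\<lambda>n. W n x)" for x
  have V[measurable]: "V \<in> borel_measurable M" unfolding V_def[abs_def] by measurable
  let ?a = "\<lambda>n x. norm (W (Suc n) x - W n x)"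
  let ?S = "\<lambda>x. \<Sum>n. ennreal (2 ^ n * (?a n x)\<^sup>2)"
  have "(\<integral>\<^sup>+x. ?S x \<partial>M) = (\<Sum>n. \<integral>\<^sup>+x. ennreal (2 ^ n * (?a n x)\<^sup>2) \<partial>M)"
    by (rule nn_integral_suminf) measurable
  also have "\<dots> \<le> (\<Sum>n. ennreal (C * (1 / 2) ^ n))"
  proof (intro suminf_le summableI)
    fix n
    have "(\<integral>\<^sup>+x. ennreal (2 ^ n * (?a n x)\<^sup>2) \<partial>M) = ennreal (2 ^ n) * (\<integral>\<^sup>+x. ennreal ((?a n x)\<^sup>2) \<partial>M)"
      by (subst nn_integral_cmult[symmetric]) (auto simp: ennreal_mult)
    also have "\<dots> \<le> ennreal (2 ^ n) * ennreal (C * (1 / 4) ^ n)"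
      by (intro mult_left_mono cauchy) auto
    also have "\<dots> = ennreal (2 ^ n * (C * (1 / 4) ^ n))"
      using C by (simp add: ennreal_mult)
    also have "2 ^ n * (C * (1 / 4) ^ n) = C * (1 / 2) ^ n"
    proof -
      have "(2::real) ^ n * (1 / 4) ^ n = (1 / 2) ^ n" by (simp flip: power_mult_distrib)
      then show ?thesis by (simp add: mult.left_commute)
    qed
    finally show "(\<integral>\<^sup>+x. ennreal (2 ^ n * (?a n x)\<^sup>2) \<partial>M) \<le> ennreal (C * (1 / 2) ^ n)" .
  qed
  also have "\<dots> = ennreal (\<Sum>n. C * (1 / 2) ^ n)"
  proof (rule suminf_ennreal2)
    show "summable (\<lambda>n. C * (1 / 2) ^ n)" by (rule summable_mult[OF summable_geometric]) simp
  qed (use C in simp)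
  finally have "(\<integral>\<^sup>+x. ?S x \<partial>M) < \<infinity>"
    by (rule order.strict_trans1) simp
  then have "(\<integral>\<^sup>+x. ?S x \<partial>M) \<noteq> \<infinity>" by simp
  from nn_integral_PInf_AE[OF _ this] have "AE x in M. ?S x \<noteq> \<infinity>" by measurable
  then have lim: "AE x in M. (\<lambda>n. W n x) \<longlonglongrightarrow> V x"
  proof eventually_elim
    case (elim x)
    then have "?S x < top" unfolding infinity_ennreal_def by (rule less_top[THEN iffD1])
    then obtain s where s: "?S x = ennreal s" "s \<ge> 0" unfolding less_top_ennreal by (elim exE conjE)
    have a: "?a n x \<le> sqrt s * sqrt (1 / 2) ^ n" for n
    proof -
      have "ennreal (2 ^ n * (?a n x)\<^sup>2) \<le> ?S x"
        by (rule ennreal_term_le_suminf)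
      then have "2 ^ n * (?a n x)\<^sup>2 \<le> s" unfolding s(1) using s(2) by (simp only: ennreal_le_iff)
      then have "(?a n x)\<^sup>2 \<le> s * (1 / 2) ^ n" by (simp add: field_simps)
      then have "sqrt ((?a n x)\<^sup>2) \<le> sqrt (s * (1 / 2) ^ n)" by (rule real_sqrt_le_mono)
      then show ?thesis by (simp add: real_sqrt_mult real_sqrt_power)
    qed
    have "summable (\<lambda>n. W (Suc n) x - W n x)"
    proof (rule summable_comparison_test'[where N = 0])
      show "summable (\<lambda>n. sqrt s * sqrt (1 / 2) ^ n)"
        by (intro summable_mult summable_geometric) simp
    qed (rule a)
    from summable_LIMSEQ[OF this] obtain L where "(\<lambda>n. \<Sum>k<n. W (Suc k) x - W k x) \<longlonglongrightarrow> L" by blast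
    then have "(\<lambda>n. W n x - W 0 x) \<longlonglongrightarrow> L" by (simp only: sum_lessThan_telescope[of "\<lambda>k. W k x"])
    from tendsto_add[OF this tendsto_const[of "W 0 x"]] have "convergent (\<lambda>n. W n x)"
      by (auto simp: convergent_def)
    then show ?case unfolding V_def by (simp add: convergent_LIMSEQ_iff)
  qed
  have "L2sq M (\<lambda>x. V x - W n x) \<le> ennreal (C * (1 / 4) ^ n)" for n
  proof -
    have "L2sq M (\<lambda>x. V x - W n x) \<le> (\<integral>\<^sup>+x. liminf (\<lambda>m. ennreal ((norm (W m x - W n x))\<^sup>2)) \<partial>M)"
    proof (intro nn_integral_mono_AE)
      show "AE x in M. ennreal ((norm (V x - W n x))\<^sup>2) \<le> liminf (\<lambda>m. ennreal ((norm (W m x - W n x))\<^sup>2))"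
        using lim
      proof eventually_elim
        case (elim x)
        have "(\<lambda>m. ennreal ((norm (W m x - W n x))\<^sup>2)) \<longlonglongrightarrow> ennreal ((norm (V x - W n x))\<^sup>2)"
          by (intro tendsto_intros elim tendsto_ennrealI)
        from lim_imp_Liminf[OF sequentially_bot this] show ?case by (rule eq_refl[OF sym])
      qed
    qed
    also have "\<dots> \<le> liminf (\<lambda>m. L2sq M (\<lambda>x. W m x - W n x))"
      by (rule nn_integral_liminf) measurable
    also have "\<dots> \<le> liminf (\<lambda>m. ennreal (C * (1 / 4) ^ n))"
      by (rule Liminf_mono) (auto simp: eventually_sequentially intro!: exI[of _ n] cauchy)
    also have "\<dots> = ennreal (C * (1 / 4) ^ n)" by (simp add: Liminf_const)
    finally show ?thesis .
  qed
  with V show ?thesis by blast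
qed

lemma ennreal_le_multiple_epsilon:
  fixes x y :: ennreal
  assumes "\<And>e. e > 0 \<Longrightarrow> x \<le> y + ennreal (c * e)" "c \<ge> 0"
  shows "x \<le> y"
proof (rule ennreal_le_epsilon)
  fix e :: real assume e: "e > 0"
  have "x \<le> y + ennreal (c * (e / (c + 1)))" by (rule assms(1)) (use assms(2) e in simp)
  also have "\<dots> \<le> y + ennreal e"
    using assms(2) e by (intro add_left_mono ennreal_leI) (simp add: field_simps)
  finally show "x \<le> y + ennreal e" .
qed

lemma fourier_measurable:
  fixes f :: "real \<Rightarrow> complex^'n"
  assumes f: "integrable lborel f"
  shows "fourier f \<in> borel_measurable borel"
proof (rule measurable_vec_componentwise)
  fix i
  have [measurable]: "f \<in> borel_measurable borel" using f by auto
  show "(\<lambda>\<xi>. fourier f \<xi> $ i) \<in> borel_measurable borel"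
    unfolding fourier_component[OF f] by measurable
qed

lemma integrable_vec_componentwise:
  fixes f :: "real \<Rightarrow> complex^'n"
  assumes "\<And>i. integrable lborel (\<lambda>x. f x $ i)"
  shows "integrable lborel f"
proof (rule Bochner_Integration.integrable_bound)
  show "integrable lborel (\<lambda>x. \<Sum>i\<in>UNIV. norm (f x $ i))" using assms by auto
  show "f \<in> borel_measurable lborel" using assms by (intro measurable_vec_componentwise) auto
  show "AE x in lborel. norm (f x) \<le> norm (\<Sum>i\<in>UNIV. norm (f x $ i))"
    by (intro AE_I2) (simp add: norm_vec_def L2_set_le_sum sum_nonneg)
qed

lemma fourier1_shift: "fourier1 (\<lambda>x. f (x + a)) \<xi> = iexp (\<xi> * a) * fourier1 f \<xi>"
proof -
  have "fourier1 f \<xi> = \<bar>1\<bar> *\<^sub>R (LINT x|lborel. exp (- (\<i> * of_real (a + 1 * x) * of_real \<xi>)) * f (a + 1 * x))"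
    unfolding fourier1_def by (rule lborel_integral_real_affine) simp
  also have "\<dots> = (LINT x|lborel. iexp (- (\<xi> * a)) * (exp (- (\<i> * of_real x * of_real \<xi>)) * f (x + a)))"
  proof -
    have "exp (- (\<i> * of_real (a + x) * of_real \<xi>)) = iexp (- (\<xi> * a)) * exp (- (\<i> * of_real x * of_real \<xi>))" for x
      by (simp add: algebra_simps flip: exp_add)
    then show ?thesis by (simp add: add.commute mult.assoc)
  qed
  also have "\<dots> = iexp (- (\<xi> * a)) * fourier1 (\<lambda>x. f (x + a)) \<xi>"
    unfolding fourier1_def by (rule integral_mult_right_zero)
  finally have "iexp (\<xi> * a) * fourier1 f \<xi> = (iexp (\<xi> * a) * iexp (- (\<xi> * a))) * fourier1 (\<lambda>x. f (x + a)) \<xi>"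
    by (simp add: mult.assoc)
  also have "iexp (\<xi> * a) * iexp (- (\<xi> * a)) = 1" by (simp flip: exp_add)
  finally show ?thesis by simp
qed

lemma fourier1_sum:
  assumes "\<And>j. j \<in> J \<Longrightarrow> integrable lborel (f j)"
  shows "fourier1 (\<lambda>x. \<Sum>j\<in>J. c j * f j x) \<xi> = (\<Sum>j\<in>J. c j * fourier1 (f j) \<xi>)"
proof -
  have int: "integrable lborel (\<lambda>x. exp (- (\<i> * of_real x * of_real \<xi>)) * (c j * f j x))" if "j \<in> J" for j
  proof (rule Bochner_Integration.integrable_bound)
    show "integrable lborel (\<lambda>x. c j * f j x)" using assms[OF that] by simp
    have [measurable]: "f j \<in> borel_measurable borel" using assms[OF that] by auto
    show "(\<lambda>x. exp (- (\<i> * of_real x * of_real \<xi>)) * (c j * f j x)) \<in> borel_measurable lborel" by measurable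
  qed (simp add: norm_mult)
  have "fourier1 (\<lambda>x. \<Sum>j\<in>J. c j * f j x) \<xi> = (LINT x|lborel. (\<Sum>j\<in>J. exp (- (\<i> * of_real x * of_real \<xi>)) * (c j * f j x)))"
    unfolding fourier1_def by (simp add: sum_distrib_left)
  also have "\<dots> = (\<Sum>j\<in>J. LINT x|lborel. exp (- (\<i> * of_real x * of_real \<xi>)) * (c j * f j x))"
    by (rule Bochner_Integration.integral_sum[OF int])
  also have "\<dots> = (\<Sum>j\<in>J. c j * fourier1 (f j) \<xi>)"
    unfolding fourier1_def by (intro sum.cong refl) (subst integral_mult_right_zero[symmetric], simp only: mult.left_commute)
  finally show ?thesis .
qed

lemma integrable_matrix_vector_mult:
  fixes f :: "real \<Rightarrow> complex^'n" and M :: "complex^'n^'m"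
  shows "integrable lborel f \<Longrightarrow> integrable lborel (\<lambda>x. M *v f x)"
  by (rule integrable_bounded_linear[OF matrix_vector_mul_bounded_linear])

lemma fourier_matrix_vector_mult:
  fixes f :: "real \<Rightarrow> complex^'n" and M :: "complex^'n^'m"
  assumes f: "integrable lborel f"
  shows "fourier (\<lambda>x. M *v f x) \<xi> = M *v fourier f \<xi>"
proof -
  have fi: "integrable lborel (\<lambda>x. f x $ j)" for j
    by (rule integrable_bounded_linear[OF bounded_linear_vec_nth f])
  have "fourier (\<lambda>x. M *v f x) \<xi> $ i = (M *v fourier f \<xi>) $ i" for i
    unfolding fourier_component[OF integrable_matrix_vector_mult[OF f]]
    by (simp add: matrix_vector_mult_def fourier1_sum[OF fi] fourier_component[OF f])
  then show ?thesis by (simp add: vec_eq_iff)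
qed

lemma fourier_diff:
  fixes f g :: "real \<Rightarrow> complex^'n"
  assumes f: "integrable lborel f" and g: "integrable lborel g"
  shows "fourier (\<lambda>x. f x - g x) \<xi> = fourier f \<xi> - fourier g \<xi>"
proof -
  have fi: "integrable lborel (\<lambda>x. f x $ j)" "integrable lborel (\<lambda>x. g x $ j)" for j
    by (auto intro: integrable_bounded_linear[OF bounded_linear_vec_nth] f g)
  have d: "integrable lborel (\<lambda>x. f x - g x)" using f g by simp
  have "fourier (\<lambda>x. f x - g x) \<xi> $ i = (fourier f \<xi> - fourier g \<xi>) $ i" for i
  proof -
    \<comment> \<open>A difference is a sum over the booleans with signs.\<close>
    have "fourier1 (\<lambda>x. \<Sum>b\<in>UNIV. (if b then 1 else -1) * (if b then f x $ i else g x $ i)) \<xi>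
      = (\<Sum>b\<in>UNIV. (if b then 1 else -1) * fourier1 (\<lambda>x. if b then f x $ i else g x $ i) \<xi>)"
    proof (rule fourier1_sum)
      show "integrable lborel (\<lambda>x. if b then f x $ i else g x $ i)" for b by (cases b) (simp_all add: fi)
    qed
    then show ?thesis unfolding fourier_component[OF d]
      by (simp add: UNIV_bool fourier_component[OF f] fourier_component[OF g])
  qed
  then show ?thesis by (simp add: vec_eq_iff)
qed

text \<open>A density on the whole plane rather than a restricted space, so that measurability is ordinary
  Borel measurability.\<close>
definition strip :: "real \<Rightarrow> (real \<times> real) measure" where
  "strip T = density lborel (indicator ({0<..<T} \<times> UNIV))"

lemma sets_strip [simp, measurable_cong]: "sets (strip T) = sets borel"
  by (simp add: strip_def)

lemma measurable_strip_set [measurable]: "({0<..<T} \<times> UNIV :: (real \<times> real) set) \<in> sets borel"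
  by (intro borel_open open_Times) auto

lemma obs_energy_eq:
  fixes W :: "real \<times> real \<Rightarrow> complex^'m"
  assumes W[measurable]: "W \<in> borel_measurable borel"
  shows "obs_energy T W = L2sq (strip T) (\<lambda>z. W z)"
proof -
  let ?F = "\<lambda>z. indicator ({0<..<T} \<times> UNIV) z * ennreal ((norm (W z))\<^sup>2)"
  have [measurable]: "W \<in> borel_measurable (borel \<Otimes>\<^sub>M borel)" by (simp add: borel_prod)
  have "L2sq (strip T) (\<lambda>z. W z) = (\<integral>\<^sup>+z. ?F z \<partial>lborel)"
    unfolding strip_def by (rule nn_integral_density) (auto intro!: borel_measurable_indicator)
  also have "\<dots> = (\<integral>\<^sup>+z. ?F z \<partial>(lborel \<Otimes>\<^sub>M lborel))" by (simp add: lborel_prod)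
  also have "\<dots> = (\<integral>\<^sup>+t. \<integral>\<^sup>+x. ?F (t, x) \<partial>lborel \<partial>lborel)"
    by (rule lborel.nn_integral_fst[symmetric]) measurable
  also have "\<dots> = (\<integral>\<^sup>+t\<in>{0<..<T}. (L2sq lborel (\<lambda>x. W (t, x))) \<partial>lborel)"
    by (intro nn_integral_cong) (auto simp: indicator_def)
  finally show ?thesis by (simp add: obs_energy_def)
qed

lemma nn_integral_open_interval_eq_integral:
  fixes f :: "real \<Rightarrow> real"
  assumes f: "continuous_on {a..b} f" "\<And>x. 0 \<le> f x" and [measurable]: "f \<in> borel_measurable borel"
  shows "(\<integral>\<^sup>+x. ennreal (f x) * indicator {a<..<b} x \<partial>lborel) = ennreal (integral {a..b} f)"
proof -
  have si: "set_integrable lborel {a..b} f"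
    unfolding set_integrable_def by (rule borel_integrable_compact) (auto intro: f)
  have "(\<integral>\<^sup>+x. ennreal (f x) * indicator {a<..<b} x \<partial>lborel) = (\<integral>\<^sup>+x. ennreal (indicator {a..b} x *\<^sub>R f x) \<partial>lborel)"
  proof (intro nn_integral_cong_AE)
    show "AE x in lborel. ennreal (f x) * indicator {a<..<b} x = ennreal (indicator {a..b} x *\<^sub>R f x)"
      using AE_lborel_singleton[of a] AE_lborel_singleton[of b]
      by eventually_elim (auto simp: indicator_def)
  qed
  also have "\<dots> = ennreal (LINT x|lborel. indicator {a..b} x *\<^sub>R f x)"
    using si by (intro nn_integral_eq_integral) (auto simp: set_integrable_def f)
  also have "(LINT x|lborel. indicator {a..b} x *\<^sub>R f x) = integral {a..b} f"
    using set_borel_integral_eq_integral(2)[OF si] by (simp add: set_lebesgue_integral_def)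
  finally show ?thesis .
qed

section \<open>The explicit solution and its energy\<close>

context diagonalized_pair
begin

text \<open>In eigencoordinates the system decouples into transport equations, and each coordinate of the
  final datum is translated with its own speed.\<close>
definition adjoint_flow :: "real \<Rightarrow> (real \<Rightarrow> complex^'n) \<Rightarrow> real \<times> real \<Rightarrow> complex^'n" where
  "adjoint_flow T qT z = from_coords (\<chi> l. coords (qT (snd z + eigval l * (T - fst z))) $ l)"

definition observed_flow :: "real \<Rightarrow> (real \<Rightarrow> complex^'n) \<Rightarrow> real \<times> real \<Rightarrow> complex^'m" where
  "observed_flow T qT z = complex_matrix (transpose B) *v adjoint_flow T qT z"

lemma adjoint_flow_continuous:
  assumes "continuous_on UNIV qT"
  shows "continuous_on S (adjoint_flow T qT)"
  unfolding adjoint_flow_def[abs_def]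
  by (intro continuous_intros continuous_on_compose2[OF assms]) auto

lemma observed_flow_continuous:
  assumes "continuous_on UNIV qT"
  shows "continuous_on S (observed_flow T qT)"
  unfolding observed_flow_def[abs_def]
  by (rule continuous_on_compose2[OF matrix_vector_mult_linear_continuous_on adjoint_flow_continuous[OF assms]]) auto

lemma observed_flow_measurable [measurable]:
  "schwartz qT \<Longrightarrow> observed_flow T qT \<in> borel_measurable borel"
  by (intro borel_measurable_continuous_onI observed_flow_continuous schwartz_continuous)

lemma bounded_linear_coords: "bounded_linear coords"
  unfolding coords_def[abs_def] by (rule matrix_vector_mul_bounded_linear)

lemma bounded_linear_from_coords: "bounded_linear from_coords"
  unfolding from_coords_def[abs_def] by (rule matrix_vector_mul_bounded_linear)

lemma from_coords_add: "from_coords u + from_coords v = from_coords (u + v)"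
  by (simp add: from_coords_def matrix_vector_right_distrib)

lemma adjoint_flow_solution:
  assumes qT: "schwartz qT"
  shows "adjoint_solution A T qT (adjoint_flow T qT)"
  unfolding adjoint_solution_def
proof (intro conjI ballI allI)
  show "continuous_on ({0..T} \<times> UNIV) (adjoint_flow T qT)"
    by (intro adjoint_flow_continuous schwartz_continuous qT)
  show "adjoint_flow T qT (T, x) = qT x" for x
    by (simp add: adjoint_flow_def)
  fix t x
  obtain f' where f': "\<And>y. (qT has_vector_derivative f' y) (at y)" using schwartz_derivative[OF qT] by blast
  let ?y = "\<lambda>l. x + eigval l * (T - t)"
  let ?u = "\<lambda>h. \<chi> l. (snd h - eigval l * fst h) *\<^sub>R coords (f' (?y l)) $ l"
  let ?q' = "\<lambda>h. from_coords (?u h)"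
  have "(adjoint_flow T qT has_derivative ?q') (at (t, x))"
    unfolding adjoint_flow_def[abs_def]
  proof (intro bounded_linear.has_derivative[OF bounded_linear_from_coords] has_derivative_vec_lambda)
    fix l
    have "((\<lambda>z::real\<times>real. snd z + eigval l * (T - fst z)) has_derivative (\<lambda>h. snd h - eigval l * fst h)) (at (t, x))"
      by (auto intro!: derivative_eq_intros simp: algebra_simps)
    moreover have "(qT has_derivative (\<lambda>h. h *\<^sub>R f' (?y l))) (at (snd (t, x) + eigval l * (T - fst (t, x))))"
      using f'[of "?y l"] by (simp add: has_vector_derivative_def)
    ultimately have "((\<lambda>z. qT (snd z + eigval l * (T - fst z))) has_derivative (\<lambda>h. (snd h - eigval l * fst h) *\<^sub>R f' (?y l))) (at (t, x))"
      by (rule has_derivative_compose)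
    then have "((\<lambda>z. coords (qT (snd z + eigval l * (T - fst z))) $ l) has_derivative (\<lambda>h. coords ((snd h - eigval l * fst h) *\<^sub>R f' (?y l)) $ l)) (at (t, x))"
      by (intro bounded_linear.has_derivative[OF bounded_linear_vec_nth] bounded_linear.has_derivative[OF bounded_linear_coords])
    then show "((\<lambda>z. (\<chi> l. coords (qT (snd z + eigval l * (T - fst z))) $ l) $ l) has_derivative (\<lambda>h. ?u h $ l)) (at (t, x))"
      by (simp add: coords_scaleR)
  qed
  moreover have "?q' (1, 0) + complex_matrix (transpose A) *v ?q' (0, 1) = 0"
  proof -
    have "?q' (1, 0) + complex_matrix (transpose A) *v ?q' (0, 1)
      = from_coords (?u (1, 0) + (\<chi> l. of_real (eigval l) * ?u (0, 1) $ l))"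
      by (simp add: complex_matrix_A spec_def from_coords_add)
    also have "?u (1, 0) + (\<chi> l. of_real (eigval l) * ?u (0, 1) $ l) = 0"
      by (simp add: vec_eq_iff scaleR_conv_of_real)
    finally show ?thesis by (simp add: from_coords_def)
  qed
  ultimately show "\<exists>q'. (adjoint_flow T qT has_derivative q') (at (t, x)) \<and> q' (1, 0) + complex_matrix (transpose A) *v q' (0, 1) = 0"
    by blast
qed

text \<open>Along the characteristic \<open>s \<mapsto> x + \<lambda>\<^sub>l (s - t)\<close> the \<open>l\<close>-th eigencoordinate of a solution has
  derivative zero, so it equals its value at time \<open>T\<close>.\<close>
lemma adjoint_solution_unique:
  assumes q: "adjoint_solution A T qT q" and t: "t \<in> {0<..<T}"
  shows "q (t, x) = adjoint_flow T qT (t, x)"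
proof -
  have qc: "continuous_on ({0..T} \<times> UNIV) q" and qT: "\<And>x. q (T, x) = qT x"
    using q by (auto simp: adjoint_solution_def)
  have "coords (q (t, x)) $ l = coords (qT (x + eigval l * (T - t))) $ l" for l
  proof -
    \<comment> \<open>The \<open>l\<close>-th eigencoordinate along the characteristic through \<open>(t, x)\<close>.\<close>
    let ?w = "\<lambda>s. coords (q (s, x + eigval l * (s - t))) $ l"
    have "?w T = ?w t"
    proof (rule has_derivative_zero_unique_strong_interval[where f = ?w and k = "{t, T}" and a = t and b = T])
      show "continuous_on {t..T} ?w"
        using t by (intro continuous_intros continuous_on_compose2[OF qc]) auto
      fix s assume "s \<in> {t..T} - {t, T}"
      then have s: "s \<in> {0<..<T}" using t by auto
      let ?p = "(s, x + eigval l * (s - t))"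
      obtain q' where q': "(q has_derivative q') (at ?p)" and eq: "q' (1, 0) + complex_matrix (transpose A) *v q' (0, 1) = 0"
        using q s unfolding adjoint_solution_def by blast
      have lin: "linear q'" using q' by (simp add: has_derivative_linear)
      have "((\<lambda>s. (s, x + eigval l * (s - t))) has_derivative (\<lambda>h. (h, eigval l * h))) (at s within {t..T})"
        by (auto intro!: derivative_eq_intros)
      then have "((\<lambda>s. q (s, x + eigval l * (s - t))) has_derivative (\<lambda>h. q' (h, eigval l * h))) (at s within {t..T})"
        by (rule has_derivative_compose[where g = q and f = "\<lambda>s. (s, x + eigval l * (s - t))"]) (rule q')
      then have "(?w has_derivative (\<lambda>h. coords (q' (h, eigval l * h)) $ l)) (at s within {t..T})"
        by (intro bounded_linear.has_derivative[OF bounded_linear_vec_nth] bounded_linear.has_derivative[OF bounded_linear_coords])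
      moreover have "coords (q' (h, eigval l * h)) $ l = 0" for h
      proof -
        have "(h, eigval l * h) = h *\<^sub>R ((1, 0) + eigval l *\<^sub>R (0, 1::real))" by simp
        then have "q' (h, eigval l * h) = h *\<^sub>R (q' (1, 0) + eigval l *\<^sub>R q' (0, 1))"
          by (simp only: linear_scale[OF lin] linear_add[OF lin])
        moreover have "coords (q' (1, 0)) $ l + coords (spec of_real (q' (0, 1))) $ l = 0"
          using arg_cong[OF eq, of "\<lambda>v. coords v $ l"] by (simp add: coords_add complex_matrix_A) (simp add: coords_def)
        ultimately show ?thesis
          by (simp add: coords_scaleR coords_add coords_spec scaleR_conv_of_real[where 'a = complex])
      qed
      ultimately show "(?w has_derivative (\<lambda>h. 0)) (at s within {t..T})" by simp
    qed (use t in auto)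
    then show ?thesis by (simp add: qT)
  qed
  then have "coords (q (t, x)) = (\<chi> l. coords (qT (x + eigval l * (T - t))) $ l)" by (simp add: vec_eq_iff)
  then show ?thesis unfolding adjoint_flow_def by (metis fst_conv snd_conv from_coords_coords)
qed

lemma observed_flow_diff:
  "observed_flow T (\<lambda>x. p x - q x) z = observed_flow T p z - observed_flow T q z"
  unfolding observed_flow_def adjoint_flow_def obs_eq
  by (simp add: matrix_vector_mult_def vec_eq_iff coords_diff right_diff_distrib sum_subtractf)

text \<open>A translation by \<open>\<lambda>\<^sub>l (T - t)\<close> becomes multiplication by \<open>e\<^bsup>i\<xi>\<lambda>\<^sub>l(T-t)\<^esup>\<close>.\<close>
lemma fourier_observed_flow:
  assumes qT: "schwartz qT"
  shows "fourier (\<lambda>x. observed_flow T qT (t, x)) \<xi> = obs_evol (\<xi> * (T - t)) (fourier qT \<xi>)"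
    and "integrable lborel (\<lambda>x. observed_flow T qT (t, x))"
    and "bounded (range (\<lambda>x. observed_flow T qT (t, x)))"
proof -
  note int = schwartz_integrable[OF qT]
  define h where "h x = (\<chi> l. coords (qT (x + eigval l * (T - t))) $ l)" for x
  have intc: "integrable lborel (\<lambda>x. coords (qT x))"
    by (rule integrable_bounded_linear[OF bounded_linear_coords int])
  have intcl: "integrable lborel (\<lambda>x. coords (qT x) $ l)" for l
    by (rule integrable_bounded_linear[OF bounded_linear_vec_nth intc])
  have inth: "integrable lborel h"
  proof (rule integrable_vec_componentwise)
    fix l
    have "integrable lborel (\<lambda>x. coords (qT (eigval l * (T - t) + 1 * x)) $ l)"
      by (subst lborel_integrable_real_affine_iff[where f = "\<lambda>x. coords (qT x) $ l"]) (auto simp: intcl)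
    then show "integrable lborel (\<lambda>x. h x $ l)" by (simp add: h_def add.commute)
  qed
  have of: "observed_flow T qT (t, x) = obs_coeff *v h x" for x
    by (simp add: observed_flow_def adjoint_flow_def obs_eq h_def)
  show "integrable lborel (\<lambda>x. observed_flow T qT (t, x))"
    unfolding of by (rule integrable_matrix_vector_mult[OF inth])
  have fh: "fourier h \<xi> $ l = iexp (\<xi> * (eigval l * (T - t))) * coords (fourier qT \<xi>) $ l" for l
  proof -
    have "fourier h \<xi> $ l = fourier1 (\<lambda>x. coords (qT (x + eigval l * (T - t))) $ l) \<xi>"
      unfolding fourier_component[OF inth] by (simp add: h_def)
    also have "\<dots> = iexp (\<xi> * (eigval l * (T - t))) * fourier1 (\<lambda>x. coords (qT x) $ l) \<xi>"
      by (rule fourier1_shift)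
    also have "fourier1 (\<lambda>x. coords (qT x) $ l) \<xi> = fourier (\<lambda>x. coords (qT x)) \<xi> $ l"
      by (rule fourier_component[OF intc, symmetric])
    also have "fourier (\<lambda>x. coords (qT x)) \<xi> = coords (fourier qT \<xi>)"
      unfolding coords_def by (rule fourier_matrix_vector_mult[OF int])
    finally show ?thesis .
  qed
  show "fourier (\<lambda>x. observed_flow T qT (t, x)) \<xi> = obs_evol (\<xi> * (T - t)) (fourier qT \<xi>)"
  proof -
    have eq: "\<xi> * (eigval l * (T - t)) = (\<xi> * (T - t)) * eigval l" for l by simp
    have "fourier (\<lambda>x. observed_flow T qT (t, x)) \<xi> = obs_coeff *v fourier h \<xi>"
      unfolding of by (rule fourier_matrix_vector_mult[OF inth])
    also have "\<dots> = obs_evol (\<xi> * (T - t)) (fourier qT \<xi>)"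
      unfolding obs_evol_def obs_spec_def matrix_vector_mult_def fh eq by (simp only: mult.left_commute)
    finally show ?thesis .
  qed
  obtain b where b: "\<And>x. norm (coords (qT x)) \<le> b"
    using bounded_linear_image[OF schwartz_bounded[OF qT] bounded_linear_coords] by (auto simp: bounded_iff)
  have "norm (h x) \<le> (\<Sum>l\<in>(UNIV::'n set). b)" for x
  proof -
    have "norm (h x) \<le> (\<Sum>l\<in>UNIV. norm (h x $ l))" by (simp add: norm_vec_def L2_set_le_sum)
    also have "\<dots> \<le> (\<Sum>l\<in>(UNIV::'n set). b)"
      unfolding h_def by (intro sum_mono) (auto intro: order.trans[OF Finite_Cartesian_Product.norm_nth_le b])
    finally show ?thesis .
  qed
  then have "bounded (range h)" by (auto simp: bounded_iff)
  then have "bounded ((*v) obs_coeff ` range h)"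
    by (rule bounded_linear_image) (rule matrix_vector_mul_bounded_linear)
  then show "bounded (range (\<lambda>x. observed_flow T qT (t, x)))"
    unfolding of by (simp add: image_image)
qed

end

context kalman_pair
begin

definition freq_energy :: "real \<Rightarrow> (real \<Rightarrow> complex^'n) \<Rightarrow> ennreal" where
  "freq_energy T g = (\<integral>\<^sup>+\<xi>. ennreal (T * energy_density (T * \<xi>) (g \<xi>)) \<partial>lborel)"

lemma energy_density_nonneg: "energy_density \<theta> v \<ge> 0"
  unfolding energy_density_def
  by (intro Henstock_Kurzweil_Integration.integral_nonneg integrable_continuous_interval continuous_intros) auto

lemma energy_density_measurable [measurable]:
  assumes [measurable]: "f \<in> borel_measurable M" "g \<in> borel_measurable M"
  shows "(\<lambda>x. energy_density (f x) (g x)) \<in> borel_measurable M"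
proof -
  have "continuous_on UNIV (\<lambda>p::real \<times> (complex^'n). integral (cbox 0 1) (\<lambda>r. (norm (obs_evol (fst p * r) (snd p)))\<^sup>2))"
    by (rule integral_continuous_on_param) (auto intro!: continuous_intros simp: case_prod_unfold)
  then have "continuous_on UNIV (\<lambda>p. energy_density (fst p) (snd p))"
    by (simp add: energy_density_def)
  from borel_measurable_continuous_Pair[OF assms this] show ?thesis by simp
qed

lemma time_integral_obs_evol:
  assumes T: "T > 0"
  shows "(\<integral>\<^sup>+t. ennreal ((norm (obs_evol (\<xi> * (T - t)) v))\<^sup>2) * indicator {0<..<T} t \<partial>lborel)
    = ennreal (T * energy_density (T * \<xi>) v)"
proof -
  have cont: "continuous_on S (\<lambda>t. (norm (obs_evol (a * t) v))\<^sup>2)" for a S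
    by (intro continuous_intros)
  have m: "(\<lambda>t. (norm (obs_evol (a * t) v))\<^sup>2) \<in> borel_measurable borel" for a
    by (rule borel_measurable_continuous_onI[OF cont])
  have [measurable]: "(\<lambda>t. (norm (obs_evol (\<xi> * (T - t)) v))\<^sup>2) \<in> borel_measurable borel"
    by (intro borel_measurable_continuous_onI continuous_intros)
  have "(\<integral>\<^sup>+t. ennreal ((norm (obs_evol (\<xi> * (T - t)) v))\<^sup>2) * indicator {0<..<T} t \<partial>lborel)
    = ennreal \<bar>-T\<bar> * (\<integral>\<^sup>+r. ennreal ((norm (obs_evol (\<xi> * (T - (T + (-T) * r))) v))\<^sup>2) * indicator {0<..<T} (T + (-T) * r) \<partial>lborel)"
    using T by (intro nn_integral_real_affine) auto
  also have "(\<integral>\<^sup>+r. ennreal ((norm (obs_evol (\<xi> * (T - (T + (-T) * r))) v))\<^sup>2) * indicator {0<..<T} (T + (-T) * r) \<partial>lborel)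
    = (\<integral>\<^sup>+r. ennreal ((norm (obs_evol ((T * \<xi>) * r) v))\<^sup>2) * indicator {0<..<1} r \<partial>lborel)"
  proof (intro nn_integral_cong)
    fix r
    have "T + (-T) * r \<in> {0<..<T} \<longleftrightarrow> r \<in> {0<..<1}" using T by (auto simp: zero_less_mult_iff)
    then show "ennreal ((norm (obs_evol (\<xi> * (T - (T + (-T) * r))) v))\<^sup>2) * indicator {0<..<T} (T + (-T) * r)
      = ennreal ((norm (obs_evol ((T * \<xi>) * r) v))\<^sup>2) * indicator {0<..<1} r"
      by (simp add: indicator_def mult_ac)
  qed
  also have "\<dots> = ennreal (energy_density (T * \<xi>) v)"
    unfolding energy_density_def by (rule nn_integral_open_interval_eq_integral[OF cont _ m]) simp
  finally show ?thesis using T by (simp add: ennreal_mult energy_density_nonneg)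
qed

text \<open>Plancherel at each time, Tonelli, and the substitution \<open>t = T - T r\<close>.\<close>
lemma obs_energy_observed_flow:
  assumes qT: "schwartz qT" and T: "T > 0"
  shows "ennreal (2 * pi) * obs_energy T (observed_flow T qT) = freq_energy T (fourier qT)"
proof -
  have fm[measurable]: "fourier qT \<in> borel_measurable borel"
    by (rule fourier_measurable[OF schwartz_integrable[OF qT]])
  have om: "(\<lambda>z. (norm (obs_evol (snd z * (T - fst z)) (fourier qT (snd z))))\<^sup>2) \<in> borel_measurable (borel \<Otimes>\<^sub>M borel)"
  proof -
    have c: "continuous_on UNIV (\<lambda>p::real \<times> (complex^'n). (norm (obs_evol (fst p) (snd p)))\<^sup>2)"
      by (intro continuous_intros)
    have 1: "(\<lambda>z::real\<times>real. snd z * (T - fst z)) \<in> borel_measurable (borel \<Otimes>\<^sub>M borel)" by measurable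
    have 2: "(\<lambda>z::real\<times>real. fourier qT (snd z)) \<in> borel_measurable (borel \<Otimes>\<^sub>M borel)" by measurable
    from borel_measurable_continuous_Pair[OF 1 2 c] show ?thesis by simp
  qed
  have [measurable]: "(\<lambda>(t, \<xi>). ennreal ((norm (obs_evol (\<xi> * (T - t)) (fourier qT \<xi>)))\<^sup>2)) \<in> borel_measurable (borel \<Otimes>\<^sub>M borel)"
    using om by (simp add: case_prod_unfold)
  have pl: "ennreal (2 * pi) * L2sq lborel (\<lambda>x. observed_flow T qT (t, x))
     = L2sq lborel (\<lambda>\<xi>. obs_evol (\<xi> * (T - t)) (fourier qT \<xi>))" for t
  proof -
    have c: "continuous_on UNIV (\<lambda>x. observed_flow T qT (t, x))"
      by (rule continuous_on_compose2[OF observed_flow_continuous[OF schwartz_continuous[OF qT], of UNIV]]) (auto intro: continuous_intros)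
    show ?thesis
      using plancherel[OF fourier_observed_flow(2)[OF qT] c fourier_observed_flow(3)[OF qT]]
      by (simp add: fourier_observed_flow(1)[OF qT])
  qed
  define F where "F t = L2sq lborel (\<lambda>x. observed_flow T qT (t, x))" for t
  have [measurable]: "F \<in> borel_measurable borel"
  proof -
    have [measurable]: "observed_flow T qT \<in> borel_measurable (borel \<Otimes>\<^sub>M borel)"
      using observed_flow_measurable[OF qT] by (simp add: borel_prod)
    have "(\<lambda>(t, x). ennreal ((norm (observed_flow T qT (t, x)))\<^sup>2)) \<in> borel_measurable (borel \<Otimes>\<^sub>M lborel)"
      by simp
    then show ?thesis unfolding F_def[abs_def] by (rule lborel.borel_measurable_nn_integral)
  qed
  have "ennreal (2 * pi) * obs_energy T (observed_flow T qT)
     = (\<integral>\<^sup>+t. (ennreal (2 * pi) * F t) * indicator {0<..<T} t \<partial>lborel)"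
    unfolding obs_energy_def F_def[symmetric] mult.assoc by (intro nn_integral_cmult[symmetric]) measurable
  also have "\<dots> = (\<integral>\<^sup>+t. \<integral>\<^sup>+\<xi>. ennreal ((norm (obs_evol (\<xi> * (T - t)) (fourier qT \<xi>)))\<^sup>2) * indicator {0<..<T} t \<partial>lborel \<partial>lborel)"
    unfolding F_def pl by (intro nn_integral_cong nn_integral_multc[symmetric]) measurable
  also have "\<dots> = (\<integral>\<^sup>+\<xi>. \<integral>\<^sup>+t. ennreal ((norm (obs_evol (\<xi> * (T - t)) (fourier qT \<xi>)))\<^sup>2) * indicator {0<..<T} t \<partial>lborel \<partial>lborel)"
    by (rule lborel_pair.Fubini') measurable
  also have "\<dots> = freq_energy T (fourier qT)"
    unfolding freq_energy_def time_integral_obs_evol[OF T] ..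
  finally show ?thesis .
qed

end

section \<open>Comparison of the observed energy with the weighted norm\<close>

abbreviation obs_dist ::
  "real \<Rightarrow> (real \<times> real \<Rightarrow> complex^'m) \<Rightarrow> (real \<times> real \<Rightarrow> complex^'m) \<Rightarrow> ennreal" where
  "obs_dist T V W \<equiv> obs_energy T (\<lambda>z. V z - W z)"

lemma obs_energy_triangle:
  fixes U V W :: "real \<times> real \<Rightarrow> complex^'m"
  assumes [measurable]: "U \<in> borel_measurable borel" "V \<in> borel_measurable borel" "W \<in> borel_measurable borel"
  shows "obs_dist T W U \<le> 2 * obs_dist T W V + 2 * obs_dist T V U"
proof -
  have "W \<in> borel_measurable (strip T)" "V \<in> borel_measurable (strip T)" "U \<in> borel_measurable (strip T)"
    by measurable
  from nn_integral_norm_diff_square_le[OF this] show ?thesis by (subst (1 2 3) obs_energy_eq) simp_all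
qed

lemma obs_energy_triangle0:
  fixes V W :: "real \<times> real \<Rightarrow> complex^'m"
  assumes [measurable]: "V \<in> borel_measurable borel" "W \<in> borel_measurable borel"
  shows "obs_energy T W \<le> 2 * obs_dist T W V + 2 * obs_energy T V"
  using obs_energy_triangle[of "\<lambda>_. 0" V W T] by simp

lemma obs_energy_commute:
  "obs_dist T W V = obs_dist T V W"
  by (simp add: obs_energy_def norm_minus_commute)

lemma obs_energy_0_AE:
  fixes W V :: "real \<times> real \<Rightarrow> complex^'m"
  assumes [measurable]: "W \<in> borel_measurable borel" "V \<in> borel_measurable borel"
    and 0: "obs_dist T W V = 0"
  shows "AE z in lborel. z \<in> {0<..<T} \<times> UNIV \<longrightarrow> W z = V z"
proof -
  have "L2sq (strip T) (\<lambda>z. W z - V z) = 0"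
    using 0 by (subst (asm) obs_energy_eq) auto
  then have "AE z in strip T. ennreal ((norm (W z - V z))\<^sup>2) = 0"
    by (subst (asm) nn_integral_0_iff_AE) auto
  then have "AE z in strip T. W z = V z" by (simp add: ennreal_eq_0_iff)
  then show ?thesis
    unfolding strip_def by (subst (asm) AE_density) (auto simp: indicator_def split: if_splits elim!: eventually_mono)
qed

lemma AE_strip_obs_energy_cong:
  fixes W V U :: "real \<times> real \<Rightarrow> complex^'m"
  assumes [measurable]: "W \<in> borel_measurable borel" "V \<in> borel_measurable borel" "U \<in> borel_measurable borel"
    and ae: "AE z in lborel. z \<in> {0<..<T} \<times> UNIV \<longrightarrow> W z = V z"
  shows "obs_dist T W U = obs_dist T V U"
proof -
  have "AE z in strip T. W z = V z"
    unfolding strip_def using ae by (subst AE_density) (auto simp: indicator_def split: if_splits elim!: eventually_mono)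
  then have "L2sq (strip T) (\<lambda>z. W z - U z) = L2sq (strip T) (\<lambda>z. V z - U z)"
    by (intro nn_integral_cong_AE) (auto elim!: eventually_mono)
  then show ?thesis by (subst (1 2) obs_energy_eq) auto
qed

lemma ennreal_numeral_mult: "0 \<le> x \<Longrightarrow> numeral n * ennreal x = ennreal (numeral n * x)"
  by (simp add: ennreal_mult)

lemma schwartz_L2:
  fixes f :: "real \<Rightarrow> complex^'n"
  assumes f: "schwartz f"
  shows "L2sq lborel f < \<infinity>"
proof -
  have int: "integrable lborel f" by (rule schwartz_integrable[OF f])
  obtain b where b: "\<And>x. norm (f x) \<le> b" using schwartz_bounded[OF f] by (auto simp: bounded_iff)
  have "integrable lborel (\<lambda>x. (norm (f x))\<^sup>2)"
  proof (rule Bochner_Integration.integrable_bound)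
    show "integrable lborel (\<lambda>x. b * norm (f x))" using int by simp
    have [measurable]: "f \<in> borel_measurable borel" using int by auto
    show "(\<lambda>x. (norm (f x))\<^sup>2) \<in> borel_measurable lborel" by measurable
    show "AE x in lborel. norm ((norm (f x))\<^sup>2) \<le> norm (b * norm (f x))"
      using b order.trans[OF norm_ge_zero b] by (intro AE_I2) (auto simp: power2_eq_square abs_mult intro!: mult_right_mono)
  qed
  then show ?thesis by (subst nn_integral_eq_integral) auto
qed

lemma kalman_weight_bounds: "0 \<le> kalman_weight k \<xi>" "kalman_weight k \<xi> \<le> 1"
  by (auto simp: kalman_weight_def)

lemma kalman_weight_scale:
  assumes T: "T > 0" and k: "k \<le> K"
  shows "min 1 (T ^ (2 * K)) * kalman_weight k \<xi> \<le> kalman_weight k (T * \<xi>)"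
    and "kalman_weight k (T * \<xi>) \<le> max 1 (T ^ (2 * K)) * kalman_weight k \<xi>"
    and "kalman_weight k (T * \<xi>) \<le> \<bar>\<xi>\<bar> ^ (2 * k) * T ^ (2 * k)"
proof -
  let ?a = "T ^ (2 * k)" and ?b = "\<bar>\<xi>\<bar> ^ (2 * k)"
  have w: "kalman_weight k (T * \<xi>) = min (?a * ?b) 1" "kalman_weight k \<xi> = min ?b 1"
    using T by (simp_all add: kalman_weight_def abs_mult power_mult_distrib)
  have a: "min 1 (T ^ (2 * K)) \<le> ?a" "?a \<le> max 1 (T ^ (2 * K))"
  proof -
    show "min 1 (T ^ (2 * K)) \<le> ?a"
      using T k power_decreasing[of "2 * k" "2 * K" T] one_le_power[of T "2 * k"] by (cases "T \<le> 1") auto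
    show "?a \<le> max 1 (T ^ (2 * K))"
      using T k power_increasing[of "2 * k" "2 * K" T] power_le_one[of T "2 * k"] by (cases "T \<le> 1") auto
  qed
  have b: "?b \<ge> 0" by simp
  have mb: "0 \<le> min ?b 1" "min ?b 1 \<le> ?b" "min ?b 1 \<le> 1" by auto
  have mT: "0 \<le> min 1 (T ^ (2 * K))" "min 1 (T ^ (2 * K)) \<le> 1" using T by auto
  show "min 1 (T ^ (2 * K)) * kalman_weight k \<xi> \<le> kalman_weight k (T * \<xi>)"
    unfolding w using mult_mono[OF a(1) mb(2)] mult_mono[OF mT(2) mb(3)] T mb mT by auto
  have "min (?a * ?b) 1 \<le> max 1 (T ^ (2 * K)) * min ?b 1"
  proof (cases "?b \<le> 1")
    case True
    have "min (?a * ?b) 1 \<le> ?a * ?b" by simp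
    also have "\<dots> \<le> max 1 (T ^ (2 * K)) * ?b" by (rule mult_right_mono[OF a(2) b])
    finally show ?thesis using True by (simp add: min_def)
  qed auto
  then show "kalman_weight k (T * \<xi>) \<le> max 1 (T ^ (2 * K)) * kalman_weight k \<xi>" unfolding w .
  show "kalman_weight k (T * \<xi>) \<le> ?b * ?a" unfolding w by (simp add: mult.commute)
qed

context kalman_pair
begin

abbreviation Y_norm2 :: "(real \<Rightarrow> complex^'n) \<Rightarrow> ennreal" where
  "Y_norm2 \<equiv> Y_sqnorm A B K"

abbreviation Y_dist :: "(real \<Rightarrow> complex^'n) \<Rightarrow> (real \<Rightarrow> complex^'n) \<Rightarrow> ennreal" where
  "Y_dist f g \<equiv> Y_norm2 (\<lambda>\<xi>. f \<xi> - g \<xi>)"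

lemma kalman_proj_diff: "kalman_proj A B k (v - w) = kalman_proj A B k v - kalman_proj A B k w"
  by (rule linear_diff[OF linear_kalman_proj])

lemma kalman_proj_measurable [measurable]:
  "g \<in> borel_measurable M \<Longrightarrow> (\<lambda>x. kalman_proj A B k (g x)) \<in> borel_measurable M"
  by (rule borel_measurable_continuous_on[where f = "kalman_proj A B k"]) (auto intro: continuous_intros)

lemma layer_norm_measurable [measurable]:
  assumes [measurable]: "f \<in> borel_measurable M" "g \<in> borel_measurable M"
  shows "(\<lambda>x. layer_norm (f x) (g x)) \<in> borel_measurable M"
  unfolding layer_norm_def kalman_weight_def by measurable

lemma Y_norm2_eq:
  assumes [measurable]: "g \<in> borel_measurable borel"
  shows "Y_norm2 g = (\<integral>\<^sup>+\<xi>. ennreal (layer_norm \<xi> (g \<xi>)) \<partial>lborel)"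
proof -
  have m: "(\<lambda>\<xi>. ennreal (kalman_weight k \<xi> * (norm (kalman_proj A B k (g \<xi>)))\<^sup>2)) \<in> borel_measurable lborel" for k
    unfolding kalman_weight_def by measurable
  show ?thesis
    unfolding Y_sqnorm_def layer_norm_def
    by (subst nn_integral_sum[symmetric, OF m]) (simp add: sum_ennreal kalman_weight_bounds)
qed

lemma Y_norm2_commute: "Y_dist f g = Y_dist g f"
  unfolding Y_sqnorm_def kalman_proj_diff by (simp add: norm_minus_commute)

lemma layer_norm_le: "layer_norm \<xi> v \<le> (norm v)\<^sup>2"
  unfolding layer_norm_def norm_sum_kalman_proj[OF index, of v, symmetric]
  by (intro sum_mono mult_left_le_one_le kalman_weight_bounds) auto

lemma layer_norm_0: "layer_norm \<xi> 0 = 0"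
  using layer_norm_le[of \<xi> 0] layer_norm_nonneg[of \<xi> 0] by simp

lemma layer_norm_triangle: "layer_norm \<xi> (u - w) \<le> 2 * layer_norm \<xi> (u - v) + 2 * layer_norm \<xi> (v - w)"
  unfolding layer_norm_def sum_distrib_left sum.distrib[symmetric]
proof (intro sum_mono)
  fix k
  have "(norm (kalman_proj A B k (u - w)))\<^sup>2
     \<le> 2 * (norm (kalman_proj A B k (u - v)))\<^sup>2 + 2 * (norm (kalman_proj A B k (v - w)))\<^sup>2"
    using norm_diff_square_le[of "kalman_proj A B k (u - v)" "kalman_proj A B k (w - v)"]
    by (simp add: kalman_proj_diff norm_minus_commute)
  from mult_left_mono[OF this kalman_weight_bounds(1)[of k \<xi>]]
  show "kalman_weight k \<xi> * (norm (kalman_proj A B k (u - w)))\<^sup>2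
     \<le> 2 * (kalman_weight k \<xi> * (norm (kalman_proj A B k (u - v)))\<^sup>2) + 2 * (kalman_weight k \<xi> * (norm (kalman_proj A B k (v - w)))\<^sup>2)"
    by (simp add: algebra_simps)
qed

lemma Y_norm2_triangle:
  assumes [measurable]: "f \<in> borel_measurable borel" "g \<in> borel_measurable borel" "h \<in> borel_measurable borel"
  shows "Y_dist f h \<le> 2 * Y_dist f g + 2 * Y_dist g h"
  by (subst (1 2 3) Y_norm2_eq, measurable)
    (rule nn_integral_triangle, auto intro: layer_norm_triangle layer_norm_nonneg)

lemma energy_density_triangle:
  "energy_density \<theta> v \<le> 2 * energy_density \<theta> w + 2 * energy_density \<theta> (v - w)"
proof -
  have i: "(\<lambda>r. (norm (obs_evol (\<theta> * r) v))\<^sup>2) integrable_on {0..1}" for v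
    by (intro integrable_continuous_interval continuous_intros)
  have "energy_density \<theta> v \<le> integral {0..1} (\<lambda>r. 2 * (norm (obs_evol (\<theta> * r) w))\<^sup>2 + 2 * (norm (obs_evol (\<theta> * r) (v - w)))\<^sup>2)"
    unfolding energy_density_def
  proof (intro integral_le i integrable_add integrable_on_mult_right)
    fix r
    show "(norm (obs_evol (\<theta> * r) v))\<^sup>2 \<le> 2 * (norm (obs_evol (\<theta> * r) w))\<^sup>2 + 2 * (norm (obs_evol (\<theta> * r) (v - w)))\<^sup>2"
      using norm_diff_square_le[of "obs_evol (\<theta> * r) w" "obs_evol (\<theta> * r) (w - v)"]
      by (simp add: obs_evol_def obs_spec_diff norm_minus_commute)
  qed
  also have "\<dots> = 2 * energy_density \<theta> w + 2 * energy_density \<theta> (v - w)"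
    unfolding energy_density_def
    by (subst Henstock_Kurzweil_Integration.integral_add) (auto intro!: integrable_on_mult_right i)
  finally show ?thesis .
qed

lemma freq_energy_triangle:
  assumes [measurable]: "f \<in> borel_measurable borel" "g \<in> borel_measurable borel" and T: "T > 0"
  shows "freq_energy T f \<le> 2 * freq_energy T g + 2 * freq_energy T (\<lambda>\<xi>. f \<xi> - g \<xi>)"
  unfolding freq_energy_def
proof (rule nn_integral_triangle)
  show "T * energy_density (T * \<xi>) (f \<xi>) \<le> 2 * (T * energy_density (T * \<xi>) (g \<xi>)) + 2 * (T * energy_density (T * \<xi>) (f \<xi> - g \<xi>))" for \<xi>
    using mult_left_mono[OF energy_density_triangle[of "T * \<xi>" "f \<xi>" "g \<xi>"], of T] T by (simp add: algebra_simps)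
qed (use T energy_density_nonneg in \<open>auto intro!: mult_nonneg_nonneg\<close>)

lemma layer_norm_scale:
  assumes T: "T > 0"
  shows "min 1 (T ^ (2 * K)) * layer_norm \<xi> v \<le> layer_norm (T * \<xi>) v"
    and "layer_norm (T * \<xi>) v \<le> max 1 (T ^ (2 * K)) * layer_norm \<xi> v"
  unfolding layer_norm_def sum_distrib_left mult.assoc[symmetric]
  by (intro sum_mono mult_right_mono kalman_weight_scale T; simp)+

text \<open>The Gramian estimate at frequency \<open>T\<xi>\<close>, integrated over \<open>\<xi>\<close>. The pointwise upper bound keeps
  the weights at \<open>T\<xi>\<close>, which is sharper and is what optimality needs.\<close>
lemma freq_energy_bounds:
  "\<exists>c>0. \<exists>C>0. \<forall>T>0. (\<forall>v \<xi>. T * energy_density (T * \<xi>) v \<le> C * T * layer_norm (T * \<xi>) v) \<and>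
    (\<forall>g\<in>borel_measurable borel. ennreal (c * (T * min 1 (T ^ (2 * K)))) * Y_norm2 g \<le> freq_energy T g \<and>
      freq_energy T g \<le> ennreal (C * (T * max 1 (T ^ (2 * K)))) * Y_norm2 g)"
proof -
  obtain c C where cC: "c > 0" "C > 0" and
    b: "\<And>\<theta> v. c * layer_norm \<theta> v \<le> energy_density \<theta> v" "\<And>\<theta> v. energy_density \<theta> v \<le> C * layer_norm \<theta> v"
    using energy_density_bounds by metis
  have "T * energy_density (T * \<xi>) v \<le> C * T * layer_norm (T * \<xi>) v" if T: "T > 0" for T v \<xi>
    using mult_left_mono[OF b(2)[of "T * \<xi>" v], of T] T by (simp add: mult_ac)
  moreover have "ennreal (c * (T * min 1 (T ^ (2 * K)))) * Y_norm2 g \<le> freq_energy T g \<and>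
      freq_energy T g \<le> ennreal (C * (T * max 1 (T ^ (2 * K)))) * Y_norm2 g"
    if T: "T > 0" and [measurable]: "g \<in> borel_measurable borel" for T g
  proof
    let ?m = "min 1 (T ^ (2 * K))" and ?M = "max 1 (T ^ (2 * K))"
    have m0: "0 \<le> ?m" "0 \<le> ?M" using T by auto
    have "ennreal (c * (T * ?m)) * Y_norm2 g = (\<integral>\<^sup>+\<xi>. ennreal (c * (T * ?m)) * ennreal (layer_norm \<xi> (g \<xi>)) \<partial>lborel)"
      unfolding Y_norm2_eq[OF that(2)] by (rule nn_integral_cmult[symmetric]) measurable
    also have "\<dots> \<le> freq_energy T g"
      unfolding freq_energy_def
    proof (intro nn_integral_mono)
      fix \<xi>
      have "c * (T * ?m) * layer_norm \<xi> (g \<xi>) = T * (c * (?m * layer_norm \<xi> (g \<xi>)))" by (simp only: mult_ac)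
      also have "\<dots> \<le> T * (c * layer_norm (T * \<xi>) (g \<xi>))"
        using T cC layer_norm_scale(1)[OF T] by (intro mult_left_mono) auto
      also have "\<dots> \<le> T * energy_density (T * \<xi>) (g \<xi>)" using T b(1) by (intro mult_left_mono) auto
      finally show "ennreal (c * (T * ?m)) * ennreal (layer_norm \<xi> (g \<xi>)) \<le> ennreal (T * energy_density (T * \<xi>) (g \<xi>))"
        using cC T m0 layer_norm_nonneg[of \<xi> "g \<xi>"] by (subst ennreal_mult[symmetric]) (auto intro!: ennreal_leI mult_nonneg_nonneg)
    qed
    finally show "ennreal (c * (T * ?m)) * Y_norm2 g \<le> freq_energy T g" .
    have "freq_energy T g \<le> (\<integral>\<^sup>+\<xi>. ennreal (C * (T * ?M)) * ennreal (layer_norm \<xi> (g \<xi>)) \<partial>lborel)"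
      unfolding freq_energy_def
    proof (intro nn_integral_mono)
      fix \<xi>
      have "T * energy_density (T * \<xi>) (g \<xi>) \<le> T * (C * layer_norm (T * \<xi>) (g \<xi>))" using T b(2) by (intro mult_left_mono) auto
      also have "\<dots> \<le> T * (C * (?M * layer_norm \<xi> (g \<xi>)))"
        using T cC layer_norm_scale(2)[OF T] by (intro mult_left_mono) auto
      also have "\<dots> = C * (T * ?M) * layer_norm \<xi> (g \<xi>)" by (simp only: mult_ac)
      finally show "ennreal (T * energy_density (T * \<xi>) (g \<xi>)) \<le> ennreal (C * (T * ?M)) * ennreal (layer_norm \<xi> (g \<xi>))"
        using cC T m0 layer_norm_nonneg[of \<xi> "g \<xi>"] by (subst ennreal_mult[symmetric]) (auto intro!: ennreal_leI mult_nonneg_nonneg)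
    qed
    also have "\<dots> = ennreal (C * (T * ?M)) * Y_norm2 g"
      unfolding Y_norm2_eq[OF that(2)] by (rule nn_integral_cmult) measurable
    finally show "freq_energy T g \<le> ennreal (C * (T * ?M)) * Y_norm2 g" .
  qed
  ultimately show ?thesis using cC by blast
qed

lemma Y_space_measurable: "g \<in> Y_space A B K \<Longrightarrow> g \<in> borel_measurable borel"
  by (simp add: Y_space_def)

lemma fourier_schwartz_measurable:
  fixes q :: "real \<Rightarrow> complex^'n"
  shows "schwartz q \<Longrightarrow> fourier q \<in> borel_measurable borel"
  by (intro fourier_measurable schwartz_integrable)

lemma Y_norm2_le_L2:
  assumes [measurable]: "g \<in> borel_measurable borel"
  shows "Y_norm2 g \<le> L2sq lborel g"
  unfolding Y_norm2_eq[OF assms] by (intro nn_integral_mono ennreal_leI layer_norm_le)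

lemma fourier_schwartz_in_Y_space:
  assumes q: "schwartz q"
  shows "fourier q \<in> Y_space A B K"
proof -
  have "Y_norm2 (fourier q) \<le> L2sq lborel (fourier q)"
    by (rule Y_norm2_le_L2[OF fourier_schwartz_measurable[OF q]])
  also have "\<dots> = ennreal (2 * pi) * L2sq lborel q"
    by (rule plancherel[OF schwartz_integrable[OF q] schwartz_continuous[OF q] schwartz_bounded[OF q]])
  also have "\<dots> < \<infinity>" using schwartz_L2[OF q] by (simp add: ennreal_mult_less_top)
  finally show ?thesis using fourier_schwartz_measurable[OF q] by (simp add: Y_space_def)
qed

text \<open>Truncate \<open>g\<close> in frequency and in size, which changes little by dominated convergence, and
  approximate the truncation in \<open>L\<^sup>2\<close>, whose norm dominates the weighted one. Values of \<open>g\<close> that blow up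
  near frequency zero are removed by the truncation in size.\<close>
lemma schwartz_dense:
  assumes g: "g \<in> Y_space A B K" and e: "e > 0"
  shows "\<exists>q. schwartz q \<and> Y_dist g (fourier q) \<le> ennreal e"
proof -
  have gm[measurable]: "g \<in> borel_measurable borel" by (rule Y_space_measurable[OF g])
  define G where "G n \<xi> = (if \<bar>\<xi>\<bar> \<le> real n \<and> norm (g \<xi>) \<le> real n then g \<xi> else 0)" for n \<xi>
  have Gm[measurable]: "G n \<in> borel_measurable borel" for n
    unfolding G_def[abs_def] by measurable
  have "(\<lambda>n. \<integral>\<^sup>+\<xi>. ennreal (layer_norm \<xi> (g \<xi> - G n \<xi>)) \<partial>lborel) \<longlonglongrightarrow> (\<integral>\<^sup>+\<xi>. 0 \<partial>(lborel::real measure))"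
  proof (rule nn_integral_dominated_convergence[where w = "\<lambda>\<xi>. ennreal (layer_norm \<xi> (g \<xi>))"])
    show "(\<integral>\<^sup>+\<xi>. ennreal (layer_norm \<xi> (g \<xi>)) \<partial>lborel) < \<infinity>"
      using g unfolding Y_space_def by (simp add: Y_norm2_eq)
    show "AE \<xi> in lborel. ennreal (layer_norm \<xi> (g \<xi> - G n \<xi>)) \<le> ennreal (layer_norm \<xi> (g \<xi>))" for n
      by (intro AE_I2 ennreal_leI) (simp add: G_def layer_norm_0 layer_norm_nonneg)
    show "AE \<xi> in lborel. (\<lambda>n. ennreal (layer_norm \<xi> (g \<xi> - G n \<xi>))) \<longlonglongrightarrow> 0"
    proof (rule AE_I2)
      fix \<xi>
      obtain N where N: "real N \<ge> max \<bar>\<xi>\<bar> (norm (g \<xi>))" using real_arch_simple by blast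
      have "layer_norm \<xi> (g \<xi> - G n \<xi>) = 0" if "n \<ge> N" for n
      proof -
        have "real n \<ge> real N" using that by simp
        then show ?thesis using N by (simp add: G_def layer_norm_0)
      qed
      then have "\<forall>\<^sub>F n in sequentially. 0 = ennreal (layer_norm \<xi> (g \<xi> - G n \<xi>))"
        by (auto simp: eventually_sequentially intro!: exI[of _ N])
      then show "(\<lambda>n. ennreal (layer_norm \<xi> (g \<xi> - G n \<xi>))) \<longlonglongrightarrow> 0"
        by (rule Lim_transform_eventually[OF tendsto_const])
    qed
  qed measurable
  then have "(\<lambda>n. \<integral>\<^sup>+\<xi>. ennreal (layer_norm \<xi> (g \<xi> - G n \<xi>)) \<partial>lborel) \<longlonglongrightarrow> 0" by simp
  from order_tendstoD(2)[OF this, of "ennreal (e / 4)"] e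
  obtain n where n: "(\<integral>\<^sup>+\<xi>. ennreal (layer_norm \<xi> (g \<xi> - G n \<xi>)) \<partial>lborel) < ennreal (e / 4)"
    by (auto simp: eventually_sequentially)
  have 1: "Y_dist g (G n) \<le> ennreal (e / 4)"
    using n by (subst Y_norm2_eq) auto
  have "\<exists>q. schwartz q \<and> L2sq lborel (\<lambda>\<xi>. fourier q \<xi> - G n \<xi>) \<le> ennreal (e / 4)"
    by (rule schwartz_approx[where M = "real n" and R = "real n + 1"]) (use e in \<open>auto simp: G_def\<close>)
  then obtain q where q: "schwartz q" "L2sq lborel (\<lambda>\<xi>. fourier q \<xi> - G n \<xi>) \<le> ennreal (e / 4)"
    by blast
  have qm[measurable]: "fourier q \<in> borel_measurable borel" by (rule fourier_schwartz_measurable[OF q(1)])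
  have "Y_dist (fourier q) (G n) \<le> L2sq lborel (\<lambda>\<xi>. fourier q \<xi> - G n \<xi>)"
    by (rule Y_norm2_le_L2) measurable
  then have 2: "Y_dist (G n) (fourier q) \<le> ennreal (e / 4)"
    using q(2) by (subst Y_norm2_commute) (rule order.trans)
  have "Y_dist g (fourier q) \<le> 2 * Y_dist g (G n) + 2 * Y_dist (G n) (fourier q)"
    by (rule Y_norm2_triangle) measurable
  also have "\<dots> \<le> 2 * ennreal (e / 4) + 2 * ennreal (e / 4)"
    by (intro add_mono mult_left_mono 1 2) auto
  also have "\<dots> = ennreal e" using e by (simp add: ennreal_numeral_mult flip: ennreal_plus)
  finally show ?thesis using q(1) by blast
qed

lemma obs_energy_observed_flow_le:
  assumes T: "T > 0" and q: "schwartz q"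
  shows "obs_energy T (observed_flow T q) \<le> freq_energy T (fourier q)"
proof -
  have "ennreal 1 * obs_energy T (observed_flow T q) \<le> ennreal (2 * pi) * obs_energy T (observed_flow T q)"
    using pi_gt3 by (intro mult_right_mono ennreal_leI) auto
  then show ?thesis by (simp add: obs_energy_observed_flow[OF q T])
qed

lemma obs_dist_observed_flow_le:
  assumes T: "T > 0" and p: "schwartz p" and q: "schwartz q"
  shows "obs_dist T (observed_flow T p) (observed_flow T q) \<le> freq_energy T (\<lambda>\<xi>. fourier p \<xi> - fourier q \<xi>)"
  using obs_energy_observed_flow_le[OF T schwartz_diff[OF p q]]
  by (simp add: observed_flow_diff[abs_def] fourier_diff[OF schwartz_integrable[OF p] schwartz_integrable[OF q], abs_def])

section \<open>Existence and energy of the observation map\<close>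

text \<open>The observations of Schwartz approximations of \<open>g\<close> form a fast Cauchy sequence. Characterizing
  the limit \<open>W\<close> by its distance to the observation of every Schwartz datum makes it usable without reference
  to the approximating sequence.\<close>
lemma observation_limit:
  assumes T: "T > 0"
  shows "\<exists>D\<ge>0. \<forall>g\<in>Y_space A B K. \<exists>W\<in>borel_measurable borel. \<forall>q. schwartz q \<longrightarrow>
     obs_dist T W (observed_flow T q) \<le> ennreal D * Y_dist g (fourier q)"
proof -
  obtain C where C: "C > 0" and fC: "\<And>g. g \<in> borel_measurable borel \<Longrightarrow>
      freq_energy T g \<le> ennreal (C * (T * max 1 (T ^ (2 * K)))) * Y_norm2 g"
    using freq_energy_bounds T by metis
  define D where "D = C * (T * max 1 (T ^ (2 * K)))"
  have D: "D \<ge> 0" using C T by (simp add: D_def)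
  have flow: "obs_dist T (observed_flow T p) (observed_flow T q) \<le> ennreal D * Y_dist (fourier p) (fourier q)"
    if p: "schwartz p" and q: "schwartz q" for p q
  proof -
    have "(\<lambda>\<xi>. fourier p \<xi> - fourier q \<xi>) \<in> borel_measurable borel"
      using fourier_schwartz_measurable[OF p] fourier_schwartz_measurable[OF q] by measurable
    from order.trans[OF obs_dist_observed_flow_le[OF T p q] fC[OF this]] show ?thesis by (simp add: D_def)
  qed
  have "\<exists>W\<in>borel_measurable borel. \<forall>q. schwartz q \<longrightarrow>
     obs_dist T W (observed_flow T q) \<le> ennreal (4 * D) * Y_dist g (fourier q)"
    if g: "g \<in> Y_space A B K" for g
  proof -
    have gm[measurable]: "g \<in> borel_measurable borel" by (rule Y_space_measurable[OF g])
    have "\<forall>n. \<exists>q. schwartz q \<and> Y_dist g (fourier q) \<le> ennreal ((1 / 4) ^ n)"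
      by (intro allI schwartz_dense g) simp
    from choice[OF this] obtain Q where Q: "\<And>n. schwartz (Q n)" "\<And>n. Y_dist g (fourier (Q n)) \<le> ennreal ((1 / 4) ^ n)"
      by blast
    have Qm[measurable]: "fourier (Q n) \<in> borel_measurable borel" for n
      by (rule fourier_schwartz_measurable[OF Q(1)])
    let ?W = "\<lambda>n. observed_flow T (Q n)"
    have Wm[measurable]: "?W n \<in> borel_measurable borel" for n by (rule observed_flow_measurable[OF Q(1)])
    have "\<exists>V\<in>borel_measurable (strip T). \<forall>n. (L2sq (strip T) (\<lambda>x. V x - ?W n x)) \<le> ennreal ((4 * D) * (1 / 4) ^ n)"
    proof (rule L2_limit_of_fast_Cauchy)
      show "?W n \<in> borel_measurable (strip T)" for n by measurable
      show "0 \<le> 4 * D" using D by simp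
      fix m n :: nat assume mn: "m \<ge> n"
      have "L2sq (strip T) (\<lambda>x. ?W m x - ?W n x) = obs_dist T (?W m) (?W n)"
        by (rule obs_energy_eq[symmetric]) measurable
      also have "\<dots> \<le> ennreal D * Y_dist (fourier (Q m)) (fourier (Q n))"
        by (rule flow[OF Q(1) Q(1)])
      also have "\<dots> \<le> ennreal D * (2 * Y_dist (fourier (Q m)) g + 2 * Y_dist g (fourier (Q n)))"
        by (intro mult_left_mono Y_norm2_triangle) auto
      also have "\<dots> \<le> ennreal D * (2 * ennreal ((1 / 4) ^ n) + 2 * ennreal ((1 / 4) ^ n))"
      proof (intro mult_left_mono add_mono Q(2))
        have "Y_dist (fourier (Q m)) g \<le> ennreal ((1 / 4) ^ m)"
          using Q(2)[of m] by (subst Y_norm2_commute)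
        also have "\<dots> \<le> ennreal ((1 / 4) ^ n)" using mn by (intro ennreal_leI power_decreasing) auto
        finally show "Y_dist (fourier (Q m)) g \<le> ennreal ((1 / 4) ^ n)" .
      qed auto
      also have "\<dots> = ennreal D * ennreal (4 * (1 / 4) ^ n)"
        by (simp add: ennreal_numeral_mult flip: ennreal_plus)
      also have "\<dots> = ennreal ((4 * D) * (1 / 4) ^ n)"
        using D by (subst ennreal_mult[symmetric]) (auto simp: mult_ac)
      finally show "L2sq (strip T) (\<lambda>x. ?W m x - ?W n x) \<le> ennreal ((4 * D) * (1 / 4) ^ n)" .
    qed
    then obtain V where Vs: "V \<in> borel_measurable (strip T)"
      and V': "\<And>n. (L2sq (strip T) (\<lambda>x. V x - ?W n x)) \<le> ennreal ((4 * D) * (1 / 4) ^ n)" by blast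
    have V[measurable]: "V \<in> borel_measurable borel" using Vs by (simp cong: measurable_cong_sets)
    have VE: "obs_dist T V (?W n) \<le> ennreal ((4 * D) * (1 / 4) ^ n)" for n
      using V'[of n] by (subst obs_energy_eq) auto
    have "obs_dist T V (observed_flow T q) \<le> ennreal (4 * D) * Y_dist g (fourier q)"
      if q: "schwartz q" for q
    proof (rule ennreal_le_multiple_epsilon)
      have qm[measurable]: "fourier q \<in> borel_measurable borel" by (rule fourier_schwartz_measurable[OF q])
      have [measurable]: "observed_flow T q \<in> borel_measurable borel" by (rule observed_flow_measurable[OF q])
      show "12 * D \<ge> 0" using D by simp
      fix e :: real assume "e > 0"
      then obtain n where n: "(1 / 4) ^ n < e" using real_arch_pow_inv[of e "1 / 4"] by auto
      let ?y = "Y_dist g (fourier q)" and ?r = "(1 / 4 :: real) ^ n"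
      have "obs_dist T V (observed_flow T q)
         \<le> 2 * obs_dist T V (?W n) + 2 * obs_dist T (?W n) (observed_flow T q)"
        by (rule obs_energy_triangle) measurable
      also have "\<dots> \<le> 2 * ennreal ((4 * D) * ?r) + 2 * (ennreal D * (2 * ennreal ?r + 2 * ?y))"
      proof (intro add_mono mult_left_mono VE)
        have "obs_dist T (?W n) (observed_flow T q) \<le> ennreal D * Y_dist (fourier (Q n)) (fourier q)"
          by (rule flow[OF Q(1) q])
        also have "\<dots> \<le> ennreal D * (2 * Y_dist (fourier (Q n)) g + 2 * ?y)"
          by (intro mult_left_mono Y_norm2_triangle) auto
        also have "\<dots> \<le> ennreal D * (2 * ennreal ?r + 2 * ?y)"
          using Q(2)[of n] by (subst Y_norm2_commute) (intro mult_left_mono add_mono; simp)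
        finally show "obs_dist T (?W n) (observed_flow T q) \<le> ennreal D * (2 * ennreal ?r + 2 * ?y)" .
      qed auto
      also have "\<dots> = 2 * ennreal ((4 * D) * ?r) + (2 * (ennreal D * (2 * ennreal ?r)) + 2 * (ennreal D * (2 * ?y)))"
        by (simp only: distrib_left)
      also have "2 * (ennreal D * (2 * ?y)) = ennreal (4 * D) * ?y"
        using D by (simp add: ennreal_mult mult_ac)
      also have "2 * (ennreal D * (2 * ennreal ?r)) = ennreal (4 * D * ?r)"
        using D by (simp add: ennreal_mult mult_ac)
      also have "2 * ennreal ((4 * D) * ?r) = ennreal (8 * D * ?r)"
        using D by (subst ennreal_numeral_mult) auto
      also have "ennreal (8 * D * ?r) + (ennreal (4 * D * ?r) + ennreal (4 * D) * ?y) = ennreal (4 * D) * ?y + (ennreal (8 * D * ?r) + ennreal (4 * D * ?r))"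
        by (simp only: ac_simps)
      also have "ennreal (8 * D * ?r) + ennreal (4 * D * ?r) = ennreal (12 * D * ?r)"
        using D by (subst ennreal_plus[symmetric]) (auto simp: algebra_simps)
      also have "ennreal (4 * D) * ?y + ennreal (12 * D * ?r) \<le> ennreal (4 * D) * ?y + ennreal (12 * D * e)"
        using n D by (intro add_left_mono ennreal_leI mult_left_mono) auto
      finally show "obs_dist T V (observed_flow T q) \<le> ennreal (4 * D) * ?y + ennreal (12 * D * e)" .
    qed
    with V show ?thesis by blast
  qed
  with D show ?thesis by (intro exI[of _ "4 * D"]) auto
qed

text \<open>Assign to \<open>g\<close> any limit provided by \<open>observation_limit\<close>. All three requirements follow by
  comparison with the observation of a Schwartz datum whose transform is close to \<open>g\<close>.\<close>
lemma observation_map_exists: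
  assumes T: "T > 0"
  shows "\<exists>Obs. is_observation_map A B K T Obs"
proof -
  obtain D where D: "D \<ge> 0" and "\<forall>g\<in>Y_space A B K. \<exists>W. W \<in> borel_measurable borel \<and> (\<forall>q. schwartz q \<longrightarrow>
     obs_dist T W (observed_flow T q) \<le> ennreal D * Y_dist g (fourier q))"
    using observation_limit[OF T] by (auto simp: Bex_def)
  from bchoice[OF this(2)] obtain Obs where
    Om: "\<And>g. g \<in> Y_space A B K \<Longrightarrow> Obs g \<in> borel_measurable borel" and
    Ob: "\<And>g q. g \<in> Y_space A B K \<Longrightarrow> schwartz q \<Longrightarrow>
       obs_dist T (Obs g) (observed_flow T q) \<le> ennreal D * Y_dist g (fourier q)"
    by blast
  have "is_observation_map A B K T Obs"
    unfolding is_observation_map_def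
  proof (intro conjI ballI allI impI)
    fix g assume g: "g \<in> Y_space A B K"
    show "Obs g \<in> borel_measurable lborel" using Om[OF g] by simp
    obtain q where q: "schwartz q" "Y_dist g (fourier q) \<le> ennreal 1"
      using schwartz_dense[OF g, of 1] by auto
    have fin: "obs_energy T (observed_flow T q) < \<infinity>"
    proof -
      have "freq_energy T (fourier q) < \<infinity>"
      proof -
        obtain C where "freq_energy T (fourier q) \<le> ennreal C * Y_norm2 (fourier q)"
          using freq_energy_bounds T fourier_schwartz_measurable[OF q(1)] by metis
        also have "\<dots> < \<infinity>" using fourier_schwartz_in_Y_space[OF q(1)] by (simp add: Y_space_def ennreal_mult_less_top)
        finally show ?thesis .
      qed
      then have "ennreal (2 * pi) * obs_energy T (observed_flow T q) < \<infinity>"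
        by (simp only: obs_energy_observed_flow[OF q(1) T])
      then show ?thesis by (auto simp: ennreal_mult_less_top)
    qed
    have "obs_energy T (Obs g) \<le> 2 * obs_dist T (Obs g) (observed_flow T q) + 2 * obs_energy T (observed_flow T q)"
      by (rule obs_energy_triangle0[OF observed_flow_measurable[OF q(1)] Om[OF g]])
    also have "\<dots> \<le> 2 * (ennreal D * ennreal 1) + 2 * obs_energy T (observed_flow T q)"
      by (intro add_right_mono mult_left_mono order.trans[OF Ob[OF g q(1)]] q(2)) auto
    also have "\<dots> < \<infinity>" using fin by (simp add: ennreal_mult_less_top)
    finally show "obs_energy T (Obs g) < \<infinity>" .
  next
    fix qT q assume qT: "schwartz qT" and q: "adjoint_solution A T qT q"
    note Y = fourier_schwartz_in_Y_space[OF qT]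
    have "obs_dist T (Obs (fourier qT)) (observed_flow T qT) \<le> ennreal D * Y_dist (fourier qT) (fourier qT)"
      by (rule Ob[OF Y qT])
    also have "\<dots> = 0" by (simp add: Y_sqnorm_def linear_0[OF linear_kalman_proj])
    finally have "obs_dist T (Obs (fourier qT)) (observed_flow T qT) = 0" by simp
    from obs_energy_0_AE[OF Om[OF Y] observed_flow_measurable[OF qT] this]
    show "AE z in lborel. z \<in> {0<..<T} \<times> UNIV \<longrightarrow> Obs (fourier qT) z = complex_matrix (transpose B) *v q z"
    proof eventually_elim
      case (elim z)
      show ?case
      proof
        assume z: "z \<in> {0<..<T} \<times> UNIV"
        then have "q z = adjoint_flow T qT z"
          using adjoint_solution_unique[OF q, of "fst z" "snd z"] by (cases z) auto
        then show "Obs (fourier qT) z = complex_matrix (transpose B) *v q z"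
          using elim z by (simp add: observed_flow_def)
      qed
    qed
  next
    fix g G assume g: "g \<in> Y_space A B K" and G: "\<forall>n. G n \<in> Y_space A B K"
      and lim: "(\<lambda>n. Y_dist (G n) g) \<longlonglongrightarrow> 0"
    note [measurable] = Y_space_measurable[OF g] Y_space_measurable[OF G[rule_format]] Om[OF g] Om[OF G[rule_format]]
    have le: "obs_dist T (Obs (G n)) (Obs g) \<le> ennreal (4 * D) * Y_dist (G n) g" for n
    proof (rule ennreal_le_multiple_epsilon)
      show "6 * D \<ge> 0" using D by simp
      fix e :: real assume e: "e > 0"
      obtain q where q: "schwartz q" "Y_dist g (fourier q) \<le> ennreal e"
        using schwartz_dense[OF g e] by auto
      note [measurable] = fourier_schwartz_measurable[OF q(1)] observed_flow_measurable[OF q(1)]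
      let ?y = "Y_dist (G n) g"
      have "obs_dist T (Obs (G n)) (Obs g)
        \<le> 2 * obs_dist T (Obs (G n)) (observed_flow T q) + 2 * obs_dist T (observed_flow T q) (Obs g)"
        by (rule obs_energy_triangle) measurable
      also have "\<dots> \<le> 2 * (ennreal D * (2 * ?y + 2 * ennreal e)) + 2 * (ennreal D * ennreal e)"
      proof (intro add_mono mult_left_mono)
        have "obs_dist T (Obs (G n)) (observed_flow T q) \<le> ennreal D * Y_dist (G n) (fourier q)"
          by (rule Ob[OF G[rule_format] q(1)])
        also have "\<dots> \<le> ennreal D * (2 * ?y + 2 * Y_dist g (fourier q))"
          by (intro mult_left_mono Y_norm2_triangle) auto
        also have "\<dots> \<le> ennreal D * (2 * ?y + 2 * ennreal e)"
          by (intro mult_left_mono add_left_mono q(2)) auto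
        finally show "obs_dist T (Obs (G n)) (observed_flow T q) \<le> ennreal D * (2 * ?y + 2 * ennreal e)" .
        have "obs_dist T (Obs g) (observed_flow T q) \<le> ennreal D * ennreal e"
          by (intro order.trans[OF Ob[OF g q(1)]] mult_left_mono q(2)) auto
        then show "obs_dist T (observed_flow T q) (Obs g) \<le> ennreal D * ennreal e"
          by (subst obs_energy_commute)
      qed auto
      also have "\<dots> = 2 * (ennreal D * (2 * ?y)) + (2 * (ennreal D * (2 * ennreal e)) + 2 * (ennreal D * ennreal e))"
        by (simp only: distrib_left ac_simps)
      also have "2 * (ennreal D * (2 * ?y)) = ennreal (4 * D) * ?y"
        using D by (simp add: ennreal_mult mult_ac)
      also have "2 * (ennreal D * (2 * ennreal e)) + 2 * (ennreal D * ennreal e) = ennreal (6 * D * e)"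
      proof -
        have "2 * (ennreal D * (2 * ennreal e)) = ennreal (4 * D * e)" "2 * (ennreal D * ennreal e) = ennreal (2 * D * e)"
          using D e by (simp_all add: ennreal_mult mult_ac)
        then show ?thesis using D e by (simp flip: ennreal_plus)
      qed
      finally show "obs_dist T (Obs (G n)) (Obs g) \<le> ennreal (4 * D) * ?y + ennreal (6 * D * e)" .
    qed
    have "(\<lambda>n. ennreal (4 * D) * Y_dist (G n) g) \<longlonglongrightarrow> ennreal (4 * D) * 0"
      by (rule ennreal_tendsto_cmult[OF _ lim]) simp
    then have up: "(\<lambda>n. ennreal (4 * D) * Y_dist (G n) g) \<longlonglongrightarrow> 0" by simp
    show "(\<lambda>n. obs_dist T (Obs (G n)) (Obs g)) \<longlonglongrightarrow> 0"
      by (rule tendsto_sandwich[OF _ _ tendsto_const up]) (use le in auto)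
  qed
  then show ?thesis by blast
qed

lemma is_observation_map_observation:
  "T > 0 \<Longrightarrow> is_observation_map A B K T (observation A B K T)"
  unfolding observation_def by (rule someI_ex[OF observation_map_exists])

text \<open>Valid for any admissible choice of the extension: both quantities are continuous along Schwartz
  approximations of \<open>g\<close>, where they agree up to the factor \<open>2\<pi>\<close>.\<close>
lemma observation_energy_equiv:
  assumes T: "T > 0" and Obs: "is_observation_map A B K T Obs" and g: "g \<in> Y_space A B K"
  shows "freq_energy T g \<le> ennreal (8 * pi) * obs_energy T (Obs g)"
    and "obs_energy T (Obs g) \<le> 4 * freq_energy T g"
proof -
  obtain C where C: "C > 0" and fC: "\<And>g. g \<in> borel_measurable borel \<Longrightarrow>
      freq_energy T g \<le> ennreal (C * (T * max 1 (T ^ (2 * K)))) * Y_norm2 g"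
    using freq_energy_bounds T by metis
  define D where "D = C * (T * max 1 (T ^ (2 * K)))"
  have "\<forall>n. \<exists>q. schwartz q \<and> Y_dist g (fourier q) \<le> ennreal ((1 / 4) ^ n)"
    by (intro allI schwartz_dense g) simp
  from choice[OF this] obtain Q where Q: "\<And>n. schwartz (Q n)" "\<And>n. Y_dist g (fourier (Q n)) \<le> ennreal ((1 / 4) ^ n)"
    by blast
  have YQ: "fourier (Q n) \<in> Y_space A B K" for n by (rule fourier_schwartz_in_Y_space[OF Q(1)])
  have Om: "Obs g \<in> borel_measurable borel" if "g \<in> Y_space A B K" for g
    using Obs that unfolding is_observation_map_def by simp
  note [measurable] = Y_space_measurable[OF g] Om[OF g] Om[OF YQ] fourier_schwartz_measurable[OF Q(1)] observed_flow_measurable[OF Q(1)]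
  have "(\<lambda>n. ennreal ((1 / 4) ^ n)) \<longlonglongrightarrow> ennreal 0"
    by (intro tendsto_ennrealI LIMSEQ_power_zero) simp
  then have lim4: "(\<lambda>n. ennreal ((1 / 4) ^ n)) \<longlonglongrightarrow> 0" by simp
  have Ylim: "(\<lambda>n. Y_dist g (fourier (Q n))) \<longlonglongrightarrow> 0"
    by (rule tendsto_sandwich[OF _ _ tendsto_const lim4]) (use Q(2) in auto)
  have "\<forall>g\<in>Y_space A B K. \<forall>G. (\<forall>n. G n \<in> Y_space A B K) \<longrightarrow>
        (\<lambda>n. Y_dist (G n) g) \<longlonglongrightarrow> 0 \<longrightarrow>
        (\<lambda>n. obs_dist T (Obs (G n)) (Obs g)) \<longlonglongrightarrow> 0"
    using Obs unfolding is_observation_map_def by blast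
  from this[rule_format, OF g, of "\<lambda>n. fourier (Q n)"]
  have "(\<lambda>n. obs_dist T (Obs (fourier (Q n))) (Obs g)) \<longlonglongrightarrow> 0"
    using YQ Ylim by (simp add: Y_norm2_commute[of g])
  moreover have "obs_dist T (Obs (fourier (Q n))) (Obs g) = obs_dist T (observed_flow T (Q n)) (Obs g)" for n
  proof (rule AE_strip_obs_energy_cong)
    show "AE z in lborel. z \<in> {0<..<T} \<times> UNIV \<longrightarrow> Obs (fourier (Q n)) z = observed_flow T (Q n) z"
      using Obs Q(1)[of n] adjoint_flow_solution[OF Q(1)[of n]] unfolding is_observation_map_def observed_flow_def by blast
  qed measurable
  ultimately have Elim: "(\<lambda>n. obs_dist T (observed_flow T (Q n)) (Obs g)) \<longlonglongrightarrow> 0" by simp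
  have "(\<lambda>n. ennreal D * Y_dist g (fourier (Q n))) \<longlonglongrightarrow> ennreal D * 0"
    by (rule ennreal_tendsto_cmult[OF _ Ylim]) simp
  then have DY: "(\<lambda>n. ennreal D * Y_dist g (fourier (Q n))) \<longlonglongrightarrow> 0" by simp
  have Flim: "(\<lambda>n. freq_energy T (\<lambda>\<xi>. g \<xi> - fourier (Q n) \<xi>)) \<longlonglongrightarrow> 0"
    by (rule tendsto_sandwich[OF _ _ tendsto_const DY]) (auto simp: D_def intro!: always_eventually fC)
  have FE: "ennreal (2 * pi) * obs_energy T (observed_flow T (Q n)) = freq_energy T (fourier (Q n))" for n
    by (rule obs_energy_observed_flow[OF Q(1) T])
  show "freq_energy T g \<le> ennreal (8 * pi) * obs_energy T (Obs g)"
  proof (rule LIMSEQ_le_const)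
    let ?u = "\<lambda>n. ennreal (8 * pi) * obs_energy T (Obs g) + (ennreal (8 * pi) * obs_dist T (observed_flow T (Q n)) (Obs g)
       + 2 * freq_energy T (\<lambda>\<xi>. g \<xi> - fourier (Q n) \<xi>))"
    have "?u \<longlonglongrightarrow> ennreal (8 * pi) * obs_energy T (Obs g) + (ennreal (8 * pi) * 0 + 2 * 0)"
      by (intro tendsto_add tendsto_const ennreal_tendsto_cmult Elim Flim) auto
    then show "?u \<longlonglongrightarrow> ennreal (8 * pi) * obs_energy T (Obs g)" by simp
    have "freq_energy T g \<le> ?u n" for n
    proof -
      let ?e = "obs_dist T (observed_flow T (Q n)) (Obs g)"
      have F: "freq_energy T (fourier (Q n)) \<le> ennreal (2 * pi) * (2 * ?e + 2 * obs_energy T (Obs g))"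
        unfolding FE[symmetric] by (intro mult_left_mono obs_energy_triangle0) auto
      have "freq_energy T g \<le> 2 * freq_energy T (fourier (Q n)) + 2 * freq_energy T (\<lambda>\<xi>. g \<xi> - fourier (Q n) \<xi>)"
        by (rule freq_energy_triangle[OF _ _ T]) measurable
      also have "\<dots> \<le> 2 * (ennreal (2 * pi) * (2 * ?e + 2 * obs_energy T (Obs g))) + 2 * freq_energy T (\<lambda>\<xi>. g \<xi> - fourier (Q n) \<xi>)"
        by (intro add_right_mono mult_left_mono F) auto
      also have "\<dots> = ?u n"
      proof -
        have *: "2 * (ennreal (2 * pi) * (2 * x)) = ennreal (8 * pi) * x" for x
          by (simp add: ennreal_mult mult_ac)
        have "2 * (ennreal (2 * pi) * (2 * x + 2 * y)) = ennreal (8 * pi) * y + ennreal (8 * pi) * x" for x y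
          unfolding distrib_left * by (rule add.commute)
        then show ?thesis by (simp only: add.assoc)
      qed
      finally show ?thesis .
    qed
    then show "\<exists>N. \<forall>n\<ge>N. freq_energy T g \<le> ?u n" by blast
  qed
  show "obs_energy T (Obs g) \<le> 4 * freq_energy T g"
  proof (rule LIMSEQ_le_const)
    let ?u = "\<lambda>n. 4 * freq_energy T g + (4 * freq_energy T (\<lambda>\<xi>. g \<xi> - fourier (Q n) \<xi>) + 2 * obs_dist T (observed_flow T (Q n)) (Obs g))"
    have "?u \<longlonglongrightarrow> 4 * freq_energy T g + (4 * 0 + 2 * 0)"
      by (intro tendsto_add tendsto_const ennreal_tendsto_cmult Elim Flim) auto
    then show "?u \<longlonglongrightarrow> 4 * freq_energy T g" by simp
    have "obs_energy T (Obs g) \<le> ?u n" for n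
    proof -
      let ?e = "obs_dist T (observed_flow T (Q n)) (Obs g)"
      have "obs_energy T (Obs g) \<le> 2 * obs_dist T (Obs g) (observed_flow T (Q n)) + 2 * obs_energy T (observed_flow T (Q n))"
        by (rule obs_energy_triangle0) measurable
      also have "\<dots> \<le> 2 * ?e + 2 * (2 * freq_energy T g + 2 * freq_energy T (\<lambda>\<xi>. g \<xi> - fourier (Q n) \<xi>))"
      proof (intro add_mono mult_left_mono)
        show "obs_dist T (Obs g) (observed_flow T (Q n)) \<le> ?e"
          by (rule eq_refl[OF obs_energy_commute])
        have "obs_energy T (observed_flow T (Q n)) \<le> freq_energy T (fourier (Q n))"
          by (rule obs_energy_observed_flow_le[OF T Q(1)])
        also have "\<dots> \<le> 2 * freq_energy T g + 2 * freq_energy T (\<lambda>\<xi>. fourier (Q n) \<xi> - g \<xi>)"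
          by (rule freq_energy_triangle[OF _ _ T]) measurable
        also have "freq_energy T (\<lambda>\<xi>. fourier (Q n) \<xi> - g \<xi>) = freq_energy T (\<lambda>\<xi>. g \<xi> - fourier (Q n) \<xi>)"
          unfolding freq_energy_def energy_density_def obs_evol_def obs_spec_diff by (simp add: norm_minus_commute)
        finally show "obs_energy T (observed_flow T (Q n)) \<le> 2 * freq_energy T g + 2 * freq_energy T (\<lambda>\<xi>. g \<xi> - fourier (Q n) \<xi>)" .
      qed auto
      also have "\<dots> = ?u n"
      proof -
        have *: "2 * (2 * x) = 4 * x" for x :: ennreal by (simp add: mult.assoc[symmetric])
        have "2 * z + 2 * (2 * x + 2 * y) = 4 * x + (4 * y + 2 * z)" for x y z :: ennreal
          unfolding distrib_left * by (simp only: ac_simps)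
        then show ?thesis .
      qed
      finally show ?thesis .
    qed
    then show "\<exists>N. \<forall>n\<ge>N. obs_energy T (Obs g) \<le> ?u n" by blast
  qed
qed

end

section \<open>Observability and its optimal dependence on time\<close>

lemma inverse_time_factor:
  assumes "T > (0::real)"
  shows "max (1 / T) (1 / T ^ (2 * K + 1)) = 1 / (T * min 1 (T ^ (2 * K)))"
proof (cases "T ^ (2 * K) \<le> 1")
  case True
  then have "T * T ^ (2 * K) \<le> T" using assms by (simp add: mult_left_le)
  then have "1 / T \<le> 1 / (T * T ^ (2 * K))" using assms by (intro divide_left_mono) auto
  with True show ?thesis by (simp add: min_def max_def)
next
  case False
  then have "T \<le> T * T ^ (2 * K)" using assms by simp
  then have "1 / (T * T ^ (2 * K)) \<le> 1 / T" using assms by (intro divide_left_mono) auto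
  with False show ?thesis by (simp add: min_def max_def)
qed

text \<open>The set of admissible constants is closed, because observed energies are finite, so the least
  element in the definition exists.\<close>
lemma C_obs_attained:
  assumes fin: "\<And>g. g \<in> Y_space A B K \<Longrightarrow> obs_energy T (observation A B K T g) < \<infinity>"
    and ex: "0 \<le> C0" "observability_inequality A B K T C0"
  shows "0 \<le> C_obs A B K T \<and> observability_inequality A B K T (C_obs A B K T)"
proof -
  define S where "S = {C. 0 \<le> C \<and> observability_inequality A B K T C}"
  have S0: "C0 \<in> S" using ex by (simp add: S_def)
  have bd: "bdd_below S" by (rule bdd_belowI[of _ 0]) (simp add: S_def)
  define m where "m = Inf S"
  have m0: "0 \<le> m" unfolding m_def by (rule cInf_greatest) (use S0 in \<open>auto simp: S_def\<close>)
  have lower: "m \<le> C" if "C \<in> S" for C unfolding m_def by (rule cInf_lower[OF that bd])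
  have "observability_inequality A B K T m"
    unfolding observability_inequality_def
  proof
    fix g assume g: "g \<in> Y_space A B K"
    let ?E = "obs_energy T (observation A B K T g)"
    show "Y_sqnorm A B K g \<le> ennreal m * ?E"
    proof (rule LIMSEQ_le_const)
      have "(\<lambda>n. ennreal (m + 1 / real (Suc n))) \<longlonglongrightarrow> ennreal (m + 0)"
        by (intro tendsto_ennrealI tendsto_add tendsto_const LIMSEQ_Suc[OF lim_1_over_n])
      then have "(\<lambda>n. ?E * ennreal (m + 1 / real (Suc n))) \<longlonglongrightarrow> ?E * ennreal (m + 0)"
        by (rule ennreal_tendsto_cmult[OF fin[OF g, unfolded infinity_ennreal_def]])
      then show "(\<lambda>n. ennreal (m + 1 / real (Suc n)) * ?E) \<longlonglongrightarrow> ennreal m * ?E"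
        by (simp only: mult.commute add_0_right)
      have "Y_sqnorm A B K g \<le> ennreal (m + 1 / real (Suc n)) * ?E" for n
      proof -
        have "Inf S < m + 1 / real (Suc n)" unfolding m_def by simp
        then obtain C where C: "C \<in> S" "C < m + 1 / real (Suc n)"
          using cInf_lessD[of S] S0 by blast
        have "Y_sqnorm A B K g \<le> ennreal C * ?E"
          using C(1) g by (simp add: S_def observability_inequality_def)
        also have "\<dots> \<le> ennreal (m + 1 / real (Suc n)) * ?E"
          using C(2) by (intro mult_right_mono ennreal_leI) auto
        finally show ?thesis .
      qed
      then show "\<exists>N. \<forall>n\<ge>N. Y_sqnorm A B K g \<le> ennreal (m + 1 / real (Suc n)) * ?E" by blast
    qed
  qed
  moreover have "C_obs A B K T = m"
    unfolding C_obs_def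
    by (rule Least_equality) (use m0 calculation lower in \<open>auto simp: S_def\<close>)
  ultimately show ?thesis using m0 by simp
qed

context kalman_pair
begin

text \<open>A vector of the top layer carries only the smallest of the weights, which makes it the worst case.\<close>
lemma top_layer_vector: "\<exists>v. v \<noteq> 0 \<and> (\<forall>\<theta>. layer_norm \<theta> v = kalman_weight K \<theta> * (norm v)\<^sup>2)"
proof -
  obtain x where x: "x \<in> kalman_layer A B K" "x \<noteq> 0" using kalman_layer_nonzero[OF index] by blast
  define v :: "complex^'n" where "v = (\<chi> i. of_real (x $ i))"
  have Re: "vec_Re v = x" and Im: "vec_Im v = 0" by (simp_all add: v_def vec_eq_iff)
  have v0: "v \<noteq> 0" using x(2) Re by auto
  have p: "kalman_proj A B K v = v"
    using orth_proj_id[OF subspace_kalman_layer x(1)] linear_0[OF linear_orth_proj[OF subspace_kalman_layer]]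
    by (simp add: vec_complex_eq_iff kalman_proj_def Re Im)
  have "layer_norm \<theta> v = kalman_weight K \<theta> * (norm v)\<^sup>2" for \<theta>
  proof -
    have "layer_norm \<theta> v = (\<Sum>k\<le>K. if k = K then kalman_weight K \<theta> * (norm v)\<^sup>2 else 0)"
      unfolding layer_norm_def
    proof (intro sum.cong refl)
      fix k
      show "kalman_weight k \<theta> * (norm (kalman_proj A B k v))\<^sup>2 = (if k = K then kalman_weight K \<theta> * (norm v)\<^sup>2 else 0)"
        using kalman_proj_kalman_proj[of A B k K v] by (auto simp: p)
    qed
    then show ?thesis by simp
  qed
  with v0 show ?thesis by blast
qed

theorem observability:
  "\<exists>C>0. \<forall>T>0. \<forall>g\<in>Y_space A B K.
     Y_norm2 g \<le> ennreal (C * max (1 / T) (1 / T ^ (2 * K + 1))) * obs_energy T (observation A B K T g)"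
proof -
  obtain c where c: "c > 0" and lower: "\<And>T g. T > 0 \<Longrightarrow> g \<in> borel_measurable borel \<Longrightarrow>
      ennreal (c * (T * min 1 (T ^ (2 * K)))) * Y_norm2 g \<le> freq_energy T g"
    using freq_energy_bounds by metis
  have "Y_norm2 g \<le> ennreal ((8 * pi / c) * max (1 / T) (1 / T ^ (2 * K + 1))) * obs_energy T (observation A B K T g)"
    if T: "T > 0" and g: "g \<in> Y_space A B K" for T g
  proof -
    define l where "l = c * (T * min 1 (T ^ (2 * K)))"
    have l: "l > 0" using c T by (auto simp: l_def)
    have "Y_norm2 g = ennreal (1 / l) * (ennreal l * Y_norm2 g)"
      using l by (simp add: mult.assoc[symmetric] flip: ennreal_mult)
    also have "\<dots> \<le> ennreal (1 / l) * (ennreal (8 * pi) * obs_energy T (observation A B K T g))"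
      by (intro mult_left_mono order.trans[OF lower[OF T, folded l_def, OF Y_space_measurable[OF g]]
          observation_energy_equiv(1)[OF T is_observation_map_observation[OF T] g]]) auto
    also have "\<dots> = ennreal (1 / l * (8 * pi)) * obs_energy T (observation A B K T g)"
      using l by (subst ennreal_mult) (auto simp: mult.assoc)
    also have "1 / l * (8 * pi) = (8 * pi / c) * max (1 / T) (1 / T ^ (2 * K + 1))"
      unfolding inverse_time_factor[OF T] l_def by simp
    finally show ?thesis .
  qed
  then show ?thesis using c by (intro exI[of _ "8 * pi / c"]) auto
qed

text \<open>For a vector of the top layer and frequencies in \<open>[1, 2]\<close> the weighted norm is independent of \<open>T\<close>,
  whereas the Gramian at frequency \<open>T\<xi>\<close> is at most of order \<open>min(1, T\<^bsup>2K\<^esup>)\<close>.\<close>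
theorem observability_optimal:
  "\<exists>c>0. \<forall>T>0. C_obs A B K T \<ge> c * max (1 / T) (1 / T ^ (2 * K + 1))"
proof -
  obtain C0 where C0: "C0 > 0" and obs: "\<And>T g. T > 0 \<Longrightarrow> g \<in> Y_space A B K \<Longrightarrow>
     Y_norm2 g \<le> ennreal (C0 * max (1 / T) (1 / T ^ (2 * K + 1))) * obs_energy T (observation A B K T g)"
    using observability by blast
  obtain C where C: "C > 0" and up: "\<And>T v \<xi>. T > 0 \<Longrightarrow> T * energy_density (T * \<xi>) v \<le> C * T * layer_norm (T * \<xi>) v"
    using freq_energy_bounds by metis
  obtain v where v: "v \<noteq> 0" "\<And>\<theta>. layer_norm \<theta> v = kalman_weight K \<theta> * (norm v)\<^sup>2"
    using top_layer_vector by blast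
  \<comment> \<open>On \<open>[1, 2]\<close> all weights equal one, so that the weighted norm of \<open>g\<close> is \<open>|v|\<close>.\<close>
  define g where "g \<xi> = (if \<xi> \<in> {1..2::real} then v else 0)" for \<xi>
  have gm[measurable]: "g \<in> borel_measurable borel" unfolding g_def[abs_def] by measurable
  have Yg: "Y_norm2 g = ennreal ((norm v)\<^sup>2)"
  proof -
    have "Y_norm2 g = (\<integral>\<^sup>+\<xi>. ennreal ((norm v)\<^sup>2) * indicator {1..2::real} \<xi> \<partial>lborel)"
      unfolding Y_norm2_eq[OF gm]
    proof (intro nn_integral_cong)
      fix \<xi> :: real
      have "kalman_weight K \<xi> = 1" if "\<xi> \<ge> 1" using that by (simp add: kalman_weight_def min_def one_le_power antisym)
      then show "ennreal (layer_norm \<xi> (g \<xi>)) = ennreal ((norm v)\<^sup>2) * indicator {1..2} \<xi>"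
        by (auto simp: g_def indicator_def v(2) layer_norm_0)
    qed
    also have "\<dots> = ennreal ((norm v)\<^sup>2)" by (simp add: nn_integral_cmult_indicator)
    finally show ?thesis .
  qed
  have gY: "g \<in> Y_space A B K" using gm by (simp add: Y_space_def Yg)
  have "C_obs A B K T \<ge> 1 / (4 * C * 4 ^ K) * max (1 / T) (1 / T ^ (2 * K + 1))" if T: "T > 0" for T
  proof -
    let ?l = "T * min 1 (T ^ (2 * K))" and ?N = "(norm v)\<^sup>2"
    have l: "?l > 0" using T by auto
    have N: "?N > 0" using v(1) by simp
    note om = is_observation_map_observation[OF T]
    have attained: "0 \<le> C_obs A B K T \<and> observability_inequality A B K T (C_obs A B K T)"
    proof (rule C_obs_attained)
      show "obs_energy T (observation A B K T g) < \<infinity>" if "g \<in> Y_space A B K" for g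
        using om that unfolding is_observation_map_def by blast
      show "0 \<le> C0 * max (1 / T) (1 / T ^ (2 * K + 1))" using C0 T by (simp add: max_def)
      show "observability_inequality A B K T (C0 * max (1 / T) (1 / T ^ (2 * K + 1)))"
        unfolding observability_inequality_def using obs[OF T] by blast
    qed
    have "freq_energy T g \<le> (\<integral>\<^sup>+\<xi>. ennreal (C * 4 ^ K * ?l * ?N) * indicator {1..2::real} \<xi> \<partial>lborel)"
      unfolding freq_energy_def
    proof (intro nn_integral_mono)
      fix \<xi> :: real
      show "ennreal (T * energy_density (T * \<xi>) (g \<xi>)) \<le> ennreal (C * 4 ^ K * ?l * ?N) * indicator {1..2} \<xi>"
      proof (cases "\<xi> \<in> {1..2}")
        case True
        have w: "kalman_weight K (T * \<xi>) \<le> 4 ^ K * min 1 (T ^ (2 * K))"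
        proof -
          have "\<bar>\<xi>\<bar> ^ (2 * K) \<le> 2 ^ (2 * K)" using True by (intro power_mono) auto
          then have x: "\<bar>\<xi>\<bar> ^ (2 * K) \<le> 4 ^ K" by (simp add: power_mult)
          have "kalman_weight K (T * \<xi>) \<le> \<bar>\<xi>\<bar> ^ (2 * K) * T ^ (2 * K)"
            by (rule kalman_weight_scale(3)[OF T order.refl])
          also have "\<dots> \<le> 4 ^ K * T ^ (2 * K)" using x T by (intro mult_right_mono) auto
          finally have "kalman_weight K (T * \<xi>) \<le> 4 ^ K * T ^ (2 * K)" .
          moreover have "kalman_weight K (T * \<xi>) \<le> 4 ^ K * 1"
            using order.trans[OF kalman_weight_bounds(2)[of K "T * \<xi>"], of "4 ^ K"] by simp
          ultimately show ?thesis by (simp add: min_def)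
        qed
        have "T * energy_density (T * \<xi>) v \<le> C * T * (kalman_weight K (T * \<xi>) * ?N)"
          using up[OF T, of \<xi> v] by (simp add: v(2))
        also have "\<dots> \<le> C * T * ((4 ^ K * min 1 (T ^ (2 * K))) * ?N)"
          using w C T by (intro mult_left_mono mult_right_mono) auto
        also have "\<dots> = C * 4 ^ K * ?l * ?N" by (simp only: mult_ac)
        finally show ?thesis using True by (simp add: g_def ennreal_leI)
      next
        case False
        have "T * energy_density (T * \<xi>) 0 \<le> 0" using up[OF T, of \<xi> 0] by (simp add: layer_norm_0)
        then have "ennreal (T * energy_density (T * \<xi>) 0) = 0" by (rule ennreal_neg)
        moreover have "g \<xi> = 0" using False unfolding g_def by (rule if_not_P)
        ultimately show ?thesis by simp
      qed
    qed
    also have "\<dots> = ennreal (C * 4 ^ K * ?l * ?N)" by (simp add: nn_integral_cmult_indicator)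
    finally have F: "freq_energy T g \<le> ennreal (C * 4 ^ K * ?l * ?N)" .
    have "ennreal ?N \<le> ennreal (C_obs A B K T) * obs_energy T (observation A B K T g)"
      using attained gY Yg unfolding observability_inequality_def by metis
    also have "\<dots> \<le> ennreal (C_obs A B K T) * (4 * ennreal (C * 4 ^ K * ?l * ?N))"
      by (intro mult_left_mono order.trans[OF observation_energy_equiv(2)[OF T om gY]] F) auto
    also have "\<dots> = ennreal (C_obs A B K T * (4 * (C * 4 ^ K * ?l * ?N)))"
      using attained C l N by (simp add: ennreal_numeral_mult ennreal_mult)
    finally have "?N \<le> C_obs A B K T * (4 * (C * 4 ^ K * ?l * ?N))"
      using attained C l N by (subst (asm) ennreal_le_iff) auto
    then have "1 \<le> C_obs A B K T * (4 * (C * 4 ^ K * ?l))"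
      using N by (simp add: mult.assoc[symmetric])
    then have "1 / (4 * (C * 4 ^ K * ?l)) \<le> C_obs A B K T"
      using C l by (simp add: divide_le_eq)
    then show ?thesis unfolding inverse_time_factor[OF T] by (simp add: mult_ac)
  qed
  then show ?thesis using C by (intro exI[of _ "1 / (4 * C * 4 ^ K)"]) auto
qed

end

theorem theorem2p1:
  fixes A :: "real^'n^'n" and B :: "real^'m^'n" and K :: nat
  assumes "CARD('m) \<le> CARD('n)"
    and "diagonalizable_over_reals A"
    and "kalman_index A B K"
  shows "(\<exists>C>0. \<forall>T>0. \<forall>g\<in>Y_space A B K.
            Y_sqnorm A B K g
              \<le> ennreal (C * max (1 / T) (1 / T ^ (2 * K + 1)))
                 * obs_energy T (observation A B K T g))
       \<and> (\<exists>c>0. \<forall>T>0. C_obs A B K T \<ge> c * max (1 / T) (1 / T ^ (2 * K + 1)))"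
proof -
  obtain P D :: "real^'n^'n" where PD: "invertible P" "\<And>i j. i \<noteq> j \<Longrightarrow> D $ i $ j = 0" "A = P ** D ** matrix_inv P"
    using assms(2) unfolding diagonalizable_over_reals_def by blast
  have "D = (\<chi> i j. if i = j then D $ i $ i else 0)" using PD(2) by (auto simp: vec_eq_iff)
  then interpret kalman_pair A B P "\<lambda>i. D $ i $ i" K
    using PD assms(3) by unfold_locales auto
  show ?thesis using observability observability_optimal by blast
qed

end
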